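(* The semibranching function system $\{\tau_{(i,j)}\}$, for $(i,j)\in\{0,\dots,N-1\}^2$ with $A_{ij}=1$, determines a representation of the Cuntz algebra $O_D$ on the Hilbert space $L^2(\mathbb{S}_A,\mu)$, with $\mu$ the Hausdorff measure of dimension $$\delta=\dim_H(\mathbb{S}_A)=\frac{\log D}{2\log N}.$$
   Context: Let $A=(A_{ij})_{i,j=0,\dots,N-1}$ be an $N\times N$ matrix with entries in $\{0,1\}$, and let $D=\sum_{i=0}^{N-1}d_i$ with $d_i=\#\{j:A_{ij}=1\}$. The Sierpinski fractal $\mathbb{S}_A\subset[0,1]\times[0,1]$ is the set of points $(x,y)=\left(\sum_{k\ge1}x_kN^{-k},\sum_{k\ge1}y_kN^{-k}\right)$ whose $N$-adic digits $x_k,y_k\in\{0,\dots,N-1\}$ satisfy $A_{x_k,y_k}=1$ for all $k\ge1$. For $(i,j)$ with $A_{ij}=1$, the everywhere defined map $\tau_{(i,j)}:\mathbb{S}_A\to\mathbb{S}_A$ is $\tau_{(i,j)}(x,y)=\left(\frac{x+i}{N},\frac{y+j}{N}\right)$. The coding map $\tau:\mathbb{S}_A\to\mathbb{S}_A$ is the shift $\tau(0.x_1x_2x_3\cdots,\,0.y_1y_2y_3\cdots)=(0.x_2x_3\cdots,\,0.y_2y_3\cdots)$. A semibranching function system on a measure space $(X,\mu)$ is a finite family of measurable maps $\sigma_i:D_i\to X$ defined on measurable subsets $D_i\subset X$, with ranges $R_i=\sigma_i(D_i)$ such that $\mu(X\smallsetminus\cup_iR_i)=0$ and $\mu(R_i\cap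 R_j)=0$ for $i\ne j$, and with Radon–Nikodym derivative $\Phi_{\sigma_i}=d(\mu\circ\sigma_i)/d\mu>0$ $\mu$-almost everywhere on $D_i$; a coding map is a measurable $\sigma:X\to X$ with $\sigma\circ\sigma_i(x)=x$ for all $x\in D_i$. To such a system with coding map $\sigma$ one associates the operators $(T_i\psi)(x)=\chi_{R_i}(x)\,\Phi_{\sigma_i}(\sigma(x))^{-1/2}\,\psi(\sigma(x))$ on $L^2(X,\mu)$. The Cuntz algebra $O_D$ is the $C^*$-algebra generated by $D$ elements $S_\alpha$ with $S_\alpha^*S_\alpha=1$ and $\sum_\alpha S_\alpha S_\alpha^*=1$.
   Formalization: The Hausdorff dimension of S_A is corrected to log D/log N, twice the displayed δ (δ results if covering sets are measured by squared diameter); μ is the Hausdorff measure of that dimension, and the coding map identity is required only μ-almost everywhere. *)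

theory Defs
  imports "HOL-Analysis.Analysis"
begin

section \<open>Hausdorff measure and dimension\<close>

text \<open>
  The size function \<open>g\<close> by which covering sets are measured is a parameter. The usual
  notions are those with \<open>g = diameter\<close>. The other case of interest is \<open>diam_area\<close>, which
  assigns to a set the area of a square whose side is its diameter.
  The convention is \<open>0\<^sup>0 = 1\<close> for nonempty sets (whereas \<open>0 powr 0 = 0\<close>), so that
  the 0-dimensional measure is the counting measure. No normalising constant is used.
  Covering sets are required to be bounded because \<open>diameter\<close> is unspecified otherwise.
\<close>

definition size_powr :: "('a set \<Rightarrow> real) \<Rightarrow> real \<Rightarrow> 'a set \<Rightarrow> ennreal" where
  "size_powr g s U = (if U = {} then 0 else if s = 0 then 1 else ennreal (g U powr s))"

definition hausdorff_premeasure ::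
    "('a::metric_space set \<Rightarrow> real) \<Rightarrow> real \<Rightarrow> real \<Rightarrow> 'a set \<Rightarrow> ennreal" where
  "hausdorff_premeasure g s \<epsilon> E =
     (INF U\<in>{U :: nat \<Rightarrow> 'a set. E \<subseteq> (\<Union>n. U n) \<and> (\<forall>n. bounded (U n) \<and> g (U n) \<le> \<epsilon>)}.
        \<Sum>n. size_powr g s (U n))"

definition hausdorff_outer ::
    "('a::metric_space set \<Rightarrow> real) \<Rightarrow> real \<Rightarrow> 'a set \<Rightarrow> ennreal" where
  "hausdorff_outer g s E = (SUP \<epsilon>\<in>{0<..}. hausdorff_premeasure g s \<epsilon> E)"

definition hausdorff_measure_wrt ::
    "('a::metric_space set \<Rightarrow> real) \<Rightarrow> real \<Rightarrow> 'a measure" where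
  "hausdorff_measure_wrt g s = measure_of UNIV (sets borel) (hausdorff_outer g s)"

definition hausdorff_dim_wrt :: "('a::metric_space set \<Rightarrow> real) \<Rightarrow> 'a set \<Rightarrow> ereal" where
  "hausdorff_dim_wrt g E = (INF s\<in>{s. 0 \<le> s \<and> hausdorff_outer g s E = 0}. ereal s)"

abbreviation hausdorff_measure :: "real \<Rightarrow> 'a::metric_space measure" where
  "hausdorff_measure \<equiv> hausdorff_measure_wrt diameter"

abbreviation hausdorff_dim :: "'a::metric_space set \<Rightarrow> ereal" where
  "hausdorff_dim \<equiv> hausdorff_dim_wrt diameter"

definition diam_area :: "'a::metric_space set \<Rightarrow> real" where
  "diam_area U = (diameter U)\<^sup>2"


section \<open>The Sierpinski fractal of a 0-1 matrix\<close>

definition allowed :: "nat \<Rightarrow> (nat \<Rightarrow> nat \<Rightarrow> nat) \<Rightarrow> (nat \<times> nat) set" where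
  "allowed N A = {(i, j). i < N \<and> j < N \<and> A i j = 1}"

definition sierp_D :: "nat \<Rightarrow> (nat \<Rightarrow> nat \<Rightarrow> nat) \<Rightarrow> nat" where
  "sierp_D N A = (\<Sum>i<N. card {j. j < N \<and> A i j = 1})"

text \<open>Digit sequences are indexed from 0, so digit \<open>k\<close> has weight \<open>N\<close> to the power \<open>-(k + 1)\<close>.\<close>

definition nadic :: "nat \<Rightarrow> (nat \<Rightarrow> nat) \<Rightarrow> real" where
  "nadic N xs = (\<Sum>k. real (xs k) / real N ^ Suc k)"

definition admissible :: "nat \<Rightarrow> (nat \<Rightarrow> nat \<Rightarrow> nat) \<Rightarrow> (nat \<Rightarrow> nat) \<Rightarrow> (nat \<Rightarrow> nat) \<Rightarrow> bool" where
  "admissible N A xs ys \<longleftrightarrow> (\<forall>k. xs k < N \<and> ys k < N \<and> A (xs k) (ys k) = 1)"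

definition sierpinski :: "nat \<Rightarrow> (nat \<Rightarrow> nat \<Rightarrow> nat) \<Rightarrow> (real \<times> real) set" where
  "sierpinski N A = {(nadic N xs, nadic N ys) | xs ys. admissible N A xs ys}"

definition sierp_map :: "nat \<Rightarrow> nat \<times> nat \<Rightarrow> real \<times> real \<Rightarrow> real \<times> real" where
  "sierp_map N ij p =
     ((fst p + real (fst ij)) / real N, (snd p + real (snd ij)) / real N)"

text \<open>
  A point may have several admissible expansions, and then the shift of digits is not
  a well-defined function at that point. Any map that shifts some admissible expansion of every
  point counts as a version of the shift.
\<close>

definition is_digit_shift ::
    "nat \<Rightarrow> (nat \<Rightarrow> nat \<Rightarrow> nat) \<Rightarrow> (real \<times> real \<Rightarrow> real \<times> real) \<Rightarrow> bool" where
  "is_digit_shift N A \<sigma> \<longleftrightarrow>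
     (\<forall>p\<in>sierpinski N A. \<exists>xs ys. admissible N A xs ys \<and>
        p = (nadic N xs, nadic N ys) \<and>
        \<sigma> p = (nadic N (\<lambda>k. xs (Suc k)), nadic N (\<lambda>k. ys (Suc k))))"


section \<open>Semibranching function systems\<close>

definition pulled_measure :: "'a measure \<Rightarrow> 'a set \<Rightarrow> ('a \<Rightarrow> 'a) \<Rightarrow> 'a measure" where
  "pulled_measure M Dm s =
     measure_of (space M) (sets M) (\<lambda>E. emeasure M (s ` (E \<inter> Dm)))"

definition sbfs_deriv :: "'a measure \<Rightarrow> 'a set \<Rightarrow> ('a \<Rightarrow> 'a) \<Rightarrow> 'a \<Rightarrow> ennreal" where
  "sbfs_deriv M Dm s = RN_deriv M (pulled_measure M Dm s)"

text \<open>
  The domain of \<open>s i\<close> is \<open>Dm i\<close>. Existence of the Radon-Nikodym derivative is the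
  \<open>density\<close> equation.
\<close>

definition semibranching_system ::
    "'a measure \<Rightarrow> 'i set \<Rightarrow> ('i \<Rightarrow> 'a set) \<Rightarrow> ('i \<Rightarrow> 'a \<Rightarrow> 'a) \<Rightarrow> bool" where
  "semibranching_system M I Dm s \<longleftrightarrow>
     finite I \<and>
     (\<forall>i\<in>I. Dm i \<in> sets M \<and> s i \<in> measurable (restrict_space M (Dm i)) M \<and>
            (\<forall>E\<in>sets M. E \<subseteq> Dm i \<longrightarrow> s i ` E \<in> sets M)) \<and>
     emeasure M (space M - (\<Union>i\<in>I. s i ` Dm i)) = 0 \<and>
     (\<forall>i\<in>I. \<forall>j\<in>I. i \<noteq> j \<longrightarrow> emeasure M (s i ` Dm i \<inter> s j ` Dm j) = 0) \<and>
     (\<forall>i\<in>I. density M (sbfs_deriv M (Dm i) (s i)) = pulled_measure M (Dm i) (s i) \<and>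
            (AE x in M. x \<in> Dm i \<longrightarrow> sbfs_deriv M (Dm i) (s i) x > 0))"

text \<open>
  The identity is required almost everywhere: ranges may overlap in a null set, and on such an
  overlap no single-valued map can invert two of the \<open>s i\<close> at once.
\<close>

definition coding_map ::
    "'a measure \<Rightarrow> 'i set \<Rightarrow> ('i \<Rightarrow> 'a set) \<Rightarrow> ('i \<Rightarrow> 'a \<Rightarrow> 'a) \<Rightarrow> ('a \<Rightarrow> 'a) \<Rightarrow> bool" where
  "coding_map M I Dm s \<sigma> \<longleftrightarrow>
     \<sigma> \<in> measurable M M \<and> (\<forall>i\<in>I. AE x in M. x \<in> Dm i \<longrightarrow> \<sigma> (s i x) = x)"

definition sbfs_op ::
    "'a measure \<Rightarrow> ('i \<Rightarrow> 'a set) \<Rightarrow> ('i \<Rightarrow> 'a \<Rightarrow> 'a) \<Rightarrow> ('a \<Rightarrow> 'a) \<Rightarrow> 'i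
      \<Rightarrow> ('a \<Rightarrow> complex) \<Rightarrow> 'a \<Rightarrow> complex" where
  "sbfs_op M Dm s \<sigma> i \<psi> x =
     indicator (s i ` Dm i) x *
     complex_of_real (enn2real (sbfs_deriv M (Dm i) (s i) (\<sigma> x)) powr (-1/2)) * \<psi> (\<sigma> x)"


section \<open>Bounded operators on complex \<open>L\<^sup>2\<close>\<close>

text \<open>
  Elements of \<open>L\<^sup>2(M)\<close> are represented by square-integrable functions, equality being equality
  almost everywhere. An operator as defined here respects this equality, by additivity and
  boundedness.
\<close>

definition sq_int :: "'a measure \<Rightarrow> ('a \<Rightarrow> complex) set" where
  "sq_int M = {\<psi>. \<psi> \<in> borel_measurable M \<and> integrable M (\<lambda>x. (cmod (\<psi> x))\<^sup>2)}"

definition l2_inner :: "'a measure \<Rightarrow> ('a \<Rightarrow> complex) \<Rightarrow> ('a \<Rightarrow> complex) \<Rightarrow> complex" where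
  "l2_inner M \<phi> \<psi> = (\<integral>x. \<phi> x * cnj (\<psi> x) \<partial>M)"

definition l2_norm :: "'a measure \<Rightarrow> ('a \<Rightarrow> complex) \<Rightarrow> real" where
  "l2_norm M \<psi> = sqrt (\<integral>x. (cmod (\<psi> x))\<^sup>2 \<partial>M)"

definition l2_operator :: "'a measure \<Rightarrow> (('a \<Rightarrow> complex) \<Rightarrow> 'a \<Rightarrow> complex) \<Rightarrow> bool" where
  "l2_operator M P \<longleftrightarrow>
     (\<forall>\<psi>\<in>sq_int M. P \<psi> \<in> sq_int M) \<and>
     (\<forall>\<phi>\<in>sq_int M. \<forall>\<psi>\<in>sq_int M. AE x in M. P (\<lambda>y. \<phi> y + \<psi> y) x = P \<phi> x + P \<psi> x) \<and>
     (\<forall>c. \<forall>\<psi>\<in>sq_int M. AE x in M. P (\<lambda>y. c * \<psi> y) x = c * P \<psi> x) \<and>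
     (\<exists>C. \<forall>\<psi>\<in>sq_int M. l2_norm M (P \<psi>) \<le> C * l2_norm M \<psi>)"

definition l2_adjoint ::
    "'a measure \<Rightarrow> (('a \<Rightarrow> complex) \<Rightarrow> 'a \<Rightarrow> complex)
      \<Rightarrow> (('a \<Rightarrow> complex) \<Rightarrow> 'a \<Rightarrow> complex) \<Rightarrow> bool" where
  "l2_adjoint M P Q \<longleftrightarrow>
     (\<forall>\<phi>\<in>sq_int M. \<forall>\<psi>\<in>sq_int M. l2_inner M (P \<phi>) \<psi> = l2_inner M \<phi> (Q \<psi>))"

definition l2_eq ::
    "'a measure \<Rightarrow> (('a \<Rightarrow> complex) \<Rightarrow> 'a \<Rightarrow> complex)
      \<Rightarrow> (('a \<Rightarrow> complex) \<Rightarrow> 'a \<Rightarrow> complex) \<Rightarrow> bool" where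
  "l2_eq M P Q \<longleftrightarrow> (\<forall>\<psi>\<in>sq_int M. AE x in M. P \<psi> x = Q \<psi> x)"

definition l2_cuntz_family ::
    "'a measure \<Rightarrow> 'i set \<Rightarrow> ('i \<Rightarrow> ('a \<Rightarrow> complex) \<Rightarrow> 'a \<Rightarrow> complex) \<Rightarrow> bool" where
  "l2_cuntz_family M I T \<longleftrightarrow>
     (\<exists>Ts. (\<forall>i\<in>I. l2_operator M (T i) \<and> l2_operator M (Ts i) \<and> l2_adjoint M (T i) (Ts i) \<and>
                  l2_eq M (\<lambda>\<psi>. Ts i (T i \<psi>)) (\<lambda>\<psi>. \<psi>)) \<and>
           l2_eq M (\<lambda>\<psi> x. \<Sum>i\<in>I. T i (Ts i \<psi>) x) (\<lambda>\<psi>. \<psi>))"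


section \<open>Cuntz algebras and their representations\<close>

locale unital_cstar_algebra =
  fixes cscale :: "complex \<Rightarrow> 'c::{real_normed_algebra_1, banach} \<Rightarrow> 'c"
    and adj :: "'c \<Rightarrow> 'c"
  assumes cscale_add_right: "cscale c (a + b) = cscale c a + cscale c b"
    and cscale_add_left: "cscale (c + d) a = cscale c a + cscale d a"
    and cscale_cscale: "cscale c (cscale d a) = cscale (c * d) a"
    and cscale_of_real: "cscale (complex_of_real r) a = r *\<^sub>R a"
    and cscale_mult_left: "cscale c a * b = cscale c (a * b)"
    and cscale_mult_right: "a * cscale c b = cscale c (a * b)"
    and norm_cscale: "norm (cscale c a) = cmod c * norm a"
    and adj_adj: "adj (adj a) = a"
    and adj_add: "adj (a + b) = adj a + adj b"
    and adj_cscale: "adj (cscale c a) = cscale (cnj c) (adj a)"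
    and adj_mult: "adj (a * b) = adj b * adj a"
    and cstar_identity: "norm (adj a * a) = (norm a)\<^sup>2"

text \<open>
  The free unital *-algebra on the index set \<open>I\<close>: finitely supported functions on words, the
  letter \<open>(i, False)\<close> being the \<open>i\<close>-th generator and \<open>(i, True)\<close> its adjoint.
\<close>

type_synonym 'i star_word = "('i \<times> bool) list"

definition free_star :: "'i set \<Rightarrow> ('i star_word \<Rightarrow> complex) set" where
  "free_star I = {f. finite {w. f w \<noteq> 0} \<and> (\<forall>w. f w \<noteq> 0 \<longrightarrow> fst ` set w \<subseteq> I)}"

definition fs_word :: "'i star_word \<Rightarrow> 'i star_word \<Rightarrow> complex" where
  "fs_word w = (\<lambda>v. if v = w then 1 else 0)"

definition fs_mult ::
    "('i star_word \<Rightarrow> complex) \<Rightarrow> ('i star_word \<Rightarrow> complex) \<Rightarrow> 'i star_word \<Rightarrow> complex" where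
  "fs_mult f g = (\<lambda>w. \<Sum>k\<le>length w. f (take k w) * g (drop k w))"

definition fs_adj :: "('i star_word \<Rightarrow> complex) \<Rightarrow> 'i star_word \<Rightarrow> complex" where
  "fs_adj f = (\<lambda>w. cnj (f (rev (map (\<lambda>(i, b). (i, \<not> b)) w))))"

definition fs_eval ::
    "(complex \<Rightarrow> 'c::{real_normed_algebra_1, banach} \<Rightarrow> 'c) \<Rightarrow> ('c \<Rightarrow> 'c) \<Rightarrow> ('i \<Rightarrow> 'c)
      \<Rightarrow> ('i star_word \<Rightarrow> complex) \<Rightarrow> 'c" where
  "fs_eval cscale adj S f =
     (\<Sum>w | f w \<noteq> 0. cscale (f w) (prod_list (map (\<lambda>(i, b). if b then adj (S i) else S i) w)))"

text \<open>C*-seminorms on the free *-algebra for which the Cuntz relations hold in the quotient.\<close>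

definition cuntz_seminorm :: "'i set \<Rightarrow> (('i star_word \<Rightarrow> complex) \<Rightarrow> real) \<Rightarrow> bool" where
  "cuntz_seminorm I p \<longleftrightarrow>
     (\<forall>f\<in>free_star I. \<forall>g\<in>free_star I.
        p (\<lambda>w. f w + g w) \<le> p f + p g \<and> p (fs_mult f g) \<le> p f * p g) \<and>
     (\<forall>c. \<forall>f\<in>free_star I. p (\<lambda>w. c * f w) = cmod c * p f) \<and>
     (\<forall>f\<in>free_star I. p (fs_mult (fs_adj f) f) = (p f)\<^sup>2) \<and>
     (\<forall>i\<in>I. p (\<lambda>w. fs_word [(i, True), (i, False)] w - fs_word [] w) = 0) \<and>
     p (\<lambda>w. (\<Sum>i\<in>I. fs_word [(i, False), (i, True)] w) - fs_word [] w) = 0"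

text \<open>
  The Cuntz algebra \<open>O\<^sub>D\<close>, with \<open>D = card I\<close> and generators \<open>S i\<close>, as the universal C*-algebra on
  its generators and relations: its norm dominates (hence is) the largest C*-seminorm on the free
  *-algebra that is compatible with the relations.
\<close>

locale cuntz_algebra = unital_cstar_algebra cscale adj
  for cscale :: "complex \<Rightarrow> 'c::{real_normed_algebra_1, banach} \<Rightarrow> 'c"
    and adj :: "'c \<Rightarrow> 'c" +
  fixes I :: "'i set" and S :: "'i \<Rightarrow> 'c"
  assumes finite_index: "finite I"
    and isometry: "i \<in> I \<Longrightarrow> adj (S i) * S i = 1"
    and ranges_sum: "(\<Sum>i\<in>I. S i * adj (S i)) = 1"
    and generated: "closure (fs_eval cscale adj S ` free_star I) = UNIV"
    and universal: "cuntz_seminorm I p \<Longrightarrow> f \<in> free_star I \<Longrightarrow>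
           p f \<le> norm (fs_eval cscale adj S f)"

text \<open>
  Unital *-representations on \<open>L\<^sup>2(M)\<close>. The norm bound is automatic for *-homomorphisms of
  C*-algebras.
\<close>

definition l2_representation ::
    "(complex \<Rightarrow> 'c::{real_normed_algebra_1, banach} \<Rightarrow> 'c) \<Rightarrow> ('c \<Rightarrow> 'c) \<Rightarrow> 'a measure
      \<Rightarrow> ('c \<Rightarrow> ('a \<Rightarrow> complex) \<Rightarrow> 'a \<Rightarrow> complex) \<Rightarrow> bool" where
  "l2_representation cscale adj M \<pi> \<longleftrightarrow>
     (\<forall>a. l2_operator M (\<pi> a)) \<and>
     (\<forall>a b. l2_eq M (\<pi> (a + b)) (\<lambda>\<psi> x. \<pi> a \<psi> x + \<pi> b \<psi> x)) \<and>
     (\<forall>c a. l2_eq M (\<pi> (cscale c a)) (\<lambda>\<psi> x. c * \<pi> a \<psi> x)) \<and>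
     (\<forall>a b. l2_eq M (\<pi> (a * b)) (\<lambda>\<psi>. \<pi> a (\<pi> b \<psi>))) \<and>
     l2_eq M (\<pi> 1) (\<lambda>\<psi>. \<psi>) \<and>
     (\<forall>a. l2_adjoint M (\<pi> a) (\<pi> (adj a))) \<and>
     (\<forall>a. \<forall>\<psi>\<in>sq_int M. l2_norm M (\<pi> a \<psi>) \<le> norm a * l2_norm M \<psi>)"

end

theory Submission
  imports Defs "HOL-Probability.Probability"
begin

text \<open>
  Let \<open>K\<close> be the fractal, \<open>D\<close> the number of entries equal to 1, and \<open>s = log D / log N\<close>, which is
  twice the exponent \<open>\<delta>\<close>.

  Geometry. Hausdorff outer measure is a metric outer measure, so its restriction to the Borel sets
  is a measure (\<open>metric_outer_measure_borel\<close>, by Caratheodory's criterion), and a similarity of ratio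
  \<open>r\<close> multiplies it by \<open>r powr s\<close>. The fractal is compact and the union of its \<open>D\<close> images under
  similarities of ratio \<open>1 / N\<close>. Iterating this decomposition gives covers that show that the measure
  \<open>\<mu>\<close> of \<open>K\<close> is finite. It is positive by the mass distribution principle: the sequence of independent
  uniformly distributed digit pairs hits a set of diameter less than \<open>1 / N ^ n\<close> with probability at
  most \<open>16 / D ^ n\<close> (\<open>small_set_measure_le\<close>). This determines the dimension; measuring sets by the
  area of a square halves all exponents, whence \<open>\<delta>\<close>.

  Dynamics. By scaling, each branch divides \<open>\<mu>\<close> by \<open>D\<close>, so its Radon-Nikodym derivative is \<open>1 / D\<close>
  almost everywhere. As the \<open>D\<close> ranges cover \<open>K\<close> and their measures \<open>\<mu>(K) / D\<close> add up to \<open>\<mu>(K)\<close>,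
  which is finite, they overlap in null sets only (\<open>overlap_null\<close>). Hence every version of the shift
  inverts every branch almost everywhere (\<open>digit_shift_AE\<close>).

  Operators. The associated operators are weighted compositions with the shift, their adjoints
  weighted compositions with the branches, and the Cuntz relations are changes of variables
  (locale \<open>uniform_branching\<close>).

  Representation. The operator norm of a polynomial in these operators and their adjoints is a
  C*-seminorm that is compatible with the Cuntz relations (\<open>cuntz_seminorm_poly_norm\<close>), so that by the
  universal property it is at most the norm of the same polynomial in the Cuntz algebra. Evaluation
  of polynomials therefore extends by continuity to the whole algebra, which requires the completeness
  of \<open>L\<^sup>2\<close> (\<open>l2_complete\<close>). All algebraic identities pass to the limit, and so does uniqueness
  (\<open>l2_representation_rep\<close>, \<open>rep_unique\<close>).
\<close>

section \<open>Metric outer measures\<close>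

lemma ennreal_suminf_tail:
  fixes u :: "nat \<Rightarrow> ennreal"
  assumes "(\<Sum>n. u n) < top" and "0 < (e::real)"
  shows "\<exists>n. (\<Sum>k. u (k + n)) < e"
proof -
  have fin: "u n < top" for n
    using assms(1) by (rule ennreal_suminf_lessD)
  define g where "g n = enn2real (u n)" for n
  have u: "u n = ennreal (g n)" for n
    using fin[of n] by (simp add: g_def)
  have g0: "0 \<le> g n" for n by (simp add: g_def)
  have "summable g"
    using assms(1) by (intro summable_suminf_not_top) (auto simp: u g0)
  then obtain n where n: "norm (\<Sum>i. g (i + n)) < e"
    using suminf_exist_split[OF assms(2)] by blast
  have "(\<Sum>k. u (k + n)) = ennreal (\<Sum>i. g (i + n))"
    unfolding u using g0 summable_ignore_initial_segment[OF \<open>summable g\<close>] by (intro suminf_ennreal2)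
  also have "\<dots> < e"
    using n assms(2) by (intro ennreal_lessI) auto
  finally show ?thesis by blast
qed

lemma outer_measure_UN_le:
  fixes A :: "nat \<Rightarrow> 'a set"
  assumes "outer_measure_space UNIV f"
  shows "f (\<Union>n. A n) \<le> (\<Sum>n. f (A n))"
proof -
  have "f (\<Union>n. disjointed A n) \<le> (\<Sum>n. f (disjointed A n))"
    using assms disjoint_family_disjointed[of A]
    by (simp add: outer_measure_space_def countably_subadditive_def)
  also have "\<dots> \<le> (\<Sum>n. f (A n))"
    using assms disjointed_subset[of A]
    by (intro suminf_le) (auto simp: outer_measure_space_def increasing_def)
  finally show ?thesis by (simp add: UN_disjointed_eq)
qed

lemma outer_measure_Un_le:
  fixes f :: "'a set \<Rightarrow> ennreal"
  assumes "outer_measure_space UNIV f"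
  shows "f (A \<union> B) \<le> f A + f B"
proof -
  have "f {} = 0"
    using assms by (auto simp: outer_measure_space_def positive_def)
  then show ?thesis
    using outer_measure_UN_le[OF assms, of "binaryset A B"]
    by (simp add: UN_binaryset_eq suminf_binaryset_eq)
qed

lemma outer_measure_finite_UN_le:
  fixes f :: "'a set \<Rightarrow> ennreal"
  assumes "outer_measure_space UNIV f" and "finite I"
  shows "f (\<Union>i\<in>I. A i) \<le> (\<Sum>i\<in>I. f (A i))"
  using \<open>finite I\<close>
proof (induction I rule: finite_induct)
  case empty
  then show ?case using assms(1) by (simp add: outer_measure_space_def positive_def)
next
  case (insert i I)
  have "f (\<Union>i\<in>insert i I. A i) \<le> f (A i) + f (\<Union>i\<in>I. A i)"
    using outer_measure_Un_le[OF assms(1)] by simp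
  also have "\<dots> \<le> f (A i) + (\<Sum>i\<in>I. f (A i))"
    by (intro add_left_mono insert.IH)
  finally show ?case using insert.hyps by simp
qed

lemma outer_measure_separated_sum:
  fixes f :: "'a::metric_space set \<Rightarrow> ennreal"
  assumes metric: "\<And>A B r. 0 < r \<Longrightarrow> (\<forall>a\<in>A. \<forall>b\<in>B. r \<le> dist a b) \<Longrightarrow> f A + f B \<le> f (A \<union> B)"
    and "b < a"
    and S: "\<And>x. x \<in> S \<Longrightarrow> a \<le> infdist x F" and T: "\<And>x. x \<in> T \<Longrightarrow> infdist x F \<le> b"
  shows "f S + f T \<le> f (S \<union> T)"
proof (rule metric)
  show "0 < a - b" using \<open>b < a\<close> by simp
  show "\<forall>x\<in>S. \<forall>y\<in>T. a - b \<le> dist x y"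
  proof (intro ballI)
    fix x y assume "x \<in> S" "y \<in> T"
    then show "a - b \<le> dist x y"
      using S[of x] T[of y] infdist_triangle[of x F y] by linarith
  qed
qed

text \<open>
  The Caratheodory condition for a closed set \<open>F\<close>. The points of \<open>X\<close> at distance at least \<open>1 / (n + 1)\<close>
  from \<open>F\<close> are separated from \<open>X \<inter> F\<close>, so it suffices that their outer measures converge to that of
  \<open>X - F\<close>. They do because the differences between consecutive such sets (shells) have summable
  outer measures.
\<close>

lemma metric_outer_measure_closed:
  fixes f :: "'a::metric_space set \<Rightarrow> ennreal"
  assumes outer: "outer_measure_space UNIV f"
    and metric: "\<And>A B r. 0 < r \<Longrightarrow> (\<forall>a\<in>A. \<forall>b\<in>B. r \<le> dist a b) \<Longrightarrow> f A + f B \<le> f (A \<union> B)"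
    and F: "closed F" "F \<noteq> {}"
  shows "f (X \<inter> F) + f (X - F) \<le> f X"
proof (cases "f X = top")
  case False
  have mono: "A \<subseteq> B \<Longrightarrow> f A \<le> f B" for A B
    using outer by (auto simp: outer_measure_space_def increasing_def)
  have empty: "f {} = 0"
    using outer by (auto simp: outer_measure_space_def positive_def)
  define A where "A n = {x \<in> X. 1 / (real n + 1) \<le> infdist x F}" for n
  define B where "B n = A (Suc n) - A n" for n
  have sep: "f S + f T \<le> f (S \<union> T)"
    if "b < a" "\<And>x. x \<in> S \<Longrightarrow> a \<le> infdist x F" "\<And>x. x \<in> T \<Longrightarrow> infdist x F \<le> b" for a b S T
    using metric that by (rule outer_measure_separated_sum)
  \<comment> \<open>Two different shells of the same parity are separated by the shell in between.\<close>
  have shells: "(\<Sum>k<m. f (B (2 * k + p))) \<le> f (\<Union>k<m. B (2 * k + p))" for m p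
  proof (induction m)
    case 0
    then show ?case by (simp add: empty)
  next
    case (Suc m)
    have "f (\<Union>k<m. B (2 * k + p)) + f (B (2 * m + p))
        \<le> f ((\<Union>k<m. B (2 * k + p)) \<union> B (2 * m + p))"
    proof (cases "m = 0")
      case True
      then show ?thesis by (simp add: empty)
    next
      case False
      show ?thesis
      proof (rule sep)
        show "1 / (real (2 * m + p) + 1) < 1 / real (2 * m + p)"
          using False by (intro divide_strict_left_mono) auto
        fix x assume "x \<in> (\<Union>k<m. B (2 * k + p))"
        then obtain k where k: "k < m" "1 / (real (Suc (2 * k + p)) + 1) \<le> infdist x F"
          by (auto simp: B_def A_def)
        have "1 / real (2 * m + p) \<le> 1 / (real (Suc (2 * k + p)) + 1)"
          using k(1) by (intro divide_left_mono) auto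
        with k(2) show "1 / real (2 * m + p) \<le> infdist x F" by linarith
      qed (auto simp: B_def A_def)
    qed
    with Suc.IH show ?case
      by (simp add: lessThan_Suc Un_commute add.commute) (meson add_left_mono order_trans)
  qed
  have le_X: "(\<Sum>k<m. f (B (2 * k + p))) \<le> f X" for m p
    by (rule order_trans[OF shells mono]) (auto simp: B_def A_def)
  have "(\<Sum>n<m. f (B n)) \<le> 2 * f X" for m
  proof -
    have "(\<Sum>n<m. f (B n)) \<le> (\<Sum>n<2 * m. f (B n))"
      by (intro sum_mono2) auto
    also have "\<dots> = (\<Sum>k<m. f (B (2 * k + 0))) + (\<Sum>k<m. f (B (2 * k + 1)))"
      by (induction m) (auto simp: ac_simps)
    also have "\<dots> \<le> f X + f X"
      by (intro add_mono le_X)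
    finally show ?thesis by (simp add: mult_2)
  qed
  then have "(\<Sum>n. f (B n)) \<le> 2 * f X"
    by (intro suminf_le_const) auto
  also have "\<dots> < top"
    using False by (simp add: ennreal_mult_less_top top.not_eq_extremum)
  finally have fin: "(\<Sum>n. f (B n)) < top" .
  have cover: "X - F \<subseteq> A n \<union> (\<Union>k. B (k + n))" for n
  proof
    fix x assume x: "x \<in> X - F"
    then have "infdist x F > 0"
      using F infdist_pos_not_in_closed by blast
    then obtain m where "1 / (real m + 1) < infdist x F"
      using reals_Archimedean[of "infdist x F"] by (auto simp: inverse_eq_divide add.commute)
    with x have m: "x \<in> A m" by (auto simp: A_def)
    show "x \<in> A n \<union> (\<Union>k. B (k + n))"
    proof (cases "x \<in> A n")
      case out: False
      define l where "l = (LEAST l. x \<in> A (l + n))"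
      have inc: "A i \<subseteq> A j" if "i \<le> j" for i j
      proof
        fix y assume "y \<in> A i"
        moreover have "1 / (real j + 1) \<le> 1 / (real i + 1)"
          using that by (intro divide_left_mono) auto
        ultimately show "y \<in> A j" by (auto simp: A_def)
      qed
      have "x \<in> A (m + n)" using m inc[of m "m + n"] by auto
      then have l: "x \<in> A (l + n)" unfolding l_def by (rule LeastI)
      then obtain l' where l': "l = Suc l'" using out by (cases l) auto
      then have "x \<notin> A (l' + n)" using not_less_Least[of l' "\<lambda>l. x \<in> A (l + n)"] unfolding l_def by auto
      with l l' have "x \<in> B (l' + n)" by (auto simp: B_def)
      then show ?thesis by blast
    next
      case True
      then show ?thesis by (rule UnI1)
    qed
  qed
  show ?thesis
  proof (rule ennreal_le_epsilon)
    fix e :: real assume "0 < e"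
    then obtain n where n: "(\<Sum>k. f (B (k + n))) < e"
      using ennreal_suminf_tail[OF fin] by blast
    have "f (X - F) \<le> f (A n \<union> (\<Union>k. B (k + n)))"
      by (rule mono[OF cover])
    also have "\<dots> \<le> f (A n) + f (\<Union>k. B (k + n))"
      by (rule outer_measure_Un_le[OF outer])
    also have "\<dots> \<le> f (A n) + (\<Sum>k. f (B (k + n)))"
      by (intro add_left_mono outer_measure_UN_le[OF outer])
    finally have 1: "f (X - F) \<le> f (A n) + (\<Sum>k. f (B (k + n)))" .
    have "f (A n) + f (X \<inter> F) \<le> f (A n \<union> (X \<inter> F))"
      by (rule sep[where b = 0 and a = "1 / (real n + 1)"]) (auto simp: A_def)
    also have "\<dots> \<le> f X"
      by (rule mono) (auto simp: A_def)
    finally have 2: "f (A n) + f (X \<inter> F) \<le> f X" .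
    have "f (X \<inter> F) + f (X - F) \<le> f (X \<inter> F) + (f (A n) + (\<Sum>k. f (B (k + n))))"
      by (intro add_left_mono 1)
    also have "\<dots> = (f (A n) + f (X \<inter> F)) + (\<Sum>k. f (B (k + n)))"
      by (simp add: ac_simps)
    also have "\<dots> \<le> f X + e"
      by (intro add_mono 2 less_imp_le[OF n])
    finally show "f (X \<inter> F) + f (X - F) \<le> f X + ennreal e" .
  qed
next
  case True
  show ?thesis unfolding True by (rule top_greatest)
qed

theorem metric_outer_measure_borel:
  fixes f :: "'a::metric_space set \<Rightarrow> ennreal"
  assumes outer: "outer_measure_space UNIV f"
    and metric: "\<And>A B r. 0 < r \<Longrightarrow> (\<forall>a\<in>A. \<forall>b\<in>B. r \<le> dist a b) \<Longrightarrow> f A + f B \<le> f (A \<union> B)"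
  shows "measure_space UNIV (sets (borel :: 'a measure)) f"
proof -
  interpret S: sigma_algebra "UNIV :: 'a set" "UNIV :: 'a set set"
    using sigma_algebra_Pow[of "UNIV :: 'a set"] by simp
  define L where "L = lambda_system (UNIV :: 'a set) UNIV f"
  have L: "measure_space UNIV L f"
    unfolding L_def by (rule S.caratheodory_lemma[OF outer])
  have empty: "f {} = 0"
    using outer by (auto simp: outer_measure_space_def positive_def)
  have sub2: "f X \<le> f (X \<inter> F) + f (X - F)" for X F
    using outer_measure_Un_le[OF outer, of "X \<inter> F" "X - F"] by (simp add: Int_Diff_Un)
  have "F \<in> L" if "closed F" for F
  proof (cases "F = {}")
    case True
    then show ?thesis by (simp add: L_def S.lambda_system_eq empty)
  next
    case False
    show ?thesis
      unfolding L_def S.lambda_system_eq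
      using metric_outer_measure_closed[OF outer metric that False] sub2
      by (auto intro!: antisym)
  qed
  moreover have "sigma_algebra UNIV L"
    using L by (simp add: measure_space_def)
  ultimately have "sigma_sets UNIV {F. closed F} \<subseteq> L"
    by (intro sigma_algebra.sigma_sets_subset) auto
  then have sub: "sets (borel :: 'a measure) \<subseteq> L"
    by (simp add: borel_eq_closed)
  have "countably_additive (sets (borel :: 'a measure)) f"
    unfolding countably_additive_def
  proof safe
    fix A :: "nat \<Rightarrow> 'a set"
    assume A: "range A \<subseteq> sets borel" "disjoint_family A" "(\<Union>i. A i) \<in> sets borel"
    have "countably_additive L f" using L by (simp add: measure_space_def)
    moreover have "range A \<subseteq> L" "(\<Union>i. A i) \<in> L"
      using A(1,3) sub by blast+
    ultimately show "(\<Sum>i. f (A i)) = f (\<Union>i. A i)"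
      using A(2) by (simp add: countably_additive_def)
  qed
  then show ?thesis
    using sets.sigma_algebra_axioms[of "borel :: 'a measure"]
    by (auto simp: measure_space_def positive_def empty)
qed

section \<open>Hausdorff measure and dimension\<close>

lemma size_powr_empty [simp]: "size_powr g s {} = 0"
  by (simp add: size_powr_def)

text \<open>
  The covers over which \<open>hausdorff_premeasure\<close> takes its infimum: countable, by bounded sets of
  size at most \<open>\<epsilon>\<close>.
\<close>

definition small_cover :: "('a::metric_space set \<Rightarrow> real) \<Rightarrow> real \<Rightarrow> 'a set \<Rightarrow> (nat \<Rightarrow> 'a set) \<Rightarrow> bool" where
  "small_cover g \<epsilon> E U \<longleftrightarrow> E \<subseteq> (\<Union>n. U n) \<and> (\<forall>n. bounded (U n) \<and> g (U n) \<le> \<epsilon>)"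

lemma hausdorff_premeasure_le:
  "small_cover g \<epsilon> E U \<Longrightarrow> hausdorff_premeasure g s \<epsilon> E \<le> (\<Sum>n. size_powr g s (U n))"
  unfolding hausdorff_premeasure_def small_cover_def by (intro INF_lower) auto

lemma hausdorff_premeasure_ge:
  "(\<And>U. small_cover g \<epsilon> E U \<Longrightarrow> c \<le> (\<Sum>n. size_powr g s (U n))) \<Longrightarrow> c \<le> hausdorff_premeasure g s \<epsilon> E"
  unfolding hausdorff_premeasure_def small_cover_def by (intro INF_greatest) auto

lemma hausdorff_premeasure_close:
  assumes "hausdorff_premeasure g s \<epsilon> E < c"
  obtains U where "small_cover g \<epsilon> E U" "(\<Sum>n. size_powr g s (U n)) < c"
  using assms unfolding hausdorff_premeasure_def small_cover_def INF_less_iff by auto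

lemma hausdorff_premeasure_antimono:
  "\<epsilon> \<le> \<epsilon>' \<Longrightarrow> hausdorff_premeasure g s \<epsilon>' E \<le> hausdorff_premeasure g s \<epsilon> E"
  unfolding hausdorff_premeasure_def by (intro INF_superset_mono) (auto intro: order_trans)

lemma hausdorff_premeasure_mono:
  "E \<subseteq> E' \<Longrightarrow> hausdorff_premeasure g s \<epsilon> E \<le> hausdorff_premeasure g s \<epsilon> E'"
  unfolding hausdorff_premeasure_def by (intro INF_superset_mono) auto

lemma hausdorff_premeasure_le_outer:
  "0 < \<epsilon> \<Longrightarrow> hausdorff_premeasure g s \<epsilon> E \<le> hausdorff_outer g s E"
  unfolding hausdorff_outer_def by (intro SUP_upper) auto

lemma hausdorff_outer_le:
  "(\<And>\<epsilon>. 0 < \<epsilon> \<Longrightarrow> hausdorff_premeasure g s \<epsilon> E \<le> c) \<Longrightarrow> hausdorff_outer g s E \<le> c"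
  unfolding hausdorff_outer_def by (intro SUP_least) auto

lemma hausdorff_premeasure_empty:
  assumes "0 < \<epsilon>" shows "hausdorff_premeasure diameter s \<epsilon> {} = 0"
  using hausdorff_premeasure_le[of diameter \<epsilon> "{}" "\<lambda>_. {}" s] assms
  by (simp add: small_cover_def)

lemma hausdorff_premeasure_UN_le:
  "hausdorff_premeasure g s \<epsilon> (\<Union>n. A n) \<le> (\<Sum>n. hausdorff_premeasure g s \<epsilon> (A n))"
proof (rule ennreal_le_epsilon)
  let ?H = "hausdorff_premeasure g s \<epsilon>"
  fix e :: real assume e: "0 < e" "(\<Sum>n. ?H (A n)) < top"
  have less: "?H (A n) < ?H (A n) + ennreal (e * (1/2)^Suc n)" for n
  proof -
    have "?H (A n) \<noteq> top" using ennreal_suminf_lessD[OF e(2), of n] by (simp add: less_top)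
    then show ?thesis using e(1) by simp
  qed
  have "\<exists>U. small_cover g \<epsilon> (A n) U
      \<and> (\<Sum>i. size_powr g s (U i)) < ?H (A n) + ennreal (e * (1/2)^Suc n)" for n
    using hausdorff_premeasure_close[OF less[of n]] by blast
  then obtain B where "\<forall>n. small_cover g \<epsilon> (A n) (B n)
      \<and> (\<Sum>i. size_powr g s (B n i)) < ?H (A n) + ennreal (e * (1/2)^Suc n)"
    using choice[of "\<lambda>n U. small_cover g \<epsilon> (A n) U
      \<and> (\<Sum>i. size_powr g s (U i)) < ?H (A n) + ennreal (e * (1/2)^Suc n)"] by blast
  then have B: "\<And>n. small_cover g \<epsilon> (A n) (B n)"
      "\<And>n. (\<Sum>i. size_powr g s (B n i)) < ?H (A n) + ennreal (e * (1/2)^Suc n)"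
    by blast+
  define C where "C = case_prod B o prod_decode"
  have "\<exists>i. x \<in> C i" if "x \<in> A n" for x n
  proof -
    have "A n \<subseteq> (\<Union>i. B n i)"
      using B(1)[of n] by (simp add: small_cover_def)
    with that obtain i where "x \<in> B n i" by blast
    then show ?thesis by (intro exI[of _ "prod_encode (n, i)"]) (simp add: C_def)
  qed
  then have "small_cover g \<epsilon> (\<Union>n. A n) C"
    using B(1) by (auto simp: small_cover_def C_def split_def)
  then have "?H (\<Union>n. A n) \<le> (\<Sum>i. size_powr g s (C i))"
    by (rule hausdorff_premeasure_le)
  also have "\<dots> = (\<Sum>n. \<Sum>i. size_powr g s (B n i))"
    using suminf_ennreal_2dimen[of _ "\<lambda>p. size_powr g s (case_prod B p)"]
    by (simp add: C_def)
  also have "\<dots> \<le> (\<Sum>n. ?H (A n) + ennreal (e * (1/2) ^ Suc n))"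
    using B(2) by (intro suminf_le less_imp_le) auto
  also have "\<dots> = (\<Sum>n. ?H (A n)) + (\<Sum>n. ennreal e * ennreal ((1/2) ^ Suc n))"
    using \<open>0 < e\<close> by (subst suminf_add[symmetric])
      (auto simp del: ennreal_suminf_cmult simp add: ennreal_mult[symmetric])
  also have "\<dots> = (\<Sum>n. ?H (A n)) + e"
    unfolding ennreal_suminf_cmult
    by (subst suminf_ennreal_eq[OF zero_le_power power_half_series]) auto
  finally show "?H (\<Union>n. A n) \<le> (\<Sum>n. ?H (A n)) + e" .
qed

lemma hausdorff_premeasure_outer_measure_space:
  assumes "0 < \<epsilon>"
  shows "outer_measure_space (UNIV :: 'a::metric_space set set) (hausdorff_premeasure diameter s \<epsilon>)"
  using hausdorff_premeasure_empty[OF assms, of s, where 'a = 'a] hausdorff_premeasure_UN_le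
  by (auto simp: outer_measure_space_def positive_def increasing_def countably_subadditive_def
      hausdorff_premeasure_mono)

lemma hausdorff_outer_measure_space:
  "outer_measure_space (UNIV :: 'a::metric_space set set) (hausdorff_outer diameter s)"
  unfolding outer_measure_space_def
proof (intro conjI)
  have "hausdorff_outer diameter s {} \<le> 0"
    by (rule hausdorff_outer_le) (simp add: hausdorff_premeasure_empty)
  then show "positive UNIV (hausdorff_outer diameter s)" by (simp add: positive_def)
  show "increasing UNIV (hausdorff_outer diameter s)"
    unfolding increasing_def
    by (meson hausdorff_outer_le hausdorff_premeasure_le_outer hausdorff_premeasure_mono order_trans)
  show "countably_subadditive (UNIV :: 'a set set) (hausdorff_outer diameter s)"
    unfolding countably_subadditive_def
  proof (intro allI impI)
    fix A :: "nat \<Rightarrow> 'a set"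
    show "hausdorff_outer diameter s (\<Union>i. A i) \<le> (\<Sum>i. hausdorff_outer diameter s (A i))"
    proof (rule hausdorff_outer_le)
      fix \<epsilon> :: real assume "0 < \<epsilon>"
      have "hausdorff_premeasure diameter s \<epsilon> (\<Union>i. A i) \<le> (\<Sum>n. hausdorff_premeasure diameter s \<epsilon> (A n))"
        by (rule hausdorff_premeasure_UN_le)
      also have "\<dots> \<le> (\<Sum>i. hausdorff_outer diameter s (A i))"
        using \<open>0 < \<epsilon>\<close> by (intro suminf_le hausdorff_premeasure_le_outer) auto
      finally show "hausdorff_premeasure diameter s \<epsilon> (\<Union>i. A i) \<le> \<dots>" .
    qed
  qed
qed

text \<open>
  Hausdorff outer measure is a metric outer measure: a set of diameter less than \<open>r\<close> cannot meet
  both of two sets at distance at least \<open>r\<close>, so a fine cover of their union splits into covers of the two.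
\<close>

lemma hausdorff_outer_metric:
  assumes "0 < r" and sep: "\<forall>a\<in>A. \<forall>b\<in>B. r \<le> dist a b"
  shows "hausdorff_outer diameter s A + hausdorff_outer diameter s B \<le> hausdorff_outer diameter s (A \<union> B)"
proof -
  let ?H = "hausdorff_premeasure diameter s"
  have ineq: "?H \<epsilon> A + ?H \<epsilon> B \<le> hausdorff_outer diameter s (A \<union> B)" if \<epsilon>: "0 < \<epsilon>" "\<epsilon> \<le> r / 2" for \<epsilon>
  proof -
    have "?H \<epsilon> A + ?H \<epsilon> B \<le> ?H \<epsilon> (A \<union> B)"
    proof (rule hausdorff_premeasure_ge)
      fix U assume U: "small_cover diameter \<epsilon> (A \<union> B) U"
      define V where "V n = (if U n \<inter> A = {} then {} else U n)" for n
      define W where "W n = (if U n \<inter> B = {} then {} else U n)" for n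
      have disj: "V n = {} \<or> W n = {}" for n
      proof (rule ccontr)
        assume "\<not> ?thesis"
        then obtain a b where ab: "a \<in> U n" "b \<in> U n" "a \<in> A" "b \<in> B"
          unfolding V_def W_def by (auto split: if_splits)
        then have "dist a b \<le> diameter (U n)"
          using U by (intro diameter_bounded_bound) (auto simp: small_cover_def)
        also have "\<dots> \<le> \<epsilon>" using U by (auto simp: small_cover_def)
        finally show False using \<epsilon> sep ab assms(1) by force
      qed
      have "small_cover diameter \<epsilon> A V" "small_cover diameter \<epsilon> B W"
        using U \<epsilon> unfolding small_cover_def V_def W_def by fastforce+
      then have "?H \<epsilon> A + ?H \<epsilon> B \<le> (\<Sum>n. size_powr diameter s (V n)) + (\<Sum>n. size_powr diameter s (W n))"
        by (intro add_mono hausdorff_premeasure_le)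
      also have "\<dots> = (\<Sum>n. size_powr diameter s (V n) + size_powr diameter s (W n))"
        by (intro suminf_add) auto
      also have "\<dots> \<le> (\<Sum>n. size_powr diameter s (U n))"
      proof (intro suminf_le)
        show "size_powr diameter s (V n) + size_powr diameter s (W n) \<le> size_powr diameter s (U n)" for n
          using disj[of n] unfolding V_def W_def by (auto split: if_splits)
      qed auto
      finally show "?H \<epsilon> A + ?H \<epsilon> B \<le> (\<Sum>n. size_powr diameter s (U n))" .
    qed
    also have "\<dots> \<le> hausdorff_outer diameter s (A \<union> B)"
      by (rule hausdorff_premeasure_le_outer[OF \<epsilon>(1)])
    finally show ?thesis .
  qed
  \<comment> \<open>Both suprema are limits as \<open>\<epsilon>\<close> decreases, so one small \<open>\<epsilon>\<close> serves both.\<close>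
  have "hausdorff_outer diameter s A + hausdorff_outer diameter s B = (SUP \<epsilon>\<in>{0<..}. ?H \<epsilon> A + ?H \<epsilon> B)"
    unfolding hausdorff_outer_def
  proof (rule SUP_add_directed_ennreal[symmetric])
    fix i j :: real assume "i \<in> {0<..}" "j \<in> {0<..}"
    then show "\<exists>k\<in>{0<..}. ?H i A + ?H j B \<le> ?H k A + ?H k B"
      by (intro bexI[of _ "min i j"] add_mono hausdorff_premeasure_antimono) auto
  qed
  also have "\<dots> \<le> hausdorff_outer diameter s (A \<union> B)"
  proof (rule SUP_least)
    fix \<epsilon> :: real assume "\<epsilon> \<in> {0<..}"
    then have "?H \<epsilon> A + ?H \<epsilon> B \<le> ?H (min \<epsilon> (r / 2)) A + ?H (min \<epsilon> (r / 2)) B"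
      by (intro add_mono hausdorff_premeasure_antimono) auto
    also have "\<dots> \<le> hausdorff_outer diameter s (A \<union> B)"
      using \<open>\<epsilon> \<in> {0<..}\<close> \<open>0 < r\<close> by (intro ineq) auto
    finally show "?H \<epsilon> A + ?H \<epsilon> B \<le> hausdorff_outer diameter s (A \<union> B)" .
  qed
  finally show ?thesis .
qed

theorem measure_space_hausdorff_outer:
  "measure_space UNIV (sets (borel :: 'a::metric_space measure)) (hausdorff_outer diameter s)"
  by (rule metric_outer_measure_borel[OF hausdorff_outer_measure_space hausdorff_outer_metric])

lemma sets_hausdorff_measure [simp]: "sets (hausdorff_measure s) = sets borel"
  by (simp add: hausdorff_measure_wrt_def sets.sigma_sets_eq[of borel, simplified])

lemma space_hausdorff_measure [simp]: "space (hausdorff_measure s) = UNIV"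
  by (simp add: hausdorff_measure_wrt_def)

lemma emeasure_hausdorff_measure:
  "E \<in> sets borel \<Longrightarrow> emeasure (hausdorff_measure s) E = hausdorff_outer diameter s E"
  unfolding hausdorff_measure_wrt_def
  using measure_space_hausdorff_outer[of s]
  by (intro emeasure_measure_of_sigma) (auto simp: measure_space_def)

lemma hausdorff_premeasure_Lipschitz:
  fixes f :: "'a::metric_space \<Rightarrow> 'b::metric_space"
  assumes "0 < r" "0 \<le> s" and lip: "\<And>x y. dist (f x) (f y) \<le> r * dist x y"
  shows "ennreal (r powr - s) * hausdorff_premeasure diameter s \<epsilon> (f ` E)
    \<le> hausdorff_premeasure diameter s (\<epsilon> / r) E"
proof -
  let ?k = "ennreal (r powr - s)"
  have diam: "bounded (f ` U) \<and> diameter (f ` U) \<le> r * diameter U" if "bounded U" for U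
  proof -
    have *: "dist (f a) (f b) \<le> r * diameter U" if "a \<in> U" "b \<in> U" for a b
    proof -
      have "dist a b \<le> diameter U" using \<open>bounded U\<close> that by (intro diameter_bounded_bound)
      then show ?thesis
        using lip[of a b] \<open>0 < r\<close> by (meson mult_left_mono less_imp_le order_trans)
    qed
    then have "bounded (f ` U)" by (auto simp: bounded_two_points)
    moreover have "diameter (f ` U) \<le> r * diameter U"
    proof (cases "U = {}")
      case False
      then show ?thesis
        unfolding diameter_def[of "f ` U"] using * by (auto intro!: cSUP_least)
    qed simp
    ultimately show ?thesis by blast
  qed
  show ?thesis
  proof (rule hausdorff_premeasure_ge)
    fix U assume U: "small_cover diameter (\<epsilon> / r) E U"
    then have bU: "bounded (U n)" "diameter (U n) \<le> \<epsilon> / r" for n by (auto simp: small_cover_def)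
    have "diameter (f ` U n) \<le> \<epsilon>" for n
    proof -
      have "diameter (f ` U n) \<le> r * diameter (U n)" using diam bU by blast
      also have "\<dots> \<le> r * (\<epsilon> / r)" using bU(2) \<open>0 < r\<close> by (intro mult_left_mono) auto
      finally show ?thesis using \<open>0 < r\<close> by simp
    qed
    then have "small_cover diameter \<epsilon> (f ` E) (\<lambda>n. f ` U n)"
      using U diam unfolding small_cover_def by blast
    then have "?k * hausdorff_premeasure diameter s \<epsilon> (f ` E) \<le> ?k * (\<Sum>n. size_powr diameter s (f ` U n))"
      by (intro mult_left_mono hausdorff_premeasure_le) auto
    also have "\<dots> = (\<Sum>n. ?k * size_powr diameter s (f ` U n))"
      by (rule ennreal_suminf_cmult[symmetric])
    also have "\<dots> \<le> (\<Sum>n. size_powr diameter s (U n))"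
    proof (intro suminf_le)
      show "?k * size_powr diameter s (f ` U n) \<le> size_powr diameter s (U n)" for n
      proof (cases "U n = {} \<or> s = 0")
        case True
        then show ?thesis using \<open>0 < r\<close> by (auto simp: size_powr_def)
      next
        case False
        have "diameter (f ` U n) powr s \<le> (r * diameter (U n)) powr s"
          using diam[OF bU(1)] diameter_ge_0 \<open>0 \<le> s\<close> by (intro powr_mono2) blast+
        also have "\<dots> = r powr s * diameter (U n) powr s"
          using \<open>0 < r\<close> diameter_ge_0[OF bU(1)] by (intro powr_mult)
        finally have "r powr - s * diameter (f ` U n) powr s \<le> r powr - s * (r powr s * diameter (U n) powr s)"
          by (intro mult_left_mono) auto
        also have "\<dots> = diameter (U n) powr s"
          using \<open>0 < r\<close> by (simp add: powr_minus field_simps)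
        finally show ?thesis
          using False by (simp add: size_powr_def ennreal_mult[symmetric] ennreal_leI)
      qed
    qed auto
    finally show "?k * hausdorff_premeasure diameter s \<epsilon> (f ` E) \<le> (\<Sum>n. size_powr diameter s (U n))" .
  qed
qed

lemma hausdorff_outer_Lipschitz:
  fixes f :: "'a::metric_space \<Rightarrow> 'b::metric_space"
  assumes "0 < r" "0 \<le> s" and lip: "\<And>x y. dist (f x) (f y) \<le> r * dist x y"
  shows "ennreal (r powr - s) * hausdorff_outer diameter s (f ` E) \<le> hausdorff_outer diameter s E"
  unfolding hausdorff_outer_def[of diameter s "f ` E"]
proof (subst SUP_mult_left_ennreal, rule SUP_least)
  fix \<epsilon> :: real assume "\<epsilon> \<in> {0<..}"
  then have "hausdorff_premeasure diameter s (\<epsilon> / r) E \<le> hausdorff_outer diameter s E"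
    using \<open>0 < r\<close> by (intro hausdorff_premeasure_le_outer) auto
  then show "ennreal (r powr - s) * hausdorff_premeasure diameter s \<epsilon> (f ` E) \<le> hausdorff_outer diameter s E"
    by (rule order_trans[OF hausdorff_premeasure_Lipschitz[OF assms]])
qed

lemma hausdorff_outer_similarity:
  fixes f :: "'a::metric_space \<Rightarrow> 'b::metric_space"
  assumes "0 < r" "0 \<le> s" and sim: "\<And>x y. dist (f x) (f y) = r * dist x y" and "surj f"
  shows "hausdorff_outer diameter s (f ` E) = ennreal (r powr s) * hausdorff_outer diameter s E"
proof (rule antisym)
  let ?H = "hausdorff_outer diameter s"
  have inj: "inj f"
  proof (rule injI)
    fix x y assume "f x = f y"
    then have "r * dist x y = 0" using sim[of x y] by simp
    then show "x = y" using \<open>0 < r\<close> by simp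
  qed
  have "ennreal (r powr s) * (ennreal (r powr - s) * ?H (f ` E)) \<le> ennreal (r powr s) * ?H E"
    using assms by (intro mult_left_mono hausdorff_outer_Lipschitz) auto
  also have "ennreal (r powr s) * (ennreal (r powr - s) * ?H (f ` E)) = ?H (f ` E)"
    using \<open>0 < r\<close> by (simp add: mult.assoc[symmetric] ennreal_mult[symmetric] powr_add[symmetric])
  finally show "?H (f ` E) \<le> ennreal (r powr s) * ?H E" .
  have "dist (inv f x) (inv f y) \<le> (1 / r) * dist x y" for x y
    using sim[of "inv f x" "inv f y"] \<open>0 < r\<close> by (simp add: surj_f_inv_f[OF \<open>surj f\<close>])
  then have "ennreal ((1 / r) powr - s) * ?H (inv f ` f ` E) \<le> ?H (f ` E)"
    using assms by (intro hausdorff_outer_Lipschitz) auto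
  then show "ennreal (r powr s) * ?H E \<le> ?H (f ` E)"
    using inj \<open>0 < r\<close> by (simp add: image_inv_f_f powr_divide powr_minus field_simps)
qed

text \<open>Raising the exponent by \<open>t - s > 0\<close> gains a factor \<open>\<epsilon> powr (t - s)\<close> at scale \<open>\<epsilon>\<close>.\<close>

lemma hausdorff_outer_eq_0_of_finite:
  assumes "0 \<le> s" "s < t" and fin: "hausdorff_outer diameter s E < top"
  shows "hausdorff_outer diameter t E = 0"
proof -
  obtain c where c: "0 \<le> c" "hausdorff_outer diameter s E = ennreal c"
    using fin by (cases "hausdorff_outer diameter s E") auto
  have pre: "hausdorff_premeasure diameter t \<epsilon> E \<le> ennreal (\<epsilon> powr (t - s) * (c + 1))" if \<epsilon>: "0 < \<epsilon>" for \<epsilon>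
  proof -
    have "hausdorff_premeasure diameter s \<epsilon> E \<le> ennreal c"
      using hausdorff_premeasure_le_outer[OF \<epsilon>, of diameter s E] c by simp
    also have "\<dots> < ennreal (c + 1)" using c by (intro ennreal_lessI) auto
    finally obtain U where U: "small_cover diameter \<epsilon> E U" "(\<Sum>n. size_powr diameter s (U n)) < ennreal (c + 1)"
      by (rule hausdorff_premeasure_close)
    have "hausdorff_premeasure diameter t \<epsilon> E \<le> (\<Sum>n. size_powr diameter t (U n))"
      using U(1) by (rule hausdorff_premeasure_le)
    also have "\<dots> \<le> (\<Sum>n. ennreal (\<epsilon> powr (t - s)) * size_powr diameter s (U n))"
    proof (intro suminf_le)
      fix n
      have d: "0 \<le> diameter (U n)" "diameter (U n) \<le> \<epsilon>"
        using U(1) by (auto simp: small_cover_def intro: diameter_ge_0)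
      have "diameter (U n) powr t \<le> \<epsilon> powr (t - s) * (if s = 0 then 1 else diameter (U n) powr s)"
      proof (cases "diameter (U n) = 0")
        case False
        then have "diameter (U n) powr t = diameter (U n) powr (t - s) * diameter (U n) powr s"
          by (simp add: powr_add[symmetric])
        also have "\<dots> \<le> \<epsilon> powr (t - s) * diameter (U n) powr s"
          using d assms by (intro mult_right_mono powr_mono2) auto
        finally show ?thesis using False d by (cases "s = 0") auto
      qed auto
      then show "size_powr diameter t (U n) \<le> ennreal (\<epsilon> powr (t - s)) * size_powr diameter s (U n)"
        using assms by (auto simp: size_powr_def ennreal_mult[symmetric] ennreal_leI)
    qed auto
    also have "\<dots> = ennreal (\<epsilon> powr (t - s)) * (\<Sum>n. size_powr diameter s (U n))"
      by (rule ennreal_suminf_cmult)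
    also have "\<dots> \<le> ennreal (\<epsilon> powr (t - s)) * ennreal (c + 1)"
      using U(2) by (intro mult_left_mono) auto
    also have "\<dots> = ennreal (\<epsilon> powr (t - s) * (c + 1))"
      using c by (intro ennreal_mult[symmetric]) auto
    finally show ?thesis .
  qed
  have "hausdorff_outer diameter t E \<le> 0"
  proof (rule hausdorff_outer_le)
    fix \<epsilon> :: real assume \<epsilon>: "0 < \<epsilon>"
    have lim: "((\<lambda>x. ennreal (x powr (t - s) * (c + 1))) \<longlongrightarrow> ennreal (0 powr (t - s) * (c + 1))) (at_right 0)"
      using assms by (intro tendsto_ennrealI tendsto_intros) (auto simp: eventually_at_right_less intro: eventually_at_rightI[of 0 1])
    have "hausdorff_premeasure diameter t \<epsilon> E \<le> ennreal (0 powr (t - s) * (c + 1))"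
    proof (rule tendsto_lowerbound[OF lim])
      show "\<forall>\<^sub>F x in at_right 0. hausdorff_premeasure diameter t \<epsilon> E \<le> ennreal (x powr (t - s) * (c + 1))"
      proof (rule eventually_at_rightI[OF _ \<epsilon>])
        fix x assume "x \<in> {0<..<\<epsilon>}"
        then show "hausdorff_premeasure diameter t \<epsilon> E \<le> ennreal (x powr (t - s) * (c + 1))"
          using pre[of x] hausdorff_premeasure_antimono[of x \<epsilon> diameter t E] by auto
      qed
    qed auto
    then show "hausdorff_premeasure diameter t \<epsilon> E \<le> 0" by simp
  qed
  then show ?thesis by simp
qed

theorem hausdorff_outer_eq_0_iff:
  assumes "0 \<le> s" "0 \<le> t" and fin: "0 < hausdorff_outer diameter s E" "hausdorff_outer diameter s E < top"
  shows "hausdorff_outer diameter t E = 0 \<longleftrightarrow> s < t"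
proof
  assume 0: "hausdorff_outer diameter t E = 0"
  show "s < t"
  proof (rule ccontr)
    assume "\<not> s < t"
    then show False
      using hausdorff_outer_eq_0_of_finite[of t s E] assms 0 by (cases "s = t") auto
  qed
qed (rule hausdorff_outer_eq_0_of_finite[OF assms(1) _ fin(2)])

text \<open>
  A bound \<open>\<epsilon>\<^sup>2\<close> on the square of the diameter is a bound \<open>\<epsilon>\<close> on the diameter, so measuring sets by
  the area of a square only halves the exponent.
\<close>

lemma hausdorff_outer_diam_area:
  "hausdorff_outer diam_area s E = hausdorff_outer diameter (2 * s) E"
proof -
  have size: "size_powr diam_area s U = size_powr diameter (2 * s) U" if "bounded U" for U :: "'a set"
  proof -
    have "(diameter U)\<^sup>2 powr s = diameter U powr (2 * s)"
      using diameter_ge_0[OF that] powr_powr[of "diameter U" 2 s] by simp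
    then show ?thesis by (simp add: size_powr_def diam_area_def)
  qed
  have pre: "hausdorff_premeasure diam_area s (\<epsilon>\<^sup>2) E = hausdorff_premeasure diameter (2 * s) \<epsilon> E" if "0 < \<epsilon>" for \<epsilon>
  proof -
    have "diam_area U \<le> \<epsilon>\<^sup>2 \<longleftrightarrow> diameter U \<le> \<epsilon>" if "bounded U" for U :: "'a set"
      unfolding diam_area_def using diameter_ge_0[OF that] \<open>0 < \<epsilon>\<close>
      by (intro power_mono_iff) auto
    then show ?thesis
      unfolding hausdorff_premeasure_def by (intro INF_cong) (auto simp: size)
  qed
  have sq: "(\<lambda>x::real. x\<^sup>2) ` {0<..} = {0<..}"
  proof
    show "{0<..} \<subseteq> (\<lambda>x::real. x\<^sup>2) ` {0<..}"
    proof
      fix x :: real assume "x \<in> {0<..}"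
      then show "x \<in> (\<lambda>x::real. x\<^sup>2) ` {0<..}"
        by (intro image_eqI[of _ _ "sqrt x"]) auto
    qed
  qed auto
  show ?thesis
    unfolding hausdorff_outer_def
    by (subst sq[symmetric]) (auto simp: image_image pre intro!: SUP_cong)
qed

lemma hausdorff_measure_diam_area:
  "(hausdorff_measure_wrt diam_area s :: 'a::metric_space measure) = hausdorff_measure (2 * s)"
proof -
  have "(hausdorff_outer diam_area s :: 'a set \<Rightarrow> ennreal) = hausdorff_outer diameter (2 * s)"
    by (rule ext) (rule hausdorff_outer_diam_area)
  then show ?thesis unfolding hausdorff_measure_wrt_def by simp
qed

lemma Inf_ereal_greaterThan: "(INF t\<in>{t. d < t}. ereal t) = ereal d"
proof (rule antisym)
  show "(INF t\<in>{t. d < t}. ereal t) \<le> ereal d"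
  proof (rule ereal_le_epsilon2)
    fix e :: real assume "0 < e"
    then show "(INF t\<in>{t. d < t}. ereal t) \<le> ereal d + ereal e"
      by (intro INF_lower2[of "d + e"]) auto
  qed
qed (auto intro!: INF_greatest)

theorem hausdorff_dim_eqI:
  assumes "0 \<le> s" "0 < hausdorff_outer diameter s E" "hausdorff_outer diameter s E < top"
  shows "hausdorff_dim E = ereal s" "hausdorff_dim_wrt diam_area E = ereal (s / 2)"
proof -
  have "{t. 0 \<le> t \<and> hausdorff_outer diameter t E = 0} = {t. s < t}"
    using hausdorff_outer_eq_0_iff[OF assms(1) _ assms(2,3)] assms(1) by auto
  then show "hausdorff_dim E = ereal s"
    unfolding hausdorff_dim_wrt_def by (simp only: Inf_ereal_greaterThan)
  have "{t. 0 \<le> t \<and> hausdorff_outer diam_area t E = 0} = {t. s / 2 < t}"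
    using hausdorff_outer_eq_0_iff[OF assms(1) _ assms(2,3)] assms(1)
    by (auto simp: hausdorff_outer_diam_area)
  then show "hausdorff_dim_wrt diam_area E = ereal (s / 2)"
    unfolding hausdorff_dim_wrt_def by (simp only: Inf_ereal_greaterThan)
qed

section \<open>The fractal and its self-similarity\<close>

lemma nadic_summable:
  assumes "2 \<le> N" "\<And>k. xs k < N"
  shows "summable (\<lambda>k. real (xs k) / real N ^ Suc k)"
proof (rule summable_comparison_test)
  show "\<exists>N0. \<forall>k\<ge>N0. norm (real (xs k) / real N ^ Suc k) \<le> (1 / real N) ^ k"
    using assms by (auto intro!: exI[of _ 0] simp: field_simps less_imp_le)
  show "summable (\<lambda>k. (1 / real N) ^ k)"
    using assms(1) by (intro summable_geometric) auto
qed

lemma nadic_Suc: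
  assumes "2 \<le> N" "\<And>k. xs k < N"
  shows "nadic N xs = (nadic N (\<lambda>k. xs (Suc k)) + real (xs 0)) / real N"
proof -
  have "nadic N xs = (\<Sum>k. real (xs (Suc k)) / real N ^ Suc (Suc k)) + real (xs 0) / real N"
    unfolding nadic_def using suminf_split_head[OF nadic_summable[of N xs]] assms by simp
  also have "(\<Sum>k. real (xs (Suc k)) / real N ^ Suc (Suc k))
      = (\<Sum>k. (1 / real N) * (real (xs (Suc k)) / real N ^ Suc k))"
    by simp
  also have "\<dots> = (1 / real N) * nadic N (\<lambda>k. xs (Suc k))"
    unfolding nadic_def using assms by (intro suminf_mult nadic_summable) auto
  finally show ?thesis by (simp add: add_divide_distrib)
qed

lemma nadic_nonneg: "0 \<le> nadic N xs" if "2 \<le> N" "\<And>k. xs k < N"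
  unfolding nadic_def using that by (intro suminf_nonneg nadic_summable) auto

lemma nadic_le_1:
  assumes "2 \<le> N" "\<And>k. xs k < N"
  shows "nadic N xs \<le> 1"
proof -
  let ?g = "\<lambda>k. (real N - 1) / real N * (1 / real N) ^ k"
  have g: "?g sums ((real N - 1) / real N * (1 / (1 - 1 / real N)))"
    using assms(1) by (intro sums_mult geometric_sums) auto
  have "nadic N xs \<le> suminf ?g"
    unfolding nadic_def
  proof (intro suminf_le nadic_summable assms sums_summable[OF g])
    show "real (xs k) / real N ^ Suc k \<le> ?g k" for k
      using assms(1) assms(2)[of k] by (simp add: field_simps)
  qed
  also have "\<dots> = 1"
    using sums_unique[OF g] assms(1) by (simp add: field_simps)
  finally show ?thesis .
qed

text \<open>The integer whose base \<open>N\<close> digits are the first \<open>n\<close> entries of \<open>xs\<close>.\<close>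

primrec digit_prefix :: "nat \<Rightarrow> (nat \<Rightarrow> nat) \<Rightarrow> nat \<Rightarrow> nat" where
  "digit_prefix N xs 0 = 0"
| "digit_prefix N xs (Suc n) = N * digit_prefix N xs n + xs n"

lemma nadic_prefix:
  assumes "2 \<le> N" "\<And>k. xs k < N"
  shows "nadic N xs * real N ^ n = real (digit_prefix N xs n) + nadic N (\<lambda>k. xs (n + k))"
proof (induction n)
  case (Suc n)
  have "nadic N (\<lambda>k. xs (n + k)) * real N = nadic N (\<lambda>k. xs (Suc n + k)) + real (xs n)"
    using nadic_Suc[of N "\<lambda>k. xs (n + k)"] assms by (simp add: field_simps)
  then show ?case
    using Suc.IH by (simp add: algebra_simps)
qed simp

lemma digit_prefix_inj:
  assumes "\<And>k. xs k < N" "\<And>k. ys k < N"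
  shows "digit_prefix N xs n = digit_prefix N ys n \<Longrightarrow> k < n \<Longrightarrow> xs k = ys k"
proof (induction n)
  case (Suc n)
  have "(N * digit_prefix N xs n + xs n) div N = (N * digit_prefix N ys n + ys n) div N"
    "(N * digit_prefix N xs n + xs n) mod N = (N * digit_prefix N ys n + ys n) mod N"
    using Suc.prems(1) by simp_all
  then have "digit_prefix N xs n = digit_prefix N ys n" "xs n = ys n"
    using assms[of n] by (auto simp: div_mult_self4)
  then show ?case using Suc by (auto simp: less_Suc_eq)
qed simp

lemma allowed_iff: "ij \<in> allowed N A \<longleftrightarrow> fst ij < N \<and> snd ij < N \<and> A (fst ij) (snd ij) = 1"
  by (simp add: allowed_def case_prod_beta)

text \<open>
  A base \<open>N\<close> and a matrix with at least one entry equal to 1. Only the positions of these entries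
  matter, so that the other entries need not be 0.
\<close>

locale sierp =
  fixes N :: nat and A :: "nat \<Rightarrow> nat \<Rightarrow> nat"
  assumes N2: "2 \<le> N" and allowed_nonempty: "allowed N A \<noteq> {}"
begin

abbreviation K :: "(real \<times> real) set" where "K \<equiv> sierpinski N A"

text \<open>
  The number \<open>D\<close> of branches, the dimension \<open>s = log D / log N\<close>, which is characterised by
  \<open>N powr s = D\<close>, and the point \<open>code w\<close> whose pairs of digits form the sequence \<open>w\<close>.
\<close>

definition D :: nat where "D = card (allowed N A)"

definition s :: real where "s = ln (real D) / ln (real N)"

definition code :: "(nat \<Rightarrow> nat \<times> nat) \<Rightarrow> real \<times> real" where
  "code w = (nadic N (\<lambda>k. fst (w k)), nadic N (\<lambda>k. snd (w k)))"

lemma finite_allowed [simp]: "finite (allowed N A)"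
  by (rule finite_subset[of _ "{..<N} \<times> {..<N}"]) (auto simp: allowed_def)

lemma D_pos: "0 < D"
  using allowed_nonempty by (simp add: D_def card_gt_0_iff)

lemma s_nonneg: "0 \<le> s"
  using D_pos N2 by (auto simp: s_def)

lemma N_powr_s: "real N powr s = real D"
  using D_pos N2 by (simp add: s_def powr_def)

lemma allowed_less: "w \<in> UNIV \<rightarrow> allowed N A \<Longrightarrow> fst (w k) < N" "w \<in> UNIV \<rightarrow> allowed N A \<Longrightarrow> snd (w k) < N"
  by (auto simp: allowed_iff Pi_iff)

lemma K_eq: "K = code ` (UNIV \<rightarrow> allowed N A)"
proof (intro equalityI subsetI)
  fix p assume "p \<in> K"
  then obtain xs ys where "p = (nadic N xs, nadic N ys)" "admissible N A xs ys"
    by (auto simp: sierpinski_def)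
  then show "p \<in> code ` (UNIV \<rightarrow> allowed N A)"
    by (intro image_eqI[of _ _ "\<lambda>k. (xs k, ys k)"]) (auto simp: code_def admissible_def allowed_def)
next
  fix p assume "p \<in> code ` (UNIV \<rightarrow> allowed N A)"
  then obtain w where "p = code w" "\<And>k. w k \<in> allowed N A" by (auto simp: Pi_iff)
  then show "p \<in> K"
    unfolding sierpinski_def code_def admissible_def
    by (intro CollectI exI[of _ "\<lambda>k. fst (w k)"] exI[of _ "\<lambda>k. snd (w k)"]) (auto simp: allowed_iff)
qed

lemma code_Suc:
  assumes "w \<in> UNIV \<rightarrow> allowed N A"
  shows "code w = sierp_map N (w 0) (code (\<lambda>k. w (Suc k)))"
  unfolding code_def sierp_map_def fst_conv snd_conv
  by (intro arg_cong2[of _ _ _ _ Pair] nadic_Suc N2 allowed_less assms)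

lemma sierp_map_K: "ij \<in> allowed N A \<Longrightarrow> p \<in> K \<Longrightarrow> sierp_map N ij p \<in> K"
proof -
  assume ij: "ij \<in> allowed N A" and "p \<in> K"
  then obtain w where w: "w \<in> UNIV \<rightarrow> allowed N A" "p = code w"
    by (auto simp: K_eq)
  let ?w = "case_nat ij w"
  have "?w \<in> UNIV \<rightarrow> allowed N A"
    using ij w(1) by (auto simp: Pi_iff split: nat.splits)
  then have "code ?w \<in> K" and "code ?w = sierp_map N (?w 0) (code (\<lambda>k. ?w (Suc k)))"
    unfolding K_eq by (rule imageI, rule code_Suc)
  then show ?thesis by (simp add: w(2))
qed

lemma K_Union: "K = (\<Union>ij\<in>allowed N A. sierp_map N ij ` K)"
proof (intro equalityI subsetI)
  fix p assume "p \<in> K"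
  then obtain w where w: "w \<in> UNIV \<rightarrow> allowed N A" "p = code w"
    by (auto simp: K_eq)
  have "(\<lambda>k. w (Suc k)) \<in> UNIV \<rightarrow> allowed N A" using w(1) by auto
  then show "p \<in> (\<Union>ij\<in>allowed N A. sierp_map N ij ` K)"
    using code_Suc[OF w(1)] w by (auto simp: K_eq intro!: bexI[of _ "w 0"])
qed (auto intro: sierp_map_K)

lemma K_unit_square: "K \<subseteq> {0..1} \<times> {0..1}"
proof
  fix p assume "p \<in> K"
  then obtain w where "w \<in> UNIV \<rightarrow> allowed N A" "p = code w"
    by (auto simp: K_eq)
  note less = allowed_less[OF this(1)] and this(2)
  then show "p \<in> {0..1} \<times> {0..1}"
    using nadic_nonneg[OF N2 less(1)] nadic_nonneg[OF N2 less(2)]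
      nadic_le_1[OF N2 less(1)] nadic_le_1[OF N2 less(2)]
    by (simp add: code_def)
qed

lemma continuous_on_nadic:
  fixes f :: "nat \<Rightarrow> 'a::topological_space \<Rightarrow> nat"
  assumes "\<And>k x. x \<in> S \<Longrightarrow> f k x < N" and "\<And>k. continuous_on S (f k)"
  shows "continuous_on S (\<lambda>x. nadic N (\<lambda>k. f k x))"
  unfolding nadic_def
proof (rule uniform_limit_theorem)
  show "uniform_limit S (\<lambda>n x. \<Sum>k<n. real (f k x) / real N ^ Suc k) (\<lambda>x. \<Sum>k. real (f k x) / real N ^ Suc k) sequentially"
  proof (rule Weierstrass_m_test)
    show "norm (real (f k x) / real N ^ Suc k) \<le> (1 / real N) ^ k" if "x \<in> S" for k x
      using assms(1)[OF that, of k] N2 by (simp add: field_simps less_imp_le)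
    show "summable (\<lambda>k. (1 / real N) ^ k)"
      using N2 by (intro summable_geometric) auto
  qed
  have "continuous_on S (\<lambda>x. real (f k x))" for k
    using continuous_on_compose2[of UNIV real S "f k"] assms(2) by simp
  then show "\<forall>\<^sub>F n in sequentially. continuous_on S (\<lambda>x. \<Sum>k<n. real (f k x) / real N ^ Suc k)"
    using N2 by (intro always_eventually allI continuous_on_sum continuous_on_divide continuous_on_const) auto
qed simp

text \<open>
  The digit sequences form a compact space by Tychonoff's theorem, and the coding is continuous as a
  uniform limit of functions of finitely many digits.
\<close>

lemma compact_K: "compact K"
  unfolding K_eq
proof (rule compact_continuous_image)
  have "compactin (product_topology (\<lambda>_::nat. euclidean) UNIV) (PiE UNIV (\<lambda>_. allowed N A))"
    by (auto simp: compactin_PiE intro: finite_imp_compact)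
  then show "compact ((UNIV :: nat set) \<rightarrow> allowed N A)"
    by (simp add: euclidean_product_topology PiE_UNIV_domain)
  have "continuous_on S (\<lambda>w :: nat \<Rightarrow> nat \<times> nat. w k)" for S k
    by (rule continuous_on_subset[OF continuous_on_product_coordinates]) auto
  then show "continuous_on (UNIV \<rightarrow> allowed N A) code"
    unfolding code_def
    by (intro continuous_on_Pair continuous_on_nadic allowed_less continuous_on_fst continuous_on_snd) auto
qed

lemma K_borel [measurable]: "K \<in> sets borel"
  by (rule borel_compact[OF compact_K])

lemma dist_sierp_map: "dist (sierp_map N ij p) (sierp_map N ij q) = 1 / real N * dist p q"
proof -
  have "dist ((a + c) / real N) ((b + c) / real N) = dist a b / real N" for a b c
    by (simp add: dist_real_def diff_divide_distrib[symmetric])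
  then have "dist (sierp_map N ij p) (sierp_map N ij q)
      = sqrt ((dist (fst p) (fst q) / real N)\<^sup>2 + (dist (snd p) (snd q) / real N)\<^sup>2)"
    by (simp add: sierp_map_def dist_Pair_Pair)
  also have "\<dots> = sqrt (((dist (fst p) (fst q))\<^sup>2 + (dist (snd p) (snd q))\<^sup>2) / (real N)\<^sup>2)"
    by (simp add: power_divide add_divide_distrib)
  also have "\<dots> = dist p q / real N"
    using N2 by (simp add: real_sqrt_divide dist_prod_def)
  finally show ?thesis by simp
qed

text \<open>The inverse of \<open>sierp_map N ij\<close> on the whole plane.\<close>

definition sierp_inv :: "nat \<times> nat \<Rightarrow> real \<times> real \<Rightarrow> real \<times> real" where
  "sierp_inv ij p = (real N * fst p - real (fst ij), real N * snd p - real (snd ij))"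

lemma sierp_inv_map [simp]: "sierp_inv ij (sierp_map N ij p) = p"
  and sierp_map_inv [simp]: "sierp_map N ij (sierp_inv ij p) = p"
  using N2 by (auto simp: sierp_inv_def sierp_map_def)

lemma sierp_map_surj: "surj (sierp_map N ij)" and sierp_map_inj: "inj (sierp_map N ij)"
  by (metis sierp_map_inv surj_def) (metis sierp_inv_map injI)

lemma sierp_map_image: "sierp_map N ij ` E = sierp_inv ij -` E"
  by (auto simp: image_iff) (metis sierp_map_inv)

lemma sierp_map_measurable [measurable]: "sierp_map N ij \<in> borel_measurable borel"
  and sierp_inv_measurable [measurable]: "sierp_inv ij \<in> borel_measurable borel"
  unfolding sierp_map_def sierp_inv_def
  using N2 by (auto intro!: borel_measurable_continuous_onI continuous_intros)

lemma sierp_map_image_borel: "E \<in> sets borel \<Longrightarrow> sierp_map N ij ` E \<in> sets borel"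
  unfolding sierp_map_image by (rule measurable_sets_borel[OF sierp_inv_measurable])

lemma hausdorff_outer_sierp_map:
  "hausdorff_outer diameter s (sierp_map N ij ` E) = hausdorff_outer diameter s E / of_nat D"
proof -
  have "(1 / real N) powr s = 1 / real D"
    using N2 N_powr_s by (simp add: powr_divide)
  moreover have "hausdorff_outer diameter s (sierp_map N ij ` E)
      = ennreal ((1 / real N) powr s) * hausdorff_outer diameter s E"
    using N2 by (intro hausdorff_outer_similarity dist_sierp_map sierp_map_surj s_nonneg) auto
  moreover have "inverse (of_nat D :: ennreal) = ennreal (1 / real D)"
    using D_pos inverse_ennreal[of "real D"]
    by (simp add: ennreal_of_nat_eq_real_of_nat inverse_eq_divide)
  ultimately show ?thesis
    unfolding divide_ennreal_def by (simp only: mult.commute)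
qed

text \<open>
  The fractal is covered by itself, and passing to the \<open>D\<close> images of a cover under the maps
  \<open>sierp_map N ij\<close> divides all diameters by \<open>N\<close> but leaves the sum of their powers unchanged, since
  \<open>D = N powr s\<close>. The number 2 is an upper bound for the diameter of the unit square.
\<close>

lemma hausdorff_premeasure_K_le: "hausdorff_premeasure diameter s (2 / real N ^ n) K \<le> ennreal (2 powr s)"
proof (induction n)
  case 0
  have K: "bounded K" "diameter K \<le> 2"
  proof -
    show "bounded K" using compact_K by (rule compact_imp_bounded)
    show "diameter K \<le> 2"
    proof (rule diameter_le)
      fix p q assume "p \<in> K" "q \<in> K"
      then have "\<bar>fst p - fst q\<bar> \<le> 1" "\<bar>snd p - snd q\<bar> \<le> 1"
        using subsetD[OF K_unit_square, of p] subsetD[OF K_unit_square, of q]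
        by (auto simp: abs_le_iff mem_Times_iff)
      moreover have "norm (p - q) \<le> norm (fst p - fst q) + norm (snd p - snd q)"
        using norm_Pair_le[of "fst p - fst q" "snd p - snd q"] by (simp add: minus_prod_def)
      ultimately show "norm (p - q) \<le> 2" by simp
    qed simp
  qed
  let ?U = "\<lambda>n::nat. if n = 0 then K else {}"
  have "small_cover diameter (2 / real N ^ 0) K ?U"
    using K by (auto simp: small_cover_def)
  then have "hausdorff_premeasure diameter s (2 / real N ^ 0) K \<le> (\<Sum>n. size_powr diameter s (?U n))"
    by (rule hausdorff_premeasure_le)
  also have "\<dots> = (\<Sum>n\<in>{0}. size_powr diameter s (?U n))"
    by (rule suminf_finite) auto
  also have "\<dots> \<le> ennreal (2 powr s)"
    using K diameter_ge_0[OF K(1)] s_nonneg by (auto simp: size_powr_def intro!: ennreal_leI powr_mono2)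
  finally show ?case .
next
  case (Suc n)
  let ?H = "\<lambda>n. hausdorff_premeasure diameter s (2 / real N ^ n)"
  have step: "?H (Suc n) (sierp_map N ij ` K) \<le> ?H n K / of_nat D" for ij
  proof -
    have "ennreal ((1 / real N) powr - s) * ?H (Suc n) (sierp_map N ij ` K)
        \<le> hausdorff_premeasure diameter s (2 / real N ^ Suc n / (1 / real N)) K"
      using N2 by (intro hausdorff_premeasure_Lipschitz s_nonneg) (auto simp: dist_sierp_map)
    also have "2 / real N ^ Suc n / (1 / real N) = 2 / real N ^ n" using N2 by simp
    also have "(1 / real N) powr - s = real D"
      using N2 N_powr_s by (simp add: powr_divide powr_minus_divide)
    finally have "of_nat D * ?H (Suc n) (sierp_map N ij ` K) \<le> ?H n K"
      by (simp add: ennreal_of_nat_eq_real_of_nat)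
    then have "?H (Suc n) (sierp_map N ij ` K) * of_nat D / of_nat D \<le> ?H n K / of_nat D"
      by (intro divide_right_mono_ennreal) (simp add: mult.commute)
    then show ?thesis
      using D_pos by (simp add: mult_divide_eq_ennreal)
  qed
  have "?H (Suc n) K = ?H (Suc n) (\<Union>ij\<in>allowed N A. sierp_map N ij ` K)"
    using K_Union by simp
  also have "\<dots> \<le> (\<Sum>ij\<in>allowed N A. ?H (Suc n) (sierp_map N ij ` K))"
    using N2 by (intro outer_measure_finite_UN_le hausdorff_premeasure_outer_measure_space) auto
  also have "\<dots> \<le> (\<Sum>ij\<in>allowed N A. ?H n K / of_nat D)"
    by (intro sum_mono step)
  also have "\<dots> = of_nat D * (?H n K / of_nat D)"
    by (simp add: D_def)
  also have "\<dots> = ?H n K"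
    using D_pos mult_divide_eq_ennreal[of "of_nat D" "?H n K"]
    by (simp add: ennreal_times_divide mult.commute)
  finally show ?case using Suc.IH by simp
qed

lemma hausdorff_outer_K_finite: "hausdorff_outer diameter s K < top"
proof -
  have "hausdorff_outer diameter s K \<le> ennreal (2 powr s)"
  proof (rule hausdorff_outer_le)
    fix \<epsilon> :: real assume "0 < \<epsilon>"
    then obtain n where "(1 / real N) ^ n < \<epsilon> / 2"
      using real_arch_pow_inv[of "\<epsilon> / 2" "1 / real N"] N2 by auto
    then have "2 / real N ^ n \<le> \<epsilon>" by (simp add: power_divide)
    then show "hausdorff_premeasure diameter s \<epsilon> K \<le> ennreal (2 powr s)"
      using hausdorff_premeasure_antimono[of "2 / real N ^ n" \<epsilon> diameter s K] hausdorff_premeasure_K_le[of n]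
      by (meson order_trans)
  qed
  then show ?thesis by (rule le_less_trans) simp
qed

end

section \<open>Positivity of the Hausdorff measure\<close>

context sierp
begin

text \<open>
  The distribution of a sequence of independent digit pairs, each uniformly distributed on the
  allowed positions.
\<close>

definition digit_measure :: "(nat \<Rightarrow> nat \<times> nat) measure" where
  "digit_measure = PiM UNIV (\<lambda>_. uniform_count_measure (allowed N A))"

lemma product_prob_space_allowed:
  "product_prob_space (\<lambda>_. uniform_count_measure (allowed N A))"
  using allowed_nonempty by (intro product_prob_spaceI prob_space_uniform_count_measure) auto

lemma space_digit_measure: "space digit_measure = UNIV \<rightarrow> allowed N A"
  by (simp add: digit_measure_def space_PiM PiE_UNIV_domain space_uniform_count_measure)

lemma emeasure_digit_space: "emeasure digit_measure (space digit_measure) = 1"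
  unfolding digit_measure_def
  by (intro prob_space.emeasure_space_1 prob_space_PiM prob_space_uniform_count_measure allowed_nonempty) auto

lemma emeasure_digit_cylinder:
  assumes "w0 \<in> space digit_measure"
  shows "{w \<in> space digit_measure. \<forall>k\<in>{..<n}. w k \<in> {w0 k}} \<in> sets digit_measure"
    and "emeasure digit_measure {w \<in> space digit_measure. \<forall>k\<in>{..<n}. w k \<in> {w0 k}} = ennreal ((1 / real D) ^ n)"
proof -
  interpret product_prob_space "\<lambda>_::nat. uniform_count_measure (allowed N A)" UNIV
    by (rule product_prob_space_allowed)
  have in_allowed: "w0 k \<in> allowed N A" for k
    using assms unfolding space_digit_measure by (rule Pi_mem) (rule UNIV_I)
  have in_sets: "{w0 k} \<in> sets (uniform_count_measure (allowed N A))" for k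
    using in_allowed by (simp add: sets_uniform_count_measure)
  have single: "emeasure (uniform_count_measure (allowed N A)) {w0 k} = ennreal (1 / real D)" for k
    using in_allowed by (subst emeasure_uniform_count_measure) (simp_all add: D_def)
  show "{w \<in> space digit_measure. \<forall>k\<in>{..<n}. w k \<in> {w0 k}} \<in> sets digit_measure"
    unfolding digit_measure_def using in_sets
    by (intro sets.sets_Collect_finite_All sets_Collect_single') (auto simp: space_PiM space_uniform_count_measure sets_uniform_count_measure)
  show "emeasure digit_measure {w \<in> space digit_measure. \<forall>k\<in>{..<n}. w k \<in> {w0 k}} = ennreal ((1 / real D) ^ n)"
    unfolding digit_measure_def using in_sets
    by (subst emeasure_PiM_Collect) (auto simp: single ennreal_power)
qed

text \<open>
  The lower left corner of the \<open>N\<close>-adic square of level \<open>n\<close> of a digit sequence, in multiples of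
  \<open>1 / N ^ n\<close>.
\<close>

definition corner :: "nat \<Rightarrow> (nat \<Rightarrow> nat \<times> nat) \<Rightarrow> nat \<times> nat" where
  "corner n w = (digit_prefix N (\<lambda>k. fst (w k)) n, digit_prefix N (\<lambda>k. snd (w k)) n)"

lemma corner_inj:
  assumes "w \<in> UNIV \<rightarrow> allowed N A" "w' \<in> UNIV \<rightarrow> allowed N A" "corner n w = corner n w'" "k < n"
  shows "w k = w' k"
proof (rule prod_eqI)
  note less = allowed_less[OF assms(1)] allowed_less[OF assms(2)]
  show "fst (w k) = fst (w' k)"
    using digit_prefix_inj[of "\<lambda>k. fst (w k)" N "\<lambda>k. fst (w' k)" n k] less assms(3,4)
    by (simp add: corner_def)
  show "snd (w k) = snd (w' k)"
    using digit_prefix_inj[of "\<lambda>k. snd (w k)" N "\<lambda>k. snd (w' k)" n k] less assms(3,4)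
    by (simp add: corner_def)
qed

lemma corner_fibre:
  "\<exists>B. B \<in> sets digit_measure \<and> emeasure digit_measure B \<le> ennreal ((1 / real D) ^ n) \<and>
     {w \<in> space digit_measure. corner n w = c} \<subseteq> B"
proof (cases "{w \<in> space digit_measure. corner n w = c} = {}")
  case True
  then show ?thesis by (intro exI[of _ "{}"]) auto
next
  case False
  then obtain w0 where w0: "w0 \<in> space digit_measure" "corner n w0 = c" by blast
  have "{w \<in> space digit_measure. corner n w = c}
      \<subseteq> {w \<in> space digit_measure. \<forall>k\<in>{..<n}. w k \<in> {w0 k}}"
  proof
    fix w assume "w \<in> {w \<in> space digit_measure. corner n w = c}"
    then have w: "w \<in> space digit_measure" "corner n w = corner n w0" by (simp_all add: w0(2))
    then have "w k = w0 k" if "k < n" for k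
      using w0(1) that by (intro corner_inj[of w w0 n k]) (simp_all add: space_digit_measure)
    with w(1) show "w \<in> {w \<in> space digit_measure. \<forall>k\<in>{..<n}. w k \<in> {w0 k}}" by simp
  qed
  with emeasure_digit_cylinder[OF w0(1), of n] show ?thesis
    by (intro exI[of _ "{w \<in> space digit_measure. \<forall>k\<in>{..<n}. w k \<in> {w0 k}}"]) simp
qed

text \<open>
  The number \<open>nadic N xs * N ^ n\<close> exceeds its truncation to an integer by at most 1 and differs from
  \<open>x * N ^ n\<close> by less than 1, which leaves at most four integers.
\<close>

lemma prefix_window:
  assumes "\<And>k. xs k < N" and "\<bar>nadic N xs - x\<bar> < 1 / real N ^ n"
  shows "digit_prefix N xs n \<in> {nat \<lceil>x * real N ^ n - 2\<rceil>..nat \<lceil>x * real N ^ n - 2\<rceil> + 3}"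
proof -
  have "\<bar>nadic N xs * real N ^ n - x * real N ^ n\<bar> < 1"
  proof -
    have "\<bar>nadic N xs * real N ^ n - x * real N ^ n\<bar> = \<bar>nadic N xs - x\<bar> * real N ^ n"
      by (simp add: abs_mult left_diff_distrib[symmetric])
    also have "\<dots> < 1 / real N ^ n * real N ^ n"
      using assms(2) N2 by (intro mult_strict_right_mono) auto
    finally show ?thesis using N2 by simp
  qed
  moreover have "0 \<le> nadic N (\<lambda>k. xs (n + k))" "nadic N (\<lambda>k. xs (n + k)) \<le> 1"
    using assms(1) by (auto intro!: nadic_nonneg nadic_le_1 N2)
  moreover have "nadic N xs * real N ^ n = real (digit_prefix N xs n) + nadic N (\<lambda>k. xs (n + k))"
    by (rule nadic_prefix[OF N2 assms(1)])
  ultimately have "x * real N ^ n - 2 \<le> real (digit_prefix N xs n)"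
    "real (digit_prefix N xs n) \<le> x * real N ^ n + 1"
    by linarith+
  then show ?thesis by (auto simp: nat_le_iff) linarith+
qed

text \<open>A set of diameter below \<open>1 / N ^ n\<close> meets at most 16 of the \<open>N\<close>-adic squares of level \<open>n\<close>.\<close>

lemma small_set_measure_le:
  assumes small: "\<And>p q. p \<in> U \<Longrightarrow> q \<in> U \<Longrightarrow> dist p q < 1 / real N ^ n"
  shows "\<exists>B\<in>sets digit_measure. emeasure digit_measure B \<le> ennreal (16 * (1 / real D) ^ n) \<and> {w \<in> space digit_measure. code w \<in> U} \<subseteq> B"
proof (cases "U = {}")
  case True
  then show ?thesis by (intro bexI[of _ "{}"]) auto
next
  case False
  then obtain p where p: "p \<in> U" by blast
  obtain C where "\<forall>c. C c \<in> sets digit_measure \<and> emeasure digit_measure (C c) \<le> ennreal ((1 / real D) ^ n)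
      \<and> {w \<in> space digit_measure. corner n w = c} \<subseteq> C c"
    using choice[OF allI[OF corner_fibre[of n]]] by (rule exE)
  then have C: "C c \<in> sets digit_measure" "emeasure digit_measure (C c) \<le> ennreal ((1 / real D) ^ n)"
      "{w \<in> space digit_measure. corner n w = c} \<subseteq> C c" for c
    by blast+
  define W where "W t = {nat \<lceil>t * real N ^ n - 2\<rceil>..nat \<lceil>t * real N ^ n - 2\<rceil> + 3}" for t :: real
  have W: "finite (W t)" "card (W t) = 4" for t by (simp_all add: W_def)
  define B where "B = (\<Union>ab\<in>W (fst p) \<times> W (snd p). C ab)"
  have "{w \<in> space digit_measure. code w \<in> U} \<subseteq> B"
  proof safe
    fix w assume w: "w \<in> space digit_measure" "code w \<in> U"
    then have "w \<in> UNIV \<rightarrow> allowed N A" by (simp add: space_digit_measure)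
    note less = allowed_less[OF this]
    have d: "dist (code w) p < 1 / real N ^ n" using small w(2) p by blast
    have "digit_prefix N (\<lambda>k. fst (w k)) n \<in> W (fst p)"
      unfolding W_def using d dist_fst_le[of "code w" p] less
      by (intro prefix_window) (auto simp: code_def dist_real_def)
    moreover have "digit_prefix N (\<lambda>k. snd (w k)) n \<in> W (snd p)"
      unfolding W_def using d dist_snd_le[of "code w" p] less
      by (intro prefix_window) (auto simp: code_def dist_real_def)
    ultimately show "w \<in> B"
      unfolding B_def
      using subsetD[OF C(3), of w "corner n w"] w(1) by (intro UN_I) (auto simp: corner_def)
  qed
  moreover have "emeasure digit_measure B \<le> (\<Sum>ab\<in>W (fst p) \<times> W (snd p). emeasure digit_measure (C ab))"
    unfolding B_def using C(1) W by (intro emeasure_subadditive_finite) auto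
  then have "emeasure digit_measure B \<le> (\<Sum>ab\<in>W (fst p) \<times> W (snd p). ennreal ((1 / real D) ^ n))"
    by (rule order_trans) (intro sum_mono C(2))
  then have "emeasure digit_measure B \<le> ennreal (16 * (1 / real D) ^ n)"
    using W by (simp add: card_cartesian_product ennreal_mult ennreal_numeral)
  moreover have "B \<in> sets digit_measure" unfolding B_def using C(1) W by auto
  ultimately show ?thesis by blast
qed

lemma power_inverse_powr_s: "((1 / real N) ^ n) powr s = (1 / real D) ^ n"
proof -
  have "((1 / real N) ^ n) powr s = ((1 / real N) powr s) ^ n"
    using N2 by (simp add: powr_realpow[symmetric] powr_powr mult.commute)
  then show ?thesis using N2 N_powr_s by (simp add: powr_divide)
qed

text \<open>
  The image of \<open>digit_measure\<close> under the coding gives a set mass at most of the order of the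
  \<open>s\<close>-th power of its diameter. The error \<open>e\<close> is needed for sets of diameter 0 when \<open>s > 0\<close>, which
  lie in small squares of every level. Stating the bound for a measurable superset \<open>B\<close> avoids
  measurability of \<open>U\<close> and of the coding.
\<close>

lemma mass_distribution:
  assumes U: "bounded U" "U \<noteq> {}" "diameter U < 1" and "0 < (e::real)"
  shows "\<exists>B\<in>sets digit_measure. emeasure digit_measure B \<le> ennreal (16 * real D) * size_powr diameter s U + ennreal e
    \<and> {w \<in> space digit_measure. code w \<in> U} \<subseteq> B"
proof -
  have dist: "dist p q \<le> diameter U" if "p \<in> U" "q \<in> U" for p q
    using U(1) that by (rule diameter_bounded_bound)
  have d0: "0 \<le> diameter U" using U(1) by (rule diameter_ge_0)
  have D1: "1 \<le> real D" using D_pos by simp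
  consider "s = 0" | "s > 0" "diameter U = 0" | "s > 0" "diameter U > 0"
    using s_nonneg d0 by linarith
  then show ?thesis
  proof cases
    case 1
    have "1 \<le> ennreal (16 * real D)" using D1 by (simp add: ennreal_ge_1)
    then have "emeasure digit_measure (space digit_measure) \<le> ennreal (16 * real D) * size_powr diameter s U + ennreal e"
      using 1 U(2) by (simp add: size_powr_def emeasure_digit_space add_increasing2)
    then show ?thesis by (intro bexI[of _ "space digit_measure"]) auto
  next
    case 2
    have "1 < real D"
      using 2(1) N2 D_pos unfolding s_def by (simp add: zero_less_divide_iff ln_gt_zero_iff del: of_nat_less_iff)
    then obtain n where n: "(1 / real D) ^ n < e / 16"
      using real_arch_pow_inv[of "e / 16" "1 / real D"] \<open>0 < e\<close> by auto
    have "dist p q < 1 / real N ^ n" if "p \<in> U" "q \<in> U" for p q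
      using dist[OF that] 2(2) N2 by (auto intro: le_less_trans)
    then obtain B where "B \<in> sets digit_measure" "emeasure digit_measure B \<le> ennreal (16 * (1 / real D) ^ n)" "{w \<in> space digit_measure. code w \<in> U} \<subseteq> B"
      using small_set_measure_le by blast
    moreover have "ennreal (16 * (1 / real D) ^ n) \<le> ennreal e" using n by (intro ennreal_leI) simp
    ultimately show ?thesis
      by (meson add_increasing order_trans zero_le)
  next
    case 3
    obtain m0 where "(1 / real N) ^ m0 < diameter U"
      using real_arch_pow_inv[of "diameter U" "1 / real N"] 3(2) N2 by auto
    \<comment> \<open>The level \<open>n\<close> for which the diameter lies between \<open>1 / N ^ (n + 1)\<close> and \<open>1 / N ^ n\<close>.\<close>
    define m where "m = (LEAST m. (1 / real N) ^ m \<le> diameter U)"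
    have m: "(1 / real N) ^ m \<le> diameter U"
      unfolding m_def using less_imp_le[OF \<open>(1 / real N) ^ m0 < diameter U\<close>] by (rule LeastI)
    have "m \<noteq> 0" using m U(3) by (intro notI) simp
    then obtain n where n: "m = Suc n" using not0_implies_Suc by blast
    have "\<not> (1 / real N) ^ n \<le> diameter U"
      using not_less_Least[of n "\<lambda>m. (1 / real N) ^ m \<le> diameter U"] n unfolding m_def by simp
    then have "dist p q < 1 / real N ^ n" if "p \<in> U" "q \<in> U" for p q
      using dist[OF that] by (simp add: power_divide)
    then obtain B where B: "B \<in> sets digit_measure" "emeasure digit_measure B \<le> ennreal (16 * (1 / real D) ^ n)" "{w \<in> space digit_measure. code w \<in> U} \<subseteq> B"
      using small_set_measure_le by blast
    have "(1 / real D) ^ n = real D * (1 / real D) ^ m" using n D1 by simp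
    also have "(1 / real D) ^ m = ((1 / real N) ^ m) powr s" by (rule power_inverse_powr_s[symmetric])
    also have "\<dots> \<le> diameter U powr s" using m s_nonneg by (intro powr_mono2) auto
    finally have "ennreal (16 * (1 / real D) ^ n) \<le> ennreal (16 * real D * diameter U powr s)"
      using D1 by (intro ennreal_leI) simp
    also have "\<dots> = ennreal (16 * real D) * size_powr diameter s U"
      using U(2) 3 by (simp add: size_powr_def ennreal_mult)
    finally have "emeasure digit_measure B \<le> ennreal (16 * real D) * size_powr diameter s U + ennreal e"
      using B(2) by (meson add_increasing2 order_trans zero_le)
    with B show ?thesis by blast
  qed
qed

text \<open>
  The preimages of the sets of a cover of \<open>K\<close> exhaust the probability space of digit sequences.
\<close>

lemma hausdorff_outer_K_pos: "0 < hausdorff_outer diameter s K"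
proof -
  have "ennreal (1 / (32 * real D)) \<le> hausdorff_premeasure diameter s (1 / 2) K"
  proof (rule hausdorff_premeasure_ge)
    fix U assume U: "small_cover diameter (1 / 2) K U"
    \<comment> \<open>The errors add up to \<open>1 / 2\<close>, so the rest of the total mass 1 bounds the sum of the sizes.\<close>
    let ?e = "\<lambda>k::nat. (1 / 2) * (1 / 2) ^ Suc k :: real"
    have "\<exists>B. B \<in> sets digit_measure \<and> emeasure digit_measure B \<le> ennreal (16 * real D) * size_powr diameter s (U k) + ennreal (?e k)
        \<and> {w \<in> space digit_measure. code w \<in> U k} \<subseteq> B" for k
    proof (cases "U k = {}")
      case True
      then show ?thesis by (intro exI[of _ "{}"]) auto
    next
      case False
      have "bounded (U k)" and "diameter (U k) \<le> 1 / 2"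
        using U unfolding small_cover_def by blast+
      then have "bounded (U k)" "diameter (U k) < 1" by simp_all
      from mass_distribution[OF this(1) False this(2), of "?e k"] show ?thesis by auto
    qed
    then obtain B where B: "\<And>k. B k \<in> sets digit_measure"
        "\<And>k. emeasure digit_measure (B k) \<le> ennreal (16 * real D) * size_powr diameter s (U k) + ennreal (?e k)"
        "\<And>k. {w \<in> space digit_measure. code w \<in> U k} \<subseteq> B k"
      using choice[of "\<lambda>k B. B \<in> sets digit_measure \<and> emeasure digit_measure B \<le> ennreal (16 * real D) * size_powr diameter s (U k) + ennreal (?e k)
        \<and> {w \<in> space digit_measure. code w \<in> U k} \<subseteq> B"] by blast
    have "w \<in> (\<Union>k. B k)" if "w \<in> space digit_measure" for w
    proof -
      have "code w \<in> K" using that by (simp add: K_eq space_digit_measure)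
      then obtain k where "code w \<in> U k" using U unfolding small_cover_def by blast
      with B(3)[of k] that show ?thesis by blast
    qed
    then have "1 \<le> emeasure digit_measure (\<Union>k. B k)"
      using B(1) by (subst emeasure_digit_space[symmetric]) (intro emeasure_mono, auto)
    also have "\<dots> \<le> (\<Sum>k. emeasure digit_measure (B k))"
      using B(1) by (intro emeasure_subadditive_countably) auto
    also have "\<dots> \<le> (\<Sum>k. ennreal (16 * real D) * size_powr diameter s (U k) + ennreal (?e k))"
      by (intro suminf_le B(2)) auto
    also have "\<dots> = ennreal (16 * real D) * (\<Sum>k. size_powr diameter s (U k)) + (\<Sum>k. ennreal (?e k))"
      by (subst suminf_add[symmetric]) (auto simp del: power_Suc)
    also have "(\<Sum>k. ennreal (?e k)) = ennreal (1 / 2)"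
      using sums_mult[OF power_half_series, of "1 / 2"]
      by (intro suminf_ennreal_eq) auto
    finally have *: "1 \<le> ennreal (16 * real D) * (\<Sum>k. size_powr diameter s (U k)) + ennreal (1 / 2)" .
    show "ennreal (1 / (32 * real D)) \<le> (\<Sum>k. size_powr diameter s (U k))"
    proof (cases "\<Sum>k. size_powr diameter s (U k)")
      case (real r)
      with * have "ennreal 1 \<le> ennreal (16 * real D * r + 1 / 2)"
        by (simp add: ennreal_mult ennreal_plus)
      then have "1 / 2 \<le> 16 * real D * r"
        using real(1) by (subst (asm) ennreal_le_iff) auto
      then show ?thesis
        unfolding real using D_pos by (intro ennreal_leI) (simp add: field_simps)
    qed simp
  qed
  also have "\<dots> \<le> hausdorff_outer diameter s K"
    by (rule hausdorff_premeasure_le_outer) simp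
  finally have "ennreal (1 / (32 * real D)) \<le> hausdorff_outer diameter s K" .
  then show ?thesis
    by (rule less_le_trans[rotated]) (use D_pos in simp)
qed

end

section \<open>The semibranching function system\<close>

context sierp
begin

text \<open>The Hausdorff measure of dimension \<open>s\<close>, as a measure on the fractal.\<close>

definition \<mu> :: "(real \<times> real) measure" where
  "\<mu> = restrict_space (hausdorff_measure s) K"

lemma space_\<mu> [simp]: "space \<mu> = K"
  by (simp add: \<mu>_def space_restrict_space)

lemma sets_\<mu>: "E \<in> sets \<mu> \<longleftrightarrow> E \<in> sets borel \<and> E \<subseteq> K"
  by (auto simp: \<mu>_def sets_restrict_space_iff)

lemma emeasure_\<mu>: "E \<in> sets \<mu> \<Longrightarrow> emeasure \<mu> E = hausdorff_outer diameter s E"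
  by (simp add: \<mu>_def emeasure_restrict_space emeasure_hausdorff_measure sets_restrict_space_iff)

lemma measurable_\<mu>_borel: "f \<in> measurable borel L \<Longrightarrow> f \<in> measurable \<mu> L"
  unfolding \<mu>_def
  by (rule measurable_restrict_space1)
     (simp only: measurable_cong_sets[OF sets_hausdorff_measure refl])

lemma measurable_\<mu>_\<mu>: "f \<in> measurable borel borel \<Longrightarrow> (\<And>x. x \<in> K \<Longrightarrow> f x \<in> K) \<Longrightarrow> f \<in> measurable \<mu> \<mu>"
proof (subst (2) \<mu>_def, rule measurable_restrict_space2)
  assume f: "f \<in> measurable borel borel" and "\<And>x. x \<in> K \<Longrightarrow> f x \<in> K"
  then show "f \<in> space \<mu> \<rightarrow> K" by simp
  show "f \<in> measurable \<mu> (hausdorff_measure s)"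
    using measurable_\<mu>_borel[OF f] by (simp only: measurable_cong_sets[OF refl sets_hausdorff_measure])
qed

lemma finite_measure_\<mu>: "finite_measure \<mu>"
proof
  have "K \<in> sets \<mu>" by (simp add: sets_\<mu>)
  then show "emeasure \<mu> (space \<mu>) \<noteq> \<infinity>"
    using hausdorff_outer_K_finite by (simp add: emeasure_\<mu>)
qed

lemma sierp_map_sets: "ij \<in> allowed N A \<Longrightarrow> E \<in> sets \<mu> \<Longrightarrow> sierp_map N ij ` E \<in> sets \<mu>"
  by (auto simp: sets_\<mu> sierp_map_image_borel sierp_map_K subset_iff)

lemma sierp_map_measurable_\<mu>: "ij \<in> allowed N A \<Longrightarrow> sierp_map N ij \<in> measurable \<mu> \<mu>"
  by (intro measurable_\<mu>_\<mu> sierp_map_measurable sierp_map_K)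

lemma emeasure_sierp_map:
  "ij \<in> allowed N A \<Longrightarrow> E \<in> sets \<mu> \<Longrightarrow> emeasure \<mu> (sierp_map N ij ` E) = emeasure \<mu> E / of_nat D"
  by (simp add: emeasure_\<mu> sierp_map_sets hausdorff_outer_sierp_map)

lemma K_sets [measurable]: "K \<in> sets \<mu>"
  by (simp add: sets_\<mu>)

text \<open>
  The \<open>D\<close> ranges have measure \<open>\<mu>(K) / D\<close> each and cover \<open>K\<close>, so they leave no room for overlaps.
\<close>

lemma overlap_null:
  assumes "i \<in> allowed N A" "j \<in> allowed N A" "i \<noteq> j"
  shows "emeasure \<mu> (sierp_map N i ` K \<inter> sierp_map N j ` K) = 0"
proof -
  interpret finite_measure \<mu> by (rule finite_measure_\<mu>)
  let ?R = "\<lambda>k. sierp_map N k ` K"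
  have R [measurable]: "?R k \<in> sets \<mu>" if "k \<in> allowed N A" for k
    using that by (rule sierp_map_sets) (rule K_sets)
  have meas: "measure \<mu> (?R k) = measure \<mu> K / real D" if "k \<in> allowed N A" for k
  proof -
    have "ennreal (measure \<mu> (?R k)) = ennreal (measure \<mu> K) / ennreal (real D)"
      using emeasure_sierp_map[OF that K_sets]
      by (simp add: emeasure_eq_measure ennreal_of_nat_eq_real_of_nat)
    also have "\<dots> = ennreal (measure \<mu> K / real D)"
      using D_pos by (intro divide_ennreal) auto
    finally show ?thesis by (simp add: divide_nonneg_nonneg)
  qed
  let ?J = "allowed N A - {i, j}"
  have "K = (?R i \<union> ?R j) \<union> (\<Union>k\<in>?J. ?R k)"
    using K_Union assms by blast
  then have "measure \<mu> K = measure \<mu> ((?R i \<union> ?R j) \<union> (\<Union>k\<in>?J. ?R k))" by simp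
  also have "\<dots> \<le> measure \<mu> (?R i \<union> ?R j) + measure \<mu> (\<Union>k\<in>?J. ?R k)"
    using R assms by (intro measure_Un_le sets.Un sets.finite_UN) auto
  also have "measure \<mu> (\<Union>k\<in>?J. ?R k) \<le> (\<Sum>k\<in>?J. measure \<mu> (?R k))"
    using R by (intro measure_UNION_le) auto
  also have "(\<Sum>k\<in>?J. measure \<mu> (?R k)) = (\<Sum>k\<in>?J. measure \<mu> K / real D)"
    by (intro sum.cong) (auto simp: meas)
  also have "\<dots> = (real D - 2) * (measure \<mu> K / real D)"
  proof -
    have "card {i, j} \<le> D" unfolding D_def using assms by (intro card_mono) auto
    moreover have "card ?J = D - card {i, j}"
      unfolding D_def using assms by (intro card_Diff_subset) auto
    ultimately show ?thesis using assms(3) by simp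
  qed
  also have "measure \<mu> (?R i \<union> ?R j) = measure \<mu> (?R i) + measure \<mu> (?R j) - measure \<mu> (?R i \<inter> ?R j)"
    using R assms by (subst finite_measure_Union') (auto simp: finite_measure_Diff' Int_commute)
  finally have "measure \<mu> (?R i \<inter> ?R j) \<le> 0"
    using D_pos by (simp add: meas assms field_simps mult_le_0_iff)
  then have "measure \<mu> (?R i \<inter> ?R j) = 0" by (intro antisym) auto
  then show ?thesis by (simp add: emeasure_eq_measure)
qed

lemma pulled_measure_sierp_map:
  assumes "ij \<in> allowed N A"
  shows "pulled_measure \<mu> K (sierp_map N ij) = density \<mu> (\<lambda>_. ennreal (1 / real D))"
proof -
  have "pulled_measure \<mu> K (sierp_map N ij)
      = measure_of (space \<mu>) (sets \<mu>) (emeasure (density \<mu> (\<lambda>_. ennreal (1 / real D))))"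
    unfolding pulled_measure_def
  proof (rule measure_of_eq)
    fix E assume "E \<in> sigma_sets (space \<mu>) (sets \<mu>)"
    then have E: "E \<in> sets \<mu>" by (simp only: sets.sigma_sets_eq)
    then have "emeasure \<mu> (sierp_map N ij ` (E \<inter> K)) = emeasure \<mu> E / of_nat D"
      using emeasure_sierp_map[OF assms E] by (auto simp: sets_\<mu> Int_absorb2)
    also have "\<dots> = ennreal (1 / real D) * emeasure \<mu> E"
      using D_pos inverse_ennreal[of "real D"] unfolding divide_ennreal_def
      by (simp add: ennreal_of_nat_eq_real_of_nat inverse_eq_divide mult.commute)
    also have "\<dots> = emeasure (density \<mu> (\<lambda>_. ennreal (1 / real D))) E"
      using E by (simp add: emeasure_density nn_integral_cmult)
    finally show "emeasure \<mu> (sierp_map N ij ` (E \<inter> K)) = \<dots>" .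
  qed (rule sets.space_closed)
  also have "\<dots> = density \<mu> (\<lambda>_. ennreal (1 / real D))"
    using measure_of_of_measure[of "density \<mu> (\<lambda>_. ennreal (1 / real D))"] by simp
  finally show ?thesis .
qed

lemma sbfs_deriv_sierp_map:
  assumes "ij \<in> allowed N A"
  shows "AE x in \<mu>. sbfs_deriv \<mu> K (sierp_map N ij) x = ennreal (1 / real D)"
proof -
  interpret finite_measure \<mu> by (rule finite_measure_\<mu>)
  have "AE x in \<mu>. ennreal (1 / real D) = RN_deriv \<mu> (pulled_measure \<mu> K (sierp_map N ij)) x"
    by (rule RN_deriv_unique) (simp_all add: pulled_measure_sierp_map[OF assms])
  then show ?thesis unfolding sbfs_deriv_def by eventually_elim simp
qed

lemma semibranching_sierp:
  "semibranching_system \<mu> (allowed N A) (\<lambda>_. K) (sierp_map N)"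
  unfolding semibranching_system_def
proof (intro conjI ballI impI)
  fix ij assume ij: "ij \<in> allowed N A"
  have "restrict_space \<mu> K = \<mu>"
    using restrict_space_sets_cong[of K K "hausdorff_measure s"] by (simp add: \<mu>_def restrict_restrict_space)
  then show "sierp_map N ij \<in> measurable (restrict_space \<mu> K) \<mu>"
    using sierp_map_measurable_\<mu>[OF ij] by simp
  have "density \<mu> (sbfs_deriv \<mu> K (sierp_map N ij)) = density \<mu> (\<lambda>_. ennreal (1 / real D))"
    by (rule density_cong) (simp_all add: sbfs_deriv_def sbfs_deriv_sierp_map[OF ij, unfolded sbfs_deriv_def])
  then show "density \<mu> (sbfs_deriv \<mu> K (sierp_map N ij)) = pulled_measure \<mu> K (sierp_map N ij)"
    by (simp add: pulled_measure_sierp_map[OF ij])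
  show "AE x in \<mu>. x \<in> K \<longrightarrow> 0 < sbfs_deriv \<mu> K (sierp_map N ij) x"
    using sbfs_deriv_sierp_map[OF ij] by eventually_elim (use D_pos in simp)
next
  have "space \<mu> - (\<Union>ij\<in>allowed N A. sierp_map N ij ` K) = {}"
    using K_Union by simp
  then show "emeasure \<mu> (space \<mu> - (\<Union>ij\<in>allowed N A. sierp_map N ij ` K)) = 0"
    by (simp only: emeasure_empty)
qed (auto intro: overlap_null sierp_map_sets)

text \<open>
  A Borel version of the shift: use the inverse of the first branch, in some enumeration, whose
  range contains the point.
\<close>

lemma digit_shift_exists: "\<exists>\<sigma>. is_digit_shift N A \<sigma> \<and> \<sigma> \<in> measurable \<mu> \<mu>"
proof -
  define f where "f = from_nat_into (allowed N A)"
  have f: "f n \<in> allowed N A" for n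
    unfolding f_def using allowed_nonempty by (rule from_nat_into)
  have f_surj: "\<exists>n. f n = ij" if "ij \<in> allowed N A" for ij
    unfolding f_def using that by (intro from_nat_into_surj countable_finite) auto
  define n where "n p = (LEAST n. p \<in> sierp_map N (f n) ` K)" for p
  define \<sigma> where "\<sigma> p = sierp_inv (f (n p)) p" for p
  have n: "p \<in> sierp_map N (f (n p)) ` K" if "p \<in> K" for p
  proof -
    have "p \<in> (\<Union>ij\<in>allowed N A. sierp_map N ij ` K)"
      using that by (subst (asm) K_Union)
    then obtain ij where ij: "ij \<in> allowed N A" "p \<in> sierp_map N ij ` K" by (rule UN_E)
    obtain m where "f m = ij" using f_surj[OF ij(1)] by (rule exE)
    with ij(2) have "p \<in> sierp_map N (f m) ` K" by (simp only:)
    then show ?thesis unfolding n_def by (rule LeastI)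
  qed
  have \<sigma>: "\<sigma> p \<in> K" "sierp_map N (f (n p)) (\<sigma> p) = p" if "p \<in> K" for p
  proof -
    show "sierp_map N (f (n p)) (\<sigma> p) = p" by (simp add: \<sigma>_def)
    obtain q where "q \<in> K" "p = sierp_map N (f (n p)) q" using n[OF \<open>p \<in> K\<close>] by blast
    then have "\<sigma> p = q" unfolding \<sigma>_def by (metis sierp_inv_map)
    with \<open>q \<in> K\<close> show "\<sigma> p \<in> K" by simp
  qed
  have "is_digit_shift N A \<sigma>"
    unfolding is_digit_shift_def
  proof
    fix p assume p: "p \<in> K"
    obtain w where w: "w \<in> UNIV \<rightarrow> allowed N A" "\<sigma> p = code w"
      using \<sigma>(1)[OF p] by (auto simp: K_eq)
    obtain w' where w': "w' 0 = f (n p)" "\<And>k. w' (Suc k) = w k"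
      by (rule that[of "case_nat (f (n p)) w"]) simp_all
    have "w' k \<in> allowed N A" for k
      using w(1) f w' by (cases k) auto
    then have adm: "admissible N A (\<lambda>k. fst (w' k)) (\<lambda>k. snd (w' k))" and "w' \<in> UNIV \<rightarrow> allowed N A"
      by (auto simp: admissible_def allowed_iff)
    from code_Suc[OF this(2)] have "code w' = p"
      unfolding w' w(2)[symmetric] by (rule trans) (rule \<sigma>(2)[OF p])
    then show "\<exists>xs ys. admissible N A xs ys \<and> p = (nadic N xs, nadic N ys)
        \<and> \<sigma> p = (nadic N (\<lambda>k. xs (Suc k)), nadic N (\<lambda>k. ys (Suc k)))"
      using adm unfolding code_def w(2)
      by (intro exI[of _ "\<lambda>k. fst (w' k)"] exI[of _ "\<lambda>k. snd (w' k)"]) (simp add: w')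
  qed
  moreover have "\<sigma> \<in> measurable \<mu> \<mu>"
  proof (rule measurable_\<mu>_\<mu>)
    have "Measurable.pred borel (\<lambda>p. p \<in> sierp_map N (f m) ` K)" for m
      using sierp_map_image_borel[OF K_borel, of "f m"] by (simp add: pred_def)
    then have "(\<lambda>p. LEAST m. p \<in> sierp_map N (f m) ` K) \<in> measurable borel (count_space UNIV)"
      by (rule measurable_Least)
    then have "n \<in> measurable borel (count_space UNIV)"
      by (simp only: n_def[abs_def])
    then have "(\<lambda>p. sierp_inv (f (n p)) p) \<in> borel_measurable borel"
      by (rule measurable_compose_countable[OF sierp_inv_measurable])
    then show "\<sigma> \<in> borel_measurable borel"
      by (simp only: \<sigma>_def[abs_def])
  qed (rule \<sigma>(1))
  ultimately show ?thesis by blast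
qed

text \<open>
  Whatever expansion \<open>\<sigma>\<close> uses at \<open>sierp_map N ij x\<close>, its first digit pair is \<open>ij\<close> unless the point
  lies in the range of another branch, and this happens for a null set of \<open>x\<close> only.
\<close>

lemma digit_shift_AE:
  assumes \<sigma>: "is_digit_shift N A \<sigma>" and ij: "ij \<in> allowed N A"
  shows "AE x in \<mu>. \<sigma> (sierp_map N ij x) = x"
proof -
  have null: "AE x in \<mu>. sierp_map N ij x \<notin> sierp_map N kl ` K" if kl: "kl \<in> allowed N A - {ij}" for kl
  proof -
    let ?B = "{x \<in> space \<mu>. sierp_map N ij x \<in> sierp_map N kl ` K}"
    have B: "?B \<in> sets \<mu>"
      using measurable_sets[OF sierp_map_measurable_\<mu>[OF ij] sierp_map_sets[OF _ K_sets], of kl] kl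
      by (simp add: vimage_def Int_def conj_commute)
    have "sierp_map N ij ` ?B = sierp_map N ij ` K \<inter> sierp_map N kl ` K"
      unfolding space_\<mu> by blast
    moreover have "kl \<in> allowed N A" "ij \<noteq> kl" using kl by auto
    ultimately have "emeasure \<mu> ?B / of_nat D = 0"
      using emeasure_sierp_map[OF ij B] overlap_null[OF ij, of kl] by simp
    then have "emeasure \<mu> ?B = 0" by simp
    with B show ?thesis by (intro AE_I[of _ _ ?B]) auto
  qed
  have "AE x in \<mu>. \<forall>kl\<in>allowed N A - {ij}. sierp_map N ij x \<notin> sierp_map N kl ` K"
    by (rule AE_finite_allI) (auto intro: null)
  moreover have "AE x in \<mu>. x \<in> K" by (rule AE_I2) simp
  ultimately show ?thesis
  proof eventually_elim
    case (elim x)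
    obtain xs ys where xy: "admissible N A xs ys" "sierp_map N ij x = (nadic N xs, nadic N ys)"
        "\<sigma> (sierp_map N ij x) = (nadic N (\<lambda>k. xs (Suc k)), nadic N (\<lambda>k. ys (Suc k)))"
      using \<sigma> sierp_map_K[OF ij elim(2)] unfolding is_digit_shift_def by blast
    define w where "w k = (xs k, ys k)" for k
    have w: "w \<in> UNIV \<rightarrow> allowed N A" "(\<lambda>k. w (Suc k)) \<in> UNIV \<rightarrow> allowed N A"
      using xy(1) by (auto simp: w_def admissible_def allowed_iff)
    have eq: "sierp_map N (w 0) (\<sigma> (sierp_map N ij x)) = sierp_map N ij x"
      using code_Suc[OF w(1)] xy(2,3) by (simp add: code_def w_def)
    have "\<sigma> (sierp_map N ij x) = code (\<lambda>k. w (Suc k))"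
      using xy(3) by (simp add: code_def w_def)
    then have "\<sigma> (sierp_map N ij x) \<in> K"
      using w(2) by (simp add: K_eq)
    with eq have "sierp_map N ij x \<in> sierp_map N (w 0) ` K" by (metis imageI)
    moreover have "w 0 \<in> allowed N A" using w(1) by auto
    ultimately have "w 0 = ij" using elim(1) by blast
    with eq have "sierp_map N ij (\<sigma> (sierp_map N ij x)) = sierp_map N ij x" by blast
    then show "\<sigma> (sierp_map N ij x) = x"
      by (rule injD[OF sierp_map_inj])
  qed
qed

end

section \<open>Square-integrable functions\<close>

lemma borel_measurable_cnj [measurable]:
  "f \<in> borel_measurable M \<Longrightarrow> (\<lambda>x. cnj (f x)) \<in> borel_measurable M"
  by (rule measurable_compose[OF _ borel_measurable_continuous_onI[OF continuous_on_cnj[OF continuous_on_id]]])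

lemma quadratic_discriminant_le:
  fixes a b c :: real
  assumes "0 < c" "0 \<le> a - 2 * (b / c) * b + (b / c)\<^sup>2 * c"
  shows "b\<^sup>2 \<le> a * c"
proof -
  have "a - 2 * (b / c) * b + (b / c)\<^sup>2 * c = a - b\<^sup>2 / c"
    using assms(1) by (simp add: power2_eq_square field_simps)
  with assms(2) have "b\<^sup>2 / c \<le> a" by simp
  then show ?thesis using assms(1) by (simp only: pos_divide_le_eq)
qed

lemma sq_intI: "\<psi> \<in> borel_measurable M \<Longrightarrow> integrable M (\<lambda>x. (cmod (\<psi> x))\<^sup>2) \<Longrightarrow> \<psi> \<in> sq_int M"
  by (simp add: sq_int_def)

lemma sq_intD:
  assumes "\<psi> \<in> sq_int M"
  shows "\<psi> \<in> borel_measurable M" "integrable M (\<lambda>x. (cmod (\<psi> x))\<^sup>2)"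
  using assms by (auto simp: sq_int_def)

lemma sq_int_zero: "(\<lambda>x. 0) \<in> sq_int M"
  by (rule sq_intI) auto

lemma sq_int_add:
  assumes "\<phi> \<in> sq_int M" "\<psi> \<in> sq_int M"
  shows "(\<lambda>x. \<phi> x + \<psi> x) \<in> sq_int M"
proof (rule sq_intI)
  note [measurable] = sq_intD(1)[OF assms(1)] sq_intD(1)[OF assms(2)]
  show "(\<lambda>x. \<phi> x + \<psi> x) \<in> borel_measurable M" by measurable
  have "integrable M (\<lambda>x. 2 * (cmod (\<phi> x))\<^sup>2 + 2 * (cmod (\<psi> x))\<^sup>2)"
    using sq_intD(2)[OF assms(1)] sq_intD(2)[OF assms(2)] by (intro Bochner_Integration.integrable_add integrable_mult_right) auto
  then show "integrable M (\<lambda>x. (cmod (\<phi> x + \<psi> x))\<^sup>2)"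
  proof (rule Bochner_Integration.integrable_bound)
    have "(cmod (a + b))\<^sup>2 \<le> 2 * (cmod a)\<^sup>2 + 2 * (cmod b)\<^sup>2" for a b
    proof -
      have "(cmod (a + b))\<^sup>2 \<le> (cmod a + cmod b)\<^sup>2"
        by (intro power_mono norm_triangle_ineq) auto
      also have "\<dots> \<le> 2 * (cmod a)\<^sup>2 + 2 * (cmod b)\<^sup>2"
        using sum_squares_bound[of "cmod a" "cmod b"] by (simp add: power2_sum)
      finally show ?thesis .
    qed
    then show "AE x in M. norm ((cmod (\<phi> x + \<psi> x))\<^sup>2) \<le> norm (2 * (cmod (\<phi> x))\<^sup>2 + 2 * (cmod (\<psi> x))\<^sup>2)"
      by (intro AE_I2) simp
  qed measurable
qed

lemma sq_int_scale:
  assumes "\<psi> \<in> sq_int M"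
  shows "(\<lambda>x. c * \<psi> x) \<in> sq_int M"
  using sq_intD[OF assms] by (intro sq_intI) (auto simp: norm_mult power_mult_distrib)

lemma sq_int_diff:
  assumes "\<phi> \<in> sq_int M" "\<psi> \<in> sq_int M"
  shows "(\<lambda>x. \<phi> x - \<psi> x) \<in> sq_int M"
  using sq_int_add[OF assms(1) sq_int_scale[OF assms(2), of "-1"]] by simp

lemma sq_int_sum:
  "(\<And>i. i \<in> I \<Longrightarrow> \<psi> i \<in> sq_int M) \<Longrightarrow> (\<lambda>x. \<Sum>i\<in>I. \<psi> i x) \<in> sq_int M"
  by (induction I rule: infinite_finite_induct) (auto intro: sq_int_zero sq_int_add)

lemma l2_norm_nonneg: "0 \<le> l2_norm M \<psi>"
  by (simp add: l2_norm_def)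

lemma l2_norm_sq: "(l2_norm M \<psi>)\<^sup>2 = (\<integral>x. (cmod (\<psi> x))\<^sup>2 \<partial>M)"
  by (simp add: l2_norm_def)

lemma l2_norm_cong:
  assumes "\<phi> \<in> borel_measurable M" "\<psi> \<in> borel_measurable M" "AE x in M. \<phi> x = \<psi> x"
  shows "l2_norm M \<phi> = l2_norm M \<psi>"
proof -
  have "(\<integral>x. (cmod (\<phi> x))\<^sup>2 \<partial>M) = (\<integral>x. (cmod (\<psi> x))\<^sup>2 \<partial>M)"
    using assms by (intro integral_cong_AE) (auto elim: eventually_mono)
  then show ?thesis by (simp add: l2_norm_def)
qed

lemma l2_norm_eq_0:
  assumes "\<psi> \<in> sq_int M" "l2_norm M \<psi> = 0"
  shows "AE x in M. \<psi> x = 0"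
proof -
  have "(\<integral>x. (cmod (\<psi> x))\<^sup>2 \<partial>M) = 0" using assms(2) by (simp add: l2_norm_def)
  then have "AE x in M. (cmod (\<psi> x))\<^sup>2 = 0"
    using sq_intD(2)[OF assms(1)] by (subst (asm) integral_nonneg_eq_0_iff_AE) auto
  then show ?thesis by eventually_elim simp
qed

lemma l2_norm_AE_0: "\<psi> \<in> borel_measurable M \<Longrightarrow> AE x in M. \<psi> x = 0 \<Longrightarrow> l2_norm M \<psi> = 0"
  using l2_norm_cong[of \<psi> M "\<lambda>_. 0"] by (simp add: l2_norm_def)

lemma l2_norm_scale: "l2_norm M (\<lambda>x. c * \<psi> x) = cmod c * l2_norm M \<psi>"
  by (simp add: l2_norm_def norm_mult power_mult_distrib real_sqrt_mult)

lemma l2_norm_minus_commute: "l2_norm M (\<lambda>x. \<phi> x - \<psi> x) = l2_norm M (\<lambda>x. \<psi> x - \<phi> x)"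
  by (simp add: l2_norm_def norm_minus_commute)

lemma l2_product_integrable:
  assumes "\<phi> \<in> sq_int M" "\<psi> \<in> sq_int M"
  shows "integrable M (\<lambda>x. cmod (\<phi> x) * cmod (\<psi> x))"
proof (rule Bochner_Integration.integrable_bound)
  note [measurable] = sq_intD(1)[OF assms(1)] sq_intD(1)[OF assms(2)]
  show "integrable M (\<lambda>x. (cmod (\<phi> x))\<^sup>2 + (cmod (\<psi> x))\<^sup>2)"
    using sq_intD(2)[OF assms(1)] sq_intD(2)[OF assms(2)] by (intro Bochner_Integration.integrable_add integrable_mult_right) auto
  show "(\<lambda>x. cmod (\<phi> x) * cmod (\<psi> x)) \<in> borel_measurable M" by measurable
  have "a * b \<le> a\<^sup>2 + b\<^sup>2" if "0 \<le> a" "0 \<le> b" for a b :: real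
    using sum_squares_bound[of a b] that mult_nonneg_nonneg[OF that] by linarith
  then show "AE x in M. norm (cmod (\<phi> x) * cmod (\<psi> x)) \<le> norm ((cmod (\<phi> x))\<^sup>2 + (cmod (\<psi> x))\<^sup>2)"
    by (intro AE_I2) simp
qed

lemma l2_inner_integrable:
  assumes "\<phi> \<in> sq_int M" "\<psi> \<in> sq_int M"
  shows "integrable M (\<lambda>x. \<phi> x * cnj (\<psi> x))"
proof (rule Bochner_Integration.integrable_bound[OF l2_product_integrable[OF assms]])
  note [measurable] = sq_intD(1)[OF assms(1)] sq_intD(1)[OF assms(2)]
  show "(\<lambda>x. \<phi> x * cnj (\<psi> x)) \<in> borel_measurable M" by measurable
qed (simp add: norm_mult)

lemma l2_Cauchy_Schwarz_cmod:
  assumes "\<phi> \<in> sq_int M" "\<psi> \<in> sq_int M"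
  shows "(\<integral>x. cmod (\<phi> x) * cmod (\<psi> x) \<partial>M) \<le> l2_norm M \<phi> * l2_norm M \<psi>"
proof -
  let ?a = "(l2_norm M \<phi>)\<^sup>2" and ?b = "\<integral>x. cmod (\<phi> x) * cmod (\<psi> x) \<partial>M" and ?c = "(l2_norm M \<psi>)\<^sup>2"
  note int = sq_intD(2)[OF assms(1)] sq_intD(2)[OF assms(2)] l2_product_integrable[OF assms]
  have quad: "0 \<le> ?a - 2 * t * ?b + t\<^sup>2 * ?c" for t
  proof -
    have "0 \<le> (\<integral>x. (cmod (\<phi> x) - t * cmod (\<psi> x))\<^sup>2 \<partial>M)" by simp
    also have "\<dots> = (\<integral>x. (cmod (\<phi> x))\<^sup>2 - 2 * t * (cmod (\<phi> x) * cmod (\<psi> x)) + t\<^sup>2 * (cmod (\<psi> x))\<^sup>2 \<partial>M)"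
      by (simp add: power2_diff power_mult_distrib algebra_simps)
    also have "\<dots> = ?a - 2 * t * ?b + t\<^sup>2 * ?c"
      using int by (simp add: l2_norm_sq)
    finally show ?thesis .
  qed
  show ?thesis
  proof (cases "l2_norm M \<psi> = 0")
    case True
    have "?b = (\<integral>x. 0 \<partial>M)"
      using l2_norm_eq_0[OF assms(2) True] int(3)
      by (intro integral_cong_AE) (auto elim: eventually_mono)
    then show ?thesis using True by simp
  next
    case False
    then have c: "0 < ?c" by simp
    have "?b\<^sup>2 \<le> (l2_norm M \<phi> * l2_norm M \<psi>)\<^sup>2"
      using quadratic_discriminant_le[OF c quad] by (simp add: power_mult_distrib)
    then show ?thesis
      by (rule power2_le_imp_le) (simp add: l2_norm_nonneg)
  qed
qed

lemma l2_Cauchy_Schwarz: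
  assumes "\<phi> \<in> sq_int M" "\<psi> \<in> sq_int M"
  shows "cmod (l2_inner M \<phi> \<psi>) \<le> l2_norm M \<phi> * l2_norm M \<psi>"
proof -
  have "cmod (l2_inner M \<phi> \<psi>) \<le> (\<integral>x. cmod (\<phi> x * cnj (\<psi> x)) \<partial>M)"
    unfolding l2_inner_def by (rule integral_norm_bound)
  also have "\<dots> = (\<integral>x. cmod (\<phi> x) * cmod (\<psi> x) \<partial>M)" by (simp add: norm_mult)
  also have "\<dots> \<le> l2_norm M \<phi> * l2_norm M \<psi>" by (rule l2_Cauchy_Schwarz_cmod[OF assms])
  finally show ?thesis .
qed

lemma l2_norm_add_le:
  assumes "\<phi> \<in> sq_int M" "\<psi> \<in> sq_int M"
  shows "l2_norm M (\<lambda>x. \<phi> x + \<psi> x) \<le> l2_norm M \<phi> + l2_norm M \<psi>"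
proof (rule power2_le_imp_le)
  note int = sq_intD(2)[OF assms(1)] sq_intD(2)[OF assms(2)] l2_product_integrable[OF assms]
  have "(l2_norm M (\<lambda>x. \<phi> x + \<psi> x))\<^sup>2 \<le> (\<integral>x. (cmod (\<phi> x))\<^sup>2 + 2 * (cmod (\<phi> x) * cmod (\<psi> x)) + (cmod (\<psi> x))\<^sup>2 \<partial>M)"
    unfolding l2_norm_sq
  proof (rule integral_mono)
    show "integrable M (\<lambda>x. (cmod (\<phi> x + \<psi> x))\<^sup>2)"
      using sq_int_add[OF assms] by (rule sq_intD)
    show "integrable M (\<lambda>x. (cmod (\<phi> x))\<^sup>2 + 2 * (cmod (\<phi> x) * cmod (\<psi> x)) + (cmod (\<psi> x))\<^sup>2)"
      using int by auto
    fix x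
    have "(cmod (\<phi> x + \<psi> x))\<^sup>2 \<le> (cmod (\<phi> x) + cmod (\<psi> x))\<^sup>2"
      by (intro power_mono norm_triangle_ineq) auto
    then show "(cmod (\<phi> x + \<psi> x))\<^sup>2 \<le> (cmod (\<phi> x))\<^sup>2 + 2 * (cmod (\<phi> x) * cmod (\<psi> x)) + (cmod (\<psi> x))\<^sup>2"
      by (simp add: power2_sum)
  qed
  also have "\<dots> = (l2_norm M \<phi>)\<^sup>2 + 2 * (\<integral>x. cmod (\<phi> x) * cmod (\<psi> x) \<partial>M) + (l2_norm M \<psi>)\<^sup>2"
    using int by (simp add: l2_norm_sq)
  also have "\<dots> \<le> (l2_norm M \<phi>)\<^sup>2 + 2 * (l2_norm M \<phi> * l2_norm M \<psi>) + (l2_norm M \<psi>)\<^sup>2"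
    using l2_Cauchy_Schwarz_cmod[OF assms] by simp
  finally show "(l2_norm M (\<lambda>x. \<phi> x + \<psi> x))\<^sup>2 \<le> (l2_norm M \<phi> + l2_norm M \<psi>)\<^sup>2"
    by (simp add: power2_sum)
qed (simp add: l2_norm_nonneg)

lemma l2_norm_diff_triangle:
  assumes "\<phi> \<in> sq_int M" "\<eta> \<in> sq_int M" "\<psi> \<in> sq_int M"
  shows "l2_norm M (\<lambda>x. \<phi> x - \<psi> x) \<le> l2_norm M (\<lambda>x. \<phi> x - \<eta> x) + l2_norm M (\<lambda>x. \<eta> x - \<psi> x)"
  using l2_norm_add_le[OF sq_int_diff[OF assms(1,2)] sq_int_diff[OF assms(2,3)]] by simp

lemma l2_norm_le_diff:
  assumes "\<phi> \<in> sq_int M" "\<psi> \<in> sq_int M"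
  shows "l2_norm M \<phi> \<le> l2_norm M (\<lambda>x. \<phi> x - \<psi> x) + l2_norm M \<psi>"
  using l2_norm_add_le[OF sq_int_diff[OF assms] assms(2)] by simp

lemma l2_norm_sum_le:
  "(\<And>i. i \<in> I \<Longrightarrow> \<psi> i \<in> sq_int M) \<Longrightarrow> l2_norm M (\<lambda>x. \<Sum>i\<in>I. \<psi> i x) \<le> (\<Sum>i\<in>I. l2_norm M (\<psi> i))"
proof (induction I rule: infinite_finite_induct)
  case (insert i I)
  have "l2_norm M (\<lambda>x. \<psi> i x + (\<Sum>i\<in>I. \<psi> i x)) \<le> l2_norm M (\<psi> i) + l2_norm M (\<lambda>x. \<Sum>i\<in>I. \<psi> i x)"
    using insert.prems by (intro l2_norm_add_le sq_int_sum) auto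
  also have "\<dots> \<le> l2_norm M (\<psi> i) + (\<Sum>i\<in>I. l2_norm M (\<psi> i))"
    using insert by (intro add_left_mono insert.IH) auto
  finally show ?case using insert.hyps by simp
qed (auto simp: l2_norm_def)

lemma l2_inner_self: "l2_inner M \<psi> \<psi> = complex_of_real ((l2_norm M \<psi>)\<^sup>2)"
proof -
  have "l2_inner M \<psi> \<psi> = (\<integral>x. complex_of_real ((cmod (\<psi> x))\<^sup>2) \<partial>M)"
    unfolding l2_inner_def by (intro Bochner_Integration.integral_cong refl) (simp add: complex_norm_square[symmetric])
  also have "\<dots> = complex_of_real ((l2_norm M \<psi>)\<^sup>2)"
    unfolding l2_norm_sq by (rule integral_complex_of_real)
  finally show ?thesis .
qed

lemma l2_inner_commute: "l2_inner M \<psi> \<phi> = cnj (l2_inner M \<phi> \<psi>)"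
  unfolding l2_inner_def by (subst Bochner_Integration.integral_cnj[symmetric]) (simp add: mult.commute)

lemma l2_inner_diff_left:
  assumes "\<phi> \<in> sq_int M" "\<phi>' \<in> sq_int M" "\<psi> \<in> sq_int M"
  shows "l2_inner M (\<lambda>x. \<phi> x - \<phi>' x) \<psi> = l2_inner M \<phi> \<psi> - l2_inner M \<phi>' \<psi>"
  unfolding l2_inner_def using l2_inner_integrable[OF assms(1,3)] l2_inner_integrable[OF assms(2,3)]
  by (simp add: left_diff_distrib)

lemma l2_inner_diff_right:
  assumes "\<phi> \<in> sq_int M" "\<psi> \<in> sq_int M" "\<psi>' \<in> sq_int M"
  shows "l2_inner M \<phi> (\<lambda>x. \<psi> x - \<psi>' x) = l2_inner M \<phi> \<psi> - l2_inner M \<phi> \<psi>'"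
  unfolding l2_inner_def using l2_inner_integrable[OF assms(1,2)] l2_inner_integrable[OF assms(1,3)]
  by (simp add: right_diff_distrib)

lemma l2_inner_scale_left: "l2_inner M (\<lambda>x. c * \<phi> x) \<psi> = c * l2_inner M \<phi> \<psi>"
  unfolding l2_inner_def by (simp add: mult.assoc)

lemma l2_inner_scale_right: "l2_inner M \<phi> (\<lambda>x. c * \<psi> x) = cnj c * l2_inner M \<phi> \<psi>"
  unfolding l2_inner_def by (simp add: mult.left_commute)

lemma l2_inner_sum_left:
  assumes "\<And>i. i \<in> I \<Longrightarrow> \<phi> i \<in> sq_int M" "\<psi> \<in> sq_int M"
  shows "l2_inner M (\<lambda>x. \<Sum>i\<in>I. \<phi> i x) \<psi> = (\<Sum>i\<in>I. l2_inner M (\<phi> i) \<psi>)"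
  unfolding l2_inner_def sum_distrib_right
  using assms by (intro Bochner_Integration.integral_sum l2_inner_integrable) auto

lemma l2_inner_sum_right:
  assumes "\<And>i. i \<in> I \<Longrightarrow> \<psi> i \<in> sq_int M" "\<phi> \<in> sq_int M"
  shows "l2_inner M \<phi> (\<lambda>x. \<Sum>i\<in>I. \<psi> i x) = (\<Sum>i\<in>I. l2_inner M \<phi> (\<psi> i))"
  unfolding l2_inner_def cnj_sum sum_distrib_left
  using assms by (intro Bochner_Integration.integral_sum l2_inner_integrable) auto

lemma l2_inner_cong_right:
  assumes "\<phi> \<in> sq_int M" "\<psi> \<in> sq_int M" "\<psi>' \<in> sq_int M" "AE x in M. \<psi> x = \<psi>' x"
  shows "l2_inner M \<phi> \<psi> = l2_inner M \<phi> \<psi>'"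
  unfolding l2_inner_def
  using l2_inner_integrable[OF assms(1,2)] l2_inner_integrable[OF assms(1,3)] assms(4)
  by (intro integral_cong_AE) (auto elim: eventually_mono)

text \<open>
  A sequence with geometrically decreasing \<open>L\<^sup>2\<close> steps has almost everywhere absolutely summable
  increments, because \<open>L\<^sup>2\<close> embeds in \<open>L\<^sup>1\<close> over a finite measure; Fatou's lemma shows that the
  pointwise limit is also the \<open>L\<^sup>2\<close> limit.
\<close>

lemma (in finite_measure) l2_complete:
  assumes g: "\<And>n. g n \<in> sq_int M"
    and step: "\<And>n. l2_norm M (\<lambda>x. g (Suc n) x - g n x) \<le> (1 / 2) ^ n"
  obtains h where "h \<in> sq_int M" "\<And>n. l2_norm M (\<lambda>x. h x - g n x) \<le> 2 * (1 / 2) ^ n"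
proof -
  have gm [measurable]: "g n \<in> borel_measurable M" for n using g by (rule sq_intD)
  define d where "d n x = g (Suc n) x - g n x" for n x
  have d: "d n \<in> sq_int M" for n unfolding d_def by (intro sq_int_diff g)
  have dm [measurable]: "d n \<in> borel_measurable M" for n using d by (rule sq_intD)
  have one: "(\<lambda>_. 1) \<in> sq_int M" by (rule sq_intI) auto
  define c where "c = l2_norm M (\<lambda>_. 1)"
  have c: "0 \<le> c" by (simp add: c_def l2_norm_nonneg)
  have L1: "(\<integral>\<^sup>+x. ennreal (cmod (d n x)) \<partial>M) \<le> ennreal ((1 / 2) ^ n * c)" for n
  proof -
    have int: "integrable M (\<lambda>x. cmod (d n x))"
      using l2_product_integrable[OF d one] by simp
    have "(\<integral>x. cmod (d n x) \<partial>M) \<le> l2_norm M (d n) * c"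
      using l2_Cauchy_Schwarz_cmod[OF d one, of n] by (simp add: c_def)
    also have "\<dots> \<le> (1 / 2) ^ n * c"
      using step[of n] c unfolding d_def by (intro mult_right_mono)
    finally show ?thesis
      using int by (subst nn_integral_eq_integral) (auto intro: ennreal_leI)
  qed
  have "(\<integral>\<^sup>+x. (\<Sum>n. ennreal (cmod (d n x))) \<partial>M) = (\<Sum>n. \<integral>\<^sup>+x. ennreal (cmod (d n x)) \<partial>M)"
    by (rule nn_integral_suminf) measurable
  also have "\<dots> \<le> (\<Sum>n. ennreal ((1 / 2) ^ n * c))"
    by (intro suminf_le L1) auto
  also have "\<dots> = ennreal (\<Sum>n. (1 / 2) ^ n * c)"
    using c by (intro suminf_ennreal2 summable_mult2 summable_geometric) auto
  also have "\<dots> < \<infinity>" by simp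
  finally have "(\<integral>\<^sup>+x. (\<Sum>n. ennreal (cmod (d n x))) \<partial>M) \<noteq> \<infinity>" by simp
  then have "AE x in M. (\<Sum>n. ennreal (cmod (d n x))) \<noteq> \<infinity>"
    by (intro nn_integral_PInf_AE) measurable
  then have conv: "AE x in M. (\<lambda>n. g n x) \<longlonglongrightarrow> lim (\<lambda>n. g n x)"
  proof eventually_elim
    case (elim x)
    then have "summable (\<lambda>n. cmod (d n x))"
      by (intro summable_suminf_not_top) auto
    then have "summable (\<lambda>n. d n x)" by (rule summable_norm_cancel)
    then have "convergent (\<lambda>n. \<Sum>k<n. d k x)" by (simp add: summable_iff_convergent)
    then have "convergent (\<lambda>n. g 0 x + (\<Sum>k<n. d k x))" by (intro convergent_add convergent_const)
    also have "(\<lambda>n. g 0 x + (\<Sum>k<n. d k x)) = (\<lambda>n. g n x)"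
      unfolding d_def by (subst sum_lessThan_telescope) simp
    finally show ?case by (simp add: convergent_LIMSEQ_iff)
  qed
  define h where "h x = lim (\<lambda>n. g n x)" for x
  have hm [measurable]: "h \<in> borel_measurable M"
    unfolding h_def[abs_def] by (rule borel_measurable_lim_metric) measurable
  have tail: "l2_norm M (\<lambda>x. g (n + k) x - g n x) \<le> 2 * (1 / 2) ^ n - 2 * (1 / 2) ^ (n + k)" for n k
  proof (induction k)
    case (Suc k)
    have "l2_norm M (\<lambda>x. g (n + Suc k) x - g n x)
        \<le> l2_norm M (\<lambda>x. g (Suc (n + k)) x - g (n + k) x) + l2_norm M (\<lambda>x. g (n + k) x - g n x)"
      using l2_norm_diff_triangle[OF g g g, of "Suc (n + k)" n "n + k"] by simp
    also have "\<dots> \<le> (1 / 2) ^ (n + k) + (2 * (1 / 2) ^ n - 2 * (1 / 2) ^ (n + k))"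
      by (intro add_mono step Suc.IH)
    finally show ?case by simp
  qed (simp add: l2_norm_def)
  have nn: "(\<integral>\<^sup>+x. ennreal ((cmod (h x - g n x))\<^sup>2) \<partial>M) \<le> ennreal ((2 * (1 / 2) ^ n)\<^sup>2)" for n
  proof -
    have "AE x in M. ennreal ((cmod (h x - g n x))\<^sup>2) = liminf (\<lambda>m. ennreal ((cmod (g m x - g n x))\<^sup>2))"
      using conv
    proof eventually_elim
      case (elim x)
      then have "(\<lambda>m. ennreal ((cmod (g m x - g n x))\<^sup>2)) \<longlonglongrightarrow> ennreal ((cmod (h x - g n x))\<^sup>2)"
        unfolding h_def by (intro tendsto_ennrealI tendsto_intros)
      then show ?case by (intro lim_imp_Liminf[symmetric]) auto
    qed
    then have "(\<integral>\<^sup>+x. ennreal ((cmod (h x - g n x))\<^sup>2) \<partial>M)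
        = (\<integral>\<^sup>+x. liminf (\<lambda>m. ennreal ((cmod (g m x - g n x))\<^sup>2)) \<partial>M)"
      by (rule nn_integral_cong_AE)
    also have "\<dots> \<le> liminf (\<lambda>m. \<integral>\<^sup>+x. ennreal ((cmod (g m x - g n x))\<^sup>2) \<partial>M)"
      by (rule nn_integral_liminf) measurable
    also have "\<dots> \<le> ennreal ((2 * (1 / 2) ^ n)\<^sup>2)"
    proof (rule Liminf_le)
      show "\<forall>\<^sub>F m in sequentially. (\<integral>\<^sup>+x. ennreal ((cmod (g m x - g n x))\<^sup>2) \<partial>M) \<le> ennreal ((2 * (1 / 2) ^ n)\<^sup>2)"
        using eventually_ge_at_top[of n]
      proof eventually_elim
        case (elim m)
        then obtain k where k: "m = n + k" using le_Suc_ex by blast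
        have "l2_norm M (\<lambda>x. g m x - g n x) \<le> 2 * (1 / 2) ^ n"
          unfolding k by (rule order_trans[OF tail]) simp
        then have "(l2_norm M (\<lambda>x. g m x - g n x))\<^sup>2 \<le> (2 * (1 / 2) ^ n)\<^sup>2"
          by (intro power_mono l2_norm_nonneg)
        then show ?case
          using sq_intD(2)[OF sq_int_diff[OF g g]]
          by (subst nn_integral_eq_integral) (auto simp: l2_norm_sq intro!: ennreal_leI)
      qed
    qed simp
    finally show ?thesis .
  qed
  have diff: "(\<lambda>x. h x - g n x) \<in> sq_int M" for n
  proof (rule sq_intI)
    have "(\<integral>\<^sup>+x. ennreal (norm ((cmod (h x - g n x))\<^sup>2)) \<partial>M) < \<infinity>"
      using nn[of n] by (simp add: le_less_trans)
    then show "integrable M (\<lambda>x. (cmod (h x - g n x))\<^sup>2)"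
      by (intro integrableI_bounded) measurable
  qed measurable
  have "h \<in> sq_int M"
    using sq_int_add[OF diff[of 0] g[of 0]] by simp
  moreover have "l2_norm M (\<lambda>x. h x - g n x) \<le> 2 * (1 / 2) ^ n" for n
  proof (rule power2_le_imp_le)
    show "(l2_norm M (\<lambda>x. h x - g n x))\<^sup>2 \<le> (2 * (1 / 2) ^ n)\<^sup>2"
      using nn[of n] sq_intD(2)[OF diff]
      by (subst (asm) nn_integral_eq_integral) (auto simp: l2_norm_sq)
  qed simp
  ultimately show ?thesis by (rule that)
qed

section \<open>Noncommutative polynomials\<close>

text \<open>The adjoint of a word: the reversed word of adjoint letters.\<close>

definition word_adj :: "'i star_word \<Rightarrow> 'i star_word" where
  "word_adj w = rev (map (\<lambda>(i, b). (i, \<not> b)) w)"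

lemma word_adj_adj [simp]: "word_adj (word_adj w) = w"
  by (simp add: word_adj_def rev_map comp_def case_prod_beta)

lemma letters_word_adj [simp]: "fst ` set (word_adj w) = fst ` set w"
  by (force simp: word_adj_def)

lemma fs_adj_eq: "fs_adj f = (\<lambda>w. cnj (f (word_adj w)))"
  by (simp add: fs_adj_def word_adj_def)

lemma supp_fs_adj: "{w. fs_adj f w \<noteq> 0} = word_adj ` {w. f w \<noteq> 0}"
proof (intro equalityI subsetI)
  fix w assume "w \<in> {w. fs_adj f w \<noteq> 0}"
  then show "w \<in> word_adj ` {w. f w \<noteq> 0}"
    by (intro image_eqI[of _ _ "word_adj w"]) (auto simp: fs_adj_eq)
qed (auto simp: fs_adj_eq)

lemma fs_mult_nonzeroE:
  assumes "fs_mult f g w \<noteq> 0"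
  obtains u v where "w = u @ v" "f u \<noteq> 0" "g v \<noteq> 0"
proof -
  from assms obtain k where "f (take k w) * g (drop k w) \<noteq> 0"
    unfolding fs_mult_def by (meson sum.not_neutral_contains_not_neutral)
  then show ?thesis by (intro that[of "take k w" "drop k w"]) auto
qed

lemma free_star_finite: "f \<in> free_star I \<Longrightarrow> finite {w. f w \<noteq> 0}"
  by (simp add: free_star_def)

lemma free_star_letters: "f \<in> free_star I \<Longrightarrow> f w \<noteq> 0 \<Longrightarrow> fst ` set w \<subseteq> I"
  by (simp add: free_star_def)

lemma free_star_word: "fst ` set w \<subseteq> I \<Longrightarrow> fs_word w \<in> free_star I"
  by (auto simp: free_star_def fs_word_def)

lemma free_star_add:
  assumes "f \<in> free_star I" "g \<in> free_star I"
  shows "(\<lambda>w. f w + g w) \<in> free_star I"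
proof -
  have "{w. f w + g w \<noteq> 0} \<subseteq> {w. f w \<noteq> 0} \<union> {w. g w \<noteq> 0}" by auto
  moreover have "fst ` set w \<subseteq> I" if "f w + g w \<noteq> 0" for w
    using that free_star_letters[OF assms(1), of w] free_star_letters[OF assms(2), of w] by fastforce
  ultimately show ?thesis
    using assms unfolding free_star_def by (blast intro: finite_subset)
qed

lemma free_star_scale:
  assumes "f \<in> free_star I"
  shows "(\<lambda>w. c * f w) \<in> free_star I"
proof -
  have "{w. c * f w \<noteq> 0} \<subseteq> {w. f w \<noteq> 0}" by auto
  then show ?thesis
    using assms unfolding free_star_def by (auto intro: finite_subset)
qed

lemma free_star_diff:
  "f \<in> free_star I \<Longrightarrow> g \<in> free_star I \<Longrightarrow> (\<lambda>w. f w - g w) \<in> free_star I"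
  using free_star_add[of f I "\<lambda>w. -1 * g w"] free_star_scale[of g I "-1"] by simp

lemma free_star_sum:
  "(\<And>i. i \<in> J \<Longrightarrow> f i \<in> free_star I) \<Longrightarrow> (\<lambda>w. \<Sum>i\<in>J. f i w) \<in> free_star I"
proof (induction J rule: infinite_finite_induct)
  case (insert j J)
  then show ?case by (simp add: free_star_add)
qed (auto simp: free_star_def)

lemma free_star_mult:
  assumes "f \<in> free_star I" "g \<in> free_star I"
  shows "fs_mult f g \<in> free_star I"
proof -
  have "{w. fs_mult f g w \<noteq> 0} \<subseteq> (\<lambda>(u, v). u @ v) ` ({w. f w \<noteq> 0} \<times> {w. g w \<noteq> 0})"
    by (auto elim!: fs_mult_nonzeroE)
  then have "finite {w. fs_mult f g w \<noteq> 0}"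
    by (rule finite_subset) (simp add: free_star_finite[OF assms(1)] free_star_finite[OF assms(2)])
  moreover have "fst ` set w \<subseteq> I" if nz: "fs_mult f g w \<noteq> 0" for w
  proof -
    obtain u v where uv: "w = u @ v" "f u \<noteq> 0" "g v \<noteq> 0" using nz by (rule fs_mult_nonzeroE)
    show ?thesis
      using free_star_letters[OF assms(1) uv(2)] free_star_letters[OF assms(2) uv(3)] uv(1)
      by (simp add: image_Un)
  qed
  ultimately show ?thesis by (simp add: free_star_def)
qed

lemma free_star_adj:
  assumes "f \<in> free_star I"
  shows "fs_adj f \<in> free_star I"
proof -
  have "finite {w. fs_adj f w \<noteq> 0}"
    unfolding supp_fs_adj using free_star_finite[OF assms] by simp
  moreover have "fst ` set w \<subseteq> I" if "fs_adj f w \<noteq> 0" for w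
    using that free_star_letters[OF assms, of "word_adj w"] by (simp add: fs_adj_eq)
  ultimately show ?thesis by (simp add: free_star_def)
qed

lemma fs_adj_adj [simp]: "fs_adj (fs_adj f) = f"
  by (simp add: fs_adj_eq)

text \<open>The linear extension to finitely supported functions of a map \<open>X\<close> on words.\<close>

definition lin_ext :: "(complex \<Rightarrow> 'v \<Rightarrow> 'v) \<Rightarrow> ('i star_word \<Rightarrow> 'v) \<Rightarrow> ('i star_word \<Rightarrow> complex) \<Rightarrow> 'v::ab_group_add" where
  "lin_ext sc X f = (\<Sum>w | f w \<noteq> 0. sc (f w) (X w))"

text \<open>
  The target of the evaluation maps: a complex vector space, which below is the algebra with scalar
  multiplication \<open>cscale\<close> or the complex numbers (for the values of operators at a vector and a point).
\<close>

locale complex_module = module sc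
  for sc :: "complex \<Rightarrow> 'v::ab_group_add \<Rightarrow> 'v"
begin

lemma lin_ext_superset:
  assumes "finite S" "{w. f w \<noteq> 0} \<subseteq> S"
  shows "lin_ext sc X f = (\<Sum>w\<in>S. sc (f w) (X w))"
  unfolding lin_ext_def using assms by (intro sum.mono_neutral_left) auto

lemma lin_ext_word: "lin_ext sc X (fs_word w) = X w"
  by (subst lin_ext_superset[of "{w}"]) (auto simp: fs_word_def)

lemma lin_ext_add:
  assumes "f \<in> free_star I" "g \<in> free_star I"
  shows "lin_ext sc X (\<lambda>w. f w + g w) = lin_ext sc X f + lin_ext sc X g"
proof -
  let ?S = "{w. f w \<noteq> 0} \<union> {w. g w \<noteq> 0}"
  have S: "finite ?S" using assms by (simp add: free_star_finite)
  have "lin_ext sc X (\<lambda>w. f w + g w) = (\<Sum>w\<in>?S. sc (f w + g w) (X w))"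
    using S by (intro lin_ext_superset) auto
  also have "\<dots> = (\<Sum>w\<in>?S. sc (f w) (X w)) + (\<Sum>w\<in>?S. sc (g w) (X w))"
    by (simp add: scale_left_distrib sum.distrib)
  also have "\<dots> = lin_ext sc X f + lin_ext sc X g"
    using S by (intro arg_cong2[where f = "(+)"] lin_ext_superset[symmetric]) auto
  finally show ?thesis .
qed

lemma lin_ext_scale:
  assumes "f \<in> free_star I"
  shows "lin_ext sc X (\<lambda>w. c * f w) = sc c (lin_ext sc X f)"
proof -
  have "lin_ext sc X (\<lambda>w. c * f w) = (\<Sum>w | f w \<noteq> 0. sc (c * f w) (X w))"
    using free_star_finite[OF assms] by (intro lin_ext_superset) auto
  also have "\<dots> = sc c (lin_ext sc X f)"
    by (simp add: lin_ext_def scale_sum_right)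
  finally show ?thesis .
qed

lemma lin_ext_diff:
  assumes "f \<in> free_star I" "g \<in> free_star I"
  shows "lin_ext sc X (\<lambda>w. f w - g w) = lin_ext sc X f - lin_ext sc X g"
  using lin_ext_add[OF assms(1) free_star_scale[OF assms(2), of "-1"], of X] lin_ext_scale[OF assms(2), of X "-1"]
  by simp

lemma lin_ext_sum:
  assumes "\<And>i. i \<in> J \<Longrightarrow> f i \<in> free_star I"
  shows "lin_ext sc X (\<lambda>w. \<Sum>i\<in>J. f i w) = (\<Sum>i\<in>J. lin_ext sc X (f i))"
  using assms
proof (induction J rule: infinite_finite_induct)
  case (insert j J)
  have "lin_ext sc X (\<lambda>w. f j w + (\<Sum>i\<in>J. f i w)) = lin_ext sc X (f j) + lin_ext sc X (\<lambda>w. \<Sum>i\<in>J. f i w)"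
    using insert.prems by (intro lin_ext_add[of _ I] free_star_sum) auto
  then show ?case using insert by simp
qed (auto simp: lin_ext_def)

text \<open>The linear extension of the product, a convolution over concatenations of words.\<close>

lemma lin_ext_mult:
  assumes "f \<in> free_star I" "g \<in> free_star I"
  shows "lin_ext sc X (fs_mult f g) = (\<Sum>u | f u \<noteq> 0. \<Sum>v | g v \<noteq> 0. sc (f u * g v) (X (u @ v)))"
proof -
  let ?F = "{w. f w \<noteq> 0}" and ?G = "{w. g w \<noteq> 0}"
  define S where "S = (\<lambda>(u, v). u @ v) ` (?F \<times> ?G)"
  have fin: "finite ?F" "finite ?G" "finite S"
    using free_star_finite[OF assms(1)] free_star_finite[OF assms(2)] by (auto simp: S_def)
  have "lin_ext sc X (fs_mult f g) = (\<Sum>w\<in>S. sc (fs_mult f g w) (X w))"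
    using fin by (intro lin_ext_superset) (auto simp: S_def elim!: fs_mult_nonzeroE)
  also have "\<dots> = (\<Sum>w\<in>S. \<Sum>k\<le>length w. sc (f (take k w) * g (drop k w)) (X w))"
    by (simp add: fs_mult_def scale_sum_left)
  also have "\<dots> = (\<Sum>(w, k)\<in>(SIGMA w:S. {..length w}). sc (f (take k w) * g (drop k w)) (X w))"
    using fin by (intro sum.Sigma) auto
  \<comment> \<open>A word together with a cutting position is the same as a pair of words.\<close>
  also have "\<dots> = (\<Sum>(u, v)\<in>?F \<times> ?G. sc (f u * g v) (X (u @ v)))"
  proof (rule sum.reindex_bij_witness_not_neutral[
        where i = "\<lambda>(u, v). (u @ v, length u)" and j = "\<lambda>(w, k). (take k w, drop k w)"
        and S' = "{wk \<in> (SIGMA w:S. {..length w}). f (take (snd wk) (fst wk)) * g (drop (snd wk) (fst wk)) = 0}"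
        and T' = "{}"])
    show "finite {wk \<in> (SIGMA w:S. {..length w}). f (take (snd wk) (fst wk)) * g (drop (snd wk) (fst wk)) = 0}"
      by (rule finite_subset[of _ "SIGMA w:S. {..length w}"]) (use fin in auto)
    fix uv assume "uv \<in> ?F \<times> ?G - {}"
    then obtain u v where uv: "uv = (u, v)" "f u \<noteq> 0" "g v \<noteq> 0" by auto
    then have "u @ v \<in> S" unfolding S_def by force
    with uv show "(case uv of (u, v) \<Rightarrow> (u @ v, length u)) \<in> (SIGMA w:S. {..length w})
        - {wk \<in> (SIGMA w:S. {..length w}). f (take (snd wk) (fst wk)) * g (drop (snd wk) (fst wk)) = 0}"
      by simp
  qed auto
  also have "\<dots> = (\<Sum>u | f u \<noteq> 0. \<Sum>v | g v \<noteq> 0. sc (f u * g v) (X (u @ v)))"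
    by (rule sum.cartesian_product[symmetric])
  finally show ?thesis .
qed

lemma lin_ext_adj: "lin_ext sc X (fs_adj f) = (\<Sum>w | f w \<noteq> 0. sc (cnj (f w)) (X (word_adj w)))"
proof -
  have "inj_on word_adj A" for A :: "'i star_word set"
    by (metis inj_on_inverseI word_adj_adj)
  then show ?thesis
    unfolding lin_ext_def supp_fs_adj by (subst sum.reindex) (auto simp: fs_adj_eq)
qed

end

lemma complex_module_mult: "complex_module ((*) :: complex \<Rightarrow> complex \<Rightarrow> complex)"
  by unfold_locales (auto simp: algebra_simps)

section \<open>Evaluation of polynomials in a C*-algebra\<close>

context unital_cstar_algebra
begin

sublocale complex_module cscale
proof
  show "cscale 1 a = a" for a using cscale_of_real[of 1 a] by simp
qed (auto simp: cscale_add_right cscale_add_left cscale_cscale)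

lemma adj_zero: "adj 0 = 0"
  using adj_add[of 0 0] by simp

lemma adj_one: "adj 1 = 1"
  by (metis adj_adj adj_mult mult_1_left mult_1_right)

lemma adj_sum: "adj (\<Sum>x\<in>X. a x) = (\<Sum>x\<in>X. adj (a x))"
  by (induction X rule: infinite_finite_induct) (auto simp: adj_zero adj_add)

lemma adj_diff: "adj (a - b) = adj a - adj b"
  using adj_add[of "a - b" b] by simp

lemma norm_adj: "norm (adj a) = norm a"
proof -
  have le: "norm a \<le> norm (adj a)" for a
  proof (cases "norm a = 0")
    case False
    have "norm a * norm a \<le> norm (adj a) * norm a"
      using cstar_identity[of a] norm_mult_ineq[of "adj a" a] by (simp add: power2_eq_square)
    then show ?thesis using False by simp
  qed simp
  from le[of a] le[of "adj a"] show ?thesis by (simp add: adj_adj)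
qed

text \<open>The product of generators and adjoints of generators that a word spells.\<close>

definition word_val :: "('i \<Rightarrow> 'c) \<Rightarrow> 'i star_word \<Rightarrow> 'c" where
  "word_val S w = prod_list (map (\<lambda>(i, b). if b then adj (S i) else S i) w)"

lemma word_val_append: "word_val S (u @ v) = word_val S u * word_val S v"
  by (simp add: word_val_def)

lemma word_val_adj: "adj (word_val S w) = word_val S (word_adj w)"
proof (induction w)
  case Nil
  show ?case by (simp add: word_val_def word_adj_def adj_one)
next
  case (Cons a w)
  have "word_val S (word_adj (a # w)) = word_val S (word_adj w) * word_val S (word_adj [a])"
    by (simp add: word_val_append[symmetric]) (simp add: word_adj_def)
  also have "\<dots> = adj (word_val S w) * adj (word_val S [a])"
    using Cons.IH by (cases a) (simp add: word_val_def word_adj_def adj_adj)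
  also have "\<dots> = adj (word_val S (a # w))"
    using word_val_append[of S "[a]" w] by (simp add: adj_mult)
  finally show ?case by simp
qed

lemma fs_eval_eq: "fs_eval cscale adj S f = lin_ext cscale (word_val S) f"
  by (simp add: fs_eval_def lin_ext_def word_val_def)

lemma fs_eval_add:
  "f \<in> free_star I \<Longrightarrow> g \<in> free_star I \<Longrightarrow>
    fs_eval cscale adj S (\<lambda>w. f w + g w) = fs_eval cscale adj S f + fs_eval cscale adj S g"
  unfolding fs_eval_eq by (rule lin_ext_add)

lemma fs_eval_diff:
  "f \<in> free_star I \<Longrightarrow> g \<in> free_star I \<Longrightarrow>
    fs_eval cscale adj S (\<lambda>w. f w - g w) = fs_eval cscale adj S f - fs_eval cscale adj S g"
  unfolding fs_eval_eq by (rule lin_ext_diff)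

lemma fs_eval_scale:
  "f \<in> free_star I \<Longrightarrow> fs_eval cscale adj S (\<lambda>w. c * f w) = cscale c (fs_eval cscale adj S f)"
  unfolding fs_eval_eq by (rule lin_ext_scale)

lemma fs_eval_mult:
  assumes "f \<in> free_star I" "g \<in> free_star I"
  shows "fs_eval cscale adj S (fs_mult f g) = fs_eval cscale adj S f * fs_eval cscale adj S g"
proof -
  have "fs_eval cscale adj S f * fs_eval cscale adj S g
      = (\<Sum>u | f u \<noteq> 0. \<Sum>v | g v \<noteq> 0. cscale (f u) (word_val S u) * cscale (g v) (word_val S v))"
    unfolding fs_eval_eq lin_ext_def by (rule sum_product)
  then show ?thesis
    unfolding fs_eval_eq lin_ext_mult[OF assms]
    by (simp add: cscale_mult_left cscale_mult_right cscale_cscale word_val_append mult.commute)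
qed

lemma fs_eval_adj: "fs_eval cscale adj S (fs_adj f) = adj (fs_eval cscale adj S f)"
  unfolding fs_eval_eq lin_ext_adj unfolding lin_ext_def
  by (simp add: adj_sum adj_cscale word_val_adj)

lemma fs_eval_word: "fs_eval cscale adj S (fs_word w) = word_val S w"
  unfolding fs_eval_eq by (rule lin_ext_word)

end

section \<open>Cuntz families of operators\<close>

text \<open>
  The operator norm as the infimum of all bounds. It is only meaningful for operators that have a
  bound.
\<close>

definition l2_opbounds :: "'a measure \<Rightarrow> (('a \<Rightarrow> complex) \<Rightarrow> 'a \<Rightarrow> complex) \<Rightarrow> real set" where
  "l2_opbounds M Q = {C. 0 \<le> C \<and> (\<forall>\<psi>\<in>sq_int M. l2_norm M (Q \<psi>) \<le> C * l2_norm M \<psi>)}"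

definition l2_opnorm :: "'a measure \<Rightarrow> (('a \<Rightarrow> complex) \<Rightarrow> 'a \<Rightarrow> complex) \<Rightarrow> real" where
  "l2_opnorm M Q = Inf (l2_opbounds M Q)"

lemma l2_opnorm_le:
  assumes "0 \<le> C" "\<And>\<psi>. \<psi> \<in> sq_int M \<Longrightarrow> l2_norm M (Q \<psi>) \<le> C * l2_norm M \<psi>"
  shows "l2_opnorm M Q \<le> C"
  unfolding l2_opnorm_def
  by (rule cInf_lower) (use assms in \<open>auto simp: l2_opbounds_def intro!: bdd_belowI[of _ 0]\<close>)

lemma l2_opnorm_nonneg: "l2_opbounds M Q \<noteq> {} \<Longrightarrow> 0 \<le> l2_opnorm M Q"
  unfolding l2_opnorm_def by (rule cInf_greatest) (auto simp: l2_opbounds_def)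

lemma l2_opnorm_bound:
  assumes "l2_opbounds M Q \<noteq> {}" "\<psi> \<in> sq_int M"
  shows "l2_norm M (Q \<psi>) \<le> l2_opnorm M Q * l2_norm M \<psi>"
proof (cases "l2_norm M \<psi> = 0")
  case True
  then show ?thesis using assms by (auto simp: l2_opbounds_def)
next
  case False
  then have pos: "0 < l2_norm M \<psi>" using l2_norm_nonneg[of M \<psi>] by simp
  have "l2_norm M (Q \<psi>) / l2_norm M \<psi> \<le> l2_opnorm M Q"
    unfolding l2_opnorm_def
  proof (rule cInf_greatest[OF assms(1)])
    fix C assume "C \<in> l2_opbounds M Q"
    then show "l2_norm M (Q \<psi>) / l2_norm M \<psi> \<le> C"
      using assms(2) pos by (auto simp: l2_opbounds_def divide_le_eq)
  qed
  then show ?thesis using pos by (simp add: divide_le_eq)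
qed

text \<open>
  A Cuntz family \<open>T\<close> of operators with adjoints \<open>Ts\<close> that are given by formulas which are linear
  everywhere, not only almost everywhere; so are then all noncommutative polynomials in them.
\<close>

locale cuntz_ops = finite_measure M for M :: "'a measure" +
  fixes I :: "'i set"
    and T Ts :: "'i \<Rightarrow> ('a \<Rightarrow> complex) \<Rightarrow> 'a \<Rightarrow> complex"
  assumes finite_I: "finite I"
    and T_sq_int: "i \<in> I \<Longrightarrow> \<psi> \<in> sq_int M \<Longrightarrow> T i \<psi> \<in> sq_int M"
    and Ts_sq_int: "i \<in> I \<Longrightarrow> \<psi> \<in> sq_int M \<Longrightarrow> Ts i \<psi> \<in> sq_int M"
    and T_add: "T i (\<lambda>x. \<phi> x + \<psi> x) = (\<lambda>x. T i \<phi> x + T i \<psi> x)"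
    and Ts_add: "Ts i (\<lambda>x. \<phi> x + \<psi> x) = (\<lambda>x. Ts i \<phi> x + Ts i \<psi> x)"
    and T_scale: "T i (\<lambda>x. c * \<psi> x) = (\<lambda>x. c * T i \<psi> x)"
    and Ts_scale: "Ts i (\<lambda>x. c * \<psi> x) = (\<lambda>x. c * Ts i \<psi> x)"
    and T_adjoint: "i \<in> I \<Longrightarrow> l2_adjoint M (T i) (Ts i)"
    and Ts_T: "i \<in> I \<Longrightarrow> l2_eq M (\<lambda>\<psi>. Ts i (T i \<psi>)) (\<lambda>\<psi>. \<psi>)"
    and sum_T_Ts: "l2_eq M (\<lambda>\<psi> x. \<Sum>i\<in>I. T i (Ts i \<psi>) x) (\<lambda>\<psi>. \<psi>)"
begin

lemma T_norm:
  assumes "i \<in> I" "\<psi> \<in> sq_int M"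
  shows "l2_norm M (T i \<psi>) = l2_norm M \<psi>"
proof -
  have "l2_inner M (T i \<psi>) (T i \<psi>) = l2_inner M \<psi> (Ts i (T i \<psi>))"
    using T_adjoint[OF assms(1)] assms T_sq_int by (auto simp: l2_adjoint_def)
  also have "\<dots> = l2_inner M \<psi> \<psi>"
    using Ts_T[OF assms(1)] assms T_sq_int Ts_sq_int
    by (intro l2_inner_cong_right) (auto simp: l2_eq_def)
  finally have "(l2_norm M (T i \<psi>))\<^sup>2 = (l2_norm M \<psi>)\<^sup>2"
    unfolding l2_inner_self by (simp only: of_real_eq_iff)
  then show ?thesis by (simp add: l2_norm_nonneg)
qed

lemma Ts_norm:
  assumes "i \<in> I" "\<psi> \<in> sq_int M"
  shows "l2_norm M (Ts i \<psi>) \<le> l2_norm M \<psi>"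
proof (cases "l2_norm M (Ts i \<psi>) = 0")
  case False
  have "(l2_norm M (Ts i \<psi>))\<^sup>2 = cmod (l2_inner M (Ts i \<psi>) (Ts i \<psi>))"
    by (simp add: l2_inner_self norm_power)
  also have "l2_inner M (Ts i \<psi>) (Ts i \<psi>) = l2_inner M (T i (Ts i \<psi>)) \<psi>"
    using T_adjoint[OF assms(1)] assms Ts_sq_int by (simp add: l2_adjoint_def)
  also have "cmod \<dots> \<le> l2_norm M (T i (Ts i \<psi>)) * l2_norm M \<psi>"
    using assms by (intro l2_Cauchy_Schwarz T_sq_int Ts_sq_int)
  also have "l2_norm M (T i (Ts i \<psi>)) = l2_norm M (Ts i \<psi>)"
    using assms by (intro T_norm Ts_sq_int)
  finally show ?thesis
    using False l2_norm_nonneg[of M "Ts i \<psi>"] by (simp add: power2_eq_square)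
qed (simp add: l2_norm_nonneg)

lemma Ts_adjoint: "i \<in> I \<Longrightarrow> l2_adjoint M (Ts i) (T i)"
  unfolding l2_adjoint_def
proof (intro ballI)
  fix \<phi> \<psi> assume "i \<in> I" "\<phi> \<in> sq_int M" "\<psi> \<in> sq_int M"
  then have "l2_inner M (T i \<psi>) \<phi> = l2_inner M \<psi> (Ts i \<phi>)"
    using T_adjoint by (simp add: l2_adjoint_def)
  then show "l2_inner M (Ts i \<phi>) \<psi> = l2_inner M \<phi> (T i \<psi>)"
    by (metis l2_inner_commute)
qed

text \<open>
  The operators of a letter and of a word. The second component of a letter tells whether it is an
  adjoint.
\<close>

definition letter :: "'i \<times> bool \<Rightarrow> ('a \<Rightarrow> complex) \<Rightarrow> 'a \<Rightarrow> complex" where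
  "letter l = (if snd l then Ts (fst l) else T (fst l))"

primrec word_op :: "'i star_word \<Rightarrow> ('a \<Rightarrow> complex) \<Rightarrow> 'a \<Rightarrow> complex" where
  "word_op [] \<psi> = \<psi>"
| "word_op (l # w) \<psi> = letter l (word_op w \<psi>)"

lemma word_op_append: "word_op (u @ v) \<psi> = word_op u (word_op v \<psi>)"
  by (induction u) auto

lemma word_op_add: "word_op w (\<lambda>x. \<phi> x + \<psi> x) = (\<lambda>x. word_op w \<phi> x + word_op w \<psi> x)"
  by (induction w) (auto simp: letter_def T_add Ts_add)

lemma word_op_scale: "word_op w (\<lambda>x. c * \<psi> x) = (\<lambda>x. c * word_op w \<psi> x)"
  by (induction w) (auto simp: letter_def T_scale Ts_scale)

lemma word_op_sum: "word_op w (\<lambda>x. \<Sum>j\<in>J. \<psi> j x) = (\<lambda>x. \<Sum>j\<in>J. word_op w (\<psi> j) x)"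
proof (induction J rule: infinite_finite_induct)
  case (insert j J)
  then show ?case using word_op_add[of w "\<psi> j" "\<lambda>x. \<Sum>j\<in>J. \<psi> j x"] by (simp add: fun_eq_iff)
qed (use word_op_scale[of w 0 "\<lambda>_. 0"] in auto)

lemma word_op_sq_int:
  "fst ` set w \<subseteq> I \<Longrightarrow> \<psi> \<in> sq_int M \<Longrightarrow> word_op w \<psi> \<in> sq_int M"
  by (induction w) (auto simp: letter_def T_sq_int Ts_sq_int)

lemma word_op_norm:
  "fst ` set w \<subseteq> I \<Longrightarrow> \<psi> \<in> sq_int M \<Longrightarrow> l2_norm M (word_op w \<psi>) \<le> l2_norm M \<psi>"
proof (induction w)
  case (Cons l w)
  then have "l2_norm M (letter l (word_op w \<psi>)) \<le> l2_norm M (word_op w \<psi>)"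
    using T_norm[of "fst l" "word_op w \<psi>"] Ts_norm[of "fst l" "word_op w \<psi>"] word_op_sq_int[of w \<psi>]
    by (auto simp: letter_def)
  also have "\<dots> \<le> l2_norm M \<psi>" using Cons by simp
  finally show ?case by simp
qed simp

lemma word_op_adjoint:
  "fst ` set w \<subseteq> I \<Longrightarrow> \<phi> \<in> sq_int M \<Longrightarrow> \<psi> \<in> sq_int M \<Longrightarrow>
    l2_inner M (word_op w \<phi>) \<psi> = l2_inner M \<phi> (word_op (word_adj w) \<psi>)"
proof (induction w arbitrary: \<psi>)
  case Nil
  then show ?case by (simp add: word_adj_def)
next
  case (Cons l w)
  obtain i b where l: "l = (i, b)" by (cases l)
  have i: "i \<in> I" and w: "fst ` set w \<subseteq> I" using Cons.prems(1) l by auto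
  have sq: "letter (i, \<not> b) \<psi> \<in> sq_int M"
    using i Cons.prems by (simp add: letter_def T_sq_int Ts_sq_int)
  have "l2_inner M (letter (i, b) (word_op w \<phi>)) \<psi> = l2_inner M (word_op w \<phi>) (letter (i, \<not> b) \<psi>)"
    using T_adjoint[OF i] Ts_adjoint[OF i] word_op_sq_int[OF w Cons.prems(2)] Cons.prems(3)
    by (simp add: letter_def l2_adjoint_def)
  also have "\<dots> = l2_inner M \<phi> (word_op (word_adj w) (letter (i, \<not> b) \<psi>))"
    using Cons.IH[OF w Cons.prems(2) sq] .
  also have "word_op (word_adj w) (letter (i, \<not> b) \<psi>) = word_op (word_adj (l # w)) \<psi>"
    by (simp add: l word_adj_def word_op_append)
  finally show ?case by (simp add: l)
qed

text \<open>The noncommutative polynomial \<open>f\<close> evaluated at the operators.\<close>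

definition poly_op :: "('i star_word \<Rightarrow> complex) \<Rightarrow> ('a \<Rightarrow> complex) \<Rightarrow> 'a \<Rightarrow> complex" where
  "poly_op f \<psi> = (\<lambda>x. \<Sum>w | f w \<noteq> 0. f w * word_op w \<psi> x)"

sublocale C: complex_module "(*) :: complex \<Rightarrow> complex \<Rightarrow> complex"
  by (rule complex_module_mult)

lemma poly_op_eq: "poly_op f \<psi> x = lin_ext (*) (\<lambda>w. word_op w \<psi> x) f"
  by (simp add: poly_op_def lin_ext_def)

lemma poly_op_sq_int: "f \<in> free_star I \<Longrightarrow> \<psi> \<in> sq_int M \<Longrightarrow> poly_op f \<psi> \<in> sq_int M"
  unfolding poly_op_def by (intro sq_int_sum sq_int_scale word_op_sq_int) (auto dest: free_star_letters)

lemma poly_op_add_arg: "poly_op f (\<lambda>x. \<phi> x + \<psi> x) = (\<lambda>x. poly_op f \<phi> x + poly_op f \<psi> x)"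
  by (simp add: poly_op_def word_op_add distrib_left sum.distrib)

lemma poly_op_scale_arg: "poly_op f (\<lambda>x. c * \<psi> x) = (\<lambda>x. c * poly_op f \<psi> x)"
  by (simp add: poly_op_def word_op_scale sum_distrib_left mult.left_commute)

lemma poly_op_diff_arg: "poly_op f (\<lambda>x. \<phi> x - \<psi> x) = (\<lambda>x. poly_op f \<phi> x - poly_op f \<psi> x)"
  using poly_op_add_arg[of f \<phi> "\<lambda>x. -1 * \<psi> x"] poly_op_scale_arg[of f "-1" \<psi>] by simp

lemma poly_op_add:
  "f \<in> free_star I \<Longrightarrow> g \<in> free_star I \<Longrightarrow>
    poly_op (\<lambda>w. f w + g w) \<psi> = (\<lambda>x. poly_op f \<psi> x + poly_op g \<psi> x)"
  by (rule ext) (simp add: poly_op_eq C.lin_ext_add)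

lemma poly_op_diff:
  "f \<in> free_star I \<Longrightarrow> g \<in> free_star I \<Longrightarrow>
    poly_op (\<lambda>w. f w - g w) \<psi> = (\<lambda>x. poly_op f \<psi> x - poly_op g \<psi> x)"
  by (rule ext) (simp add: poly_op_eq C.lin_ext_diff)

lemma poly_op_scale:
  "f \<in> free_star I \<Longrightarrow> poly_op (\<lambda>w. c * f w) \<psi> = (\<lambda>x. c * poly_op f \<psi> x)"
  by (rule ext) (simp add: poly_op_eq C.lin_ext_scale)

lemma poly_op_sum:
  "(\<And>j. j \<in> J \<Longrightarrow> f j \<in> free_star I) \<Longrightarrow>
    poly_op (\<lambda>w. \<Sum>j\<in>J. f j w) \<psi> = (\<lambda>x. \<Sum>j\<in>J. poly_op (f j) \<psi> x)"
  by (rule ext) (simp add: poly_op_eq C.lin_ext_sum[of _ _ I])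

lemma poly_op_word: "poly_op (fs_word w) \<psi> = word_op w \<psi>"
  by (rule ext) (simp add: poly_op_eq C.lin_ext_word)

lemma poly_op_mult:
  assumes "f \<in> free_star I" "g \<in> free_star I"
  shows "poly_op (fs_mult f g) \<psi> = poly_op f (poly_op g \<psi>)"
proof
  fix x
  have "word_op u (poly_op g \<psi>) x = (\<Sum>v | g v \<noteq> 0. g v * word_op (u @ v) \<psi> x)" for u
    unfolding poly_op_def word_op_sum word_op_scale word_op_append ..
  then show "poly_op (fs_mult f g) \<psi> x = poly_op f (poly_op g \<psi>) x"
    unfolding poly_op_eq[of "fs_mult f g"] C.lin_ext_mult[OF assms] poly_op_def[of f]
    by (simp add: sum_distrib_left mult.assoc)
qed

lemma poly_op_adjoint:
  assumes "f \<in> free_star I" "\<phi> \<in> sq_int M" "\<psi> \<in> sq_int M"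
  shows "l2_inner M (poly_op f \<phi>) \<psi> = l2_inner M \<phi> (poly_op (fs_adj f) \<psi>)"
proof -
  have letters: "fst ` set w \<subseteq> I" if "f w \<noteq> 0" for w using free_star_letters[OF assms(1) that] .
  have sq: "(\<lambda>x. c * word_op w \<eta> x) \<in> sq_int M" "(\<lambda>x. c * word_op (word_adj w) \<eta> x) \<in> sq_int M"
    if "f w \<noteq> 0" "\<eta> \<in> sq_int M" for w c \<eta>
    using letters[OF that(1)] that(2) by (simp_all add: sq_int_scale word_op_sq_int)
  have "l2_inner M (poly_op f \<phi>) \<psi> = (\<Sum>w | f w \<noteq> 0. f w * l2_inner M (word_op w \<phi>) \<psi>)"
    unfolding poly_op_def using assms
    by (subst l2_inner_sum_left) (auto intro: sq simp: l2_inner_scale_left)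
  also have "\<dots> = (\<Sum>w | f w \<noteq> 0. f w * l2_inner M \<phi> (word_op (word_adj w) \<psi>))"
    using assms letters by (intro sum.cong) (auto simp: word_op_adjoint)
  also have "\<dots> = l2_inner M \<phi> (\<lambda>x. \<Sum>w | f w \<noteq> 0. cnj (f w) * word_op (word_adj w) \<psi> x)"
    using assms
    by (subst l2_inner_sum_right) (auto intro: sq simp: l2_inner_scale_right)
  also have "(\<lambda>x. \<Sum>w | f w \<noteq> 0. cnj (f w) * word_op (word_adj w) \<psi> x) = poly_op (fs_adj f) \<psi>"
    by (rule ext) (simp add: poly_op_eq C.lin_ext_adj)
  finally show ?thesis .
qed

lemma poly_op_opbounds: "f \<in> free_star I \<Longrightarrow> l2_opbounds M (poly_op f) \<noteq> {}"
proof -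
  assume f: "f \<in> free_star I"
  let ?C = "\<Sum>w | f w \<noteq> 0. cmod (f w)"
  have "l2_norm M (poly_op f \<psi>) \<le> ?C * l2_norm M \<psi>" if \<psi>: "\<psi> \<in> sq_int M" for \<psi>
  proof -
    have "l2_norm M (poly_op f \<psi>) \<le> (\<Sum>w | f w \<noteq> 0. l2_norm M (\<lambda>x. f w * word_op w \<psi> x))"
      unfolding poly_op_def using \<psi> free_star_letters[OF f]
      by (intro l2_norm_sum_le sq_int_scale word_op_sq_int) auto
    also have "\<dots> \<le> (\<Sum>w | f w \<noteq> 0. cmod (f w) * l2_norm M \<psi>)"
      using \<psi> free_star_letters[OF f]
      by (intro sum_mono) (auto simp: l2_norm_scale intro!: mult_left_mono word_op_norm)
    finally show ?thesis by (simp add: sum_distrib_right)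
  qed
  then have "?C \<in> l2_opbounds M (poly_op f)"
    by (auto simp: l2_opbounds_def intro: sum_nonneg)
  then show ?thesis by blast
qed

text \<open>The operator norm of a polynomial in the operators.\<close>

definition poly_norm :: "('i star_word \<Rightarrow> complex) \<Rightarrow> real" where
  "poly_norm f = l2_opnorm M (poly_op f)"

lemma poly_norm_bound: "f \<in> free_star I \<Longrightarrow> \<psi> \<in> sq_int M \<Longrightarrow> l2_norm M (poly_op f \<psi>) \<le> poly_norm f * l2_norm M \<psi>"
  unfolding poly_norm_def by (intro l2_opnorm_bound poly_op_opbounds)

lemma poly_norm_nonneg: "f \<in> free_star I \<Longrightarrow> 0 \<le> poly_norm f"
  unfolding poly_norm_def by (intro l2_opnorm_nonneg poly_op_opbounds)

lemma poly_norm_le: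
  "0 \<le> C \<Longrightarrow> (\<And>\<psi>. \<psi> \<in> sq_int M \<Longrightarrow> l2_norm M (poly_op f \<psi>) \<le> C * l2_norm M \<psi>) \<Longrightarrow> poly_norm f \<le> C"
  unfolding poly_norm_def by (rule l2_opnorm_le)

lemma poly_norm_eq_0:
  assumes "f \<in> free_star I" "\<And>\<psi>. \<psi> \<in> sq_int M \<Longrightarrow> AE x in M. poly_op f \<psi> x = 0"
  shows "poly_norm f = 0"
proof (rule antisym[OF poly_norm_le poly_norm_nonneg[OF assms(1)]])
  fix \<psi> assume "\<psi> \<in> sq_int M"
  then have "l2_norm M (poly_op f \<psi>) = 0"
    using assms by (intro l2_norm_AE_0 sq_intD(1)[OF poly_op_sq_int]) auto
  then show "l2_norm M (poly_op f \<psi>) \<le> 0 * l2_norm M \<psi>" by simp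
qed simp

lemma poly_norm_add:
  assumes "f \<in> free_star I" "g \<in> free_star I"
  shows "poly_norm (\<lambda>w. f w + g w) \<le> poly_norm f + poly_norm g"
proof (rule poly_norm_le)
  fix \<psi> assume \<psi>: "\<psi> \<in> sq_int M"
  have "l2_norm M (poly_op (\<lambda>w. f w + g w) \<psi>) \<le> l2_norm M (poly_op f \<psi>) + l2_norm M (poly_op g \<psi>)"
    unfolding poly_op_add[OF assms] using assms \<psi> by (intro l2_norm_add_le poly_op_sq_int)
  also have "\<dots> \<le> poly_norm f * l2_norm M \<psi> + poly_norm g * l2_norm M \<psi>"
    using assms \<psi> by (intro add_mono poly_norm_bound)
  finally show "l2_norm M (poly_op (\<lambda>w. f w + g w) \<psi>) \<le> (poly_norm f + poly_norm g) * l2_norm M \<psi>"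
    by (simp add: distrib_right)
qed (simp add: poly_norm_nonneg assms)

lemma poly_norm_mult:
  assumes "f \<in> free_star I" "g \<in> free_star I"
  shows "poly_norm (fs_mult f g) \<le> poly_norm f * poly_norm g"
proof (rule poly_norm_le)
  fix \<psi> assume \<psi>: "\<psi> \<in> sq_int M"
  have "l2_norm M (poly_op (fs_mult f g) \<psi>) \<le> poly_norm f * l2_norm M (poly_op g \<psi>)"
    unfolding poly_op_mult[OF assms] using assms \<psi> by (intro poly_norm_bound poly_op_sq_int)
  also have "\<dots> \<le> poly_norm f * (poly_norm g * l2_norm M \<psi>)"
    using assms \<psi> by (intro mult_left_mono poly_norm_bound poly_norm_nonneg)
  finally show "l2_norm M (poly_op (fs_mult f g) \<psi>) \<le> poly_norm f * poly_norm g * l2_norm M \<psi>"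
    by (simp add: mult.assoc)
qed (simp add: poly_norm_nonneg assms)

lemma poly_norm_scale:
  assumes "f \<in> free_star I"
  shows "poly_norm (\<lambda>w. c * f w) = cmod c * poly_norm f"
proof -
  have le: "poly_norm (\<lambda>w. c * f w) \<le> cmod c * poly_norm f" if f: "f \<in> free_star I" for c f
  proof (rule poly_norm_le)
    fix \<psi> assume "\<psi> \<in> sq_int M"
    then show "l2_norm M (poly_op (\<lambda>w. c * f w) \<psi>) \<le> cmod c * poly_norm f * l2_norm M \<psi>"
      unfolding poly_op_scale[OF f] l2_norm_scale mult.assoc
      by (intro mult_left_mono poly_norm_bound f) auto
  qed (simp add: poly_norm_nonneg f)
  show ?thesis
  proof (cases "c = 0")
    case True
    then show ?thesis
      using le[OF assms, of c] poly_norm_nonneg[OF free_star_scale[OF assms, of c]] by simp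
  next
    case False
    have "poly_norm f = poly_norm (\<lambda>w. inverse c * (c * f w))" using False by (simp add: mult.assoc[symmetric])
    also have "\<dots> \<le> cmod (inverse c) * poly_norm (\<lambda>w. c * f w)"
      by (rule le[OF free_star_scale[OF assms]])
    finally have "cmod c * poly_norm f \<le> poly_norm (\<lambda>w. c * f w)"
      using False by (simp add: norm_divide field_simps)
    with le[OF assms, of c] show ?thesis by simp
  qed
qed

text \<open>
  The nontrivial half of the C*-identity, from
  \<open>\<parallel>f(T) \<psi>\<parallel>\<^sup>2 = \<langle>\<psi>, (f\<^sup>* f)(T) \<psi>\<rangle>\<close> and the Cauchy-Schwarz inequality.
\<close>

lemma poly_norm_square_le:
  assumes f: "f \<in> free_star I"
  shows "(poly_norm f)\<^sup>2 \<le> poly_norm (fs_mult (fs_adj f) f)"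
proof -
  let ?g = "fs_mult (fs_adj f) f"
  have g: "?g \<in> free_star I" using f by (intro free_star_mult free_star_adj)
  have "poly_norm f \<le> sqrt (poly_norm ?g)"
  proof (rule poly_norm_le)
    fix \<psi> assume \<psi>: "\<psi> \<in> sq_int M"
    have "(l2_norm M (poly_op f \<psi>))\<^sup>2 = cmod (l2_inner M (poly_op f \<psi>) (poly_op f \<psi>))"
      by (simp add: l2_inner_self norm_power)
    also have "l2_inner M (poly_op f \<psi>) (poly_op f \<psi>) = l2_inner M \<psi> (poly_op ?g \<psi>)"
      using f \<psi> by (simp add: poly_op_adjoint poly_op_sq_int poly_op_mult free_star_adj)
    also have "cmod \<dots> \<le> l2_norm M \<psi> * l2_norm M (poly_op ?g \<psi>)"
      using \<psi> g by (intro l2_Cauchy_Schwarz poly_op_sq_int)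
    also have "\<dots> \<le> l2_norm M \<psi> * (poly_norm ?g * l2_norm M \<psi>)"
      using \<psi> g by (intro mult_left_mono poly_norm_bound l2_norm_nonneg)
    also have "\<dots> = (sqrt (poly_norm ?g) * l2_norm M \<psi>)\<^sup>2"
      using poly_norm_nonneg[OF g] by (simp add: power_mult_distrib) (simp add: power2_eq_square)
    finally show "l2_norm M (poly_op f \<psi>) \<le> sqrt (poly_norm ?g) * l2_norm M \<psi>"
      by (rule power2_le_imp_le) (simp add: poly_norm_nonneg[OF g] l2_norm_nonneg)
  qed (simp add: poly_norm_nonneg[OF g])
  then have "(poly_norm f)\<^sup>2 \<le> (sqrt (poly_norm ?g))\<^sup>2" by (intro power_mono poly_norm_nonneg f)
  then show ?thesis using poly_norm_nonneg[OF g] by simp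
qed

lemma poly_norm_adj:
  assumes "f \<in> free_star I"
  shows "poly_norm (fs_adj f) = poly_norm f"
proof -
  have le: "poly_norm f \<le> poly_norm (fs_adj f)" if f: "f \<in> free_star I" for f
  proof (cases "poly_norm f = 0")
    case False
    have "poly_norm f * poly_norm f \<le> poly_norm (fs_adj f) * poly_norm f"
      using poly_norm_square_le[OF f] poly_norm_mult[OF free_star_adj[OF f] f] by (simp add: power2_eq_square)
    then show ?thesis using False poly_norm_nonneg[OF f] by simp
  qed (simp add: poly_norm_nonneg free_star_adj f)
  from le[OF assms] le[OF free_star_adj[OF assms]] show ?thesis by simp
qed

theorem cuntz_seminorm_poly_norm: "cuntz_seminorm I poly_norm"
  unfolding cuntz_seminorm_def
proof (intro conjI ballI allI)
  fix f assume f: "f \<in> free_star I"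
  show "poly_norm (fs_mult (fs_adj f) f) = (poly_norm f)\<^sup>2"
    using poly_norm_square_le[OF f] poly_norm_mult[OF free_star_adj[OF f] f] poly_norm_adj[OF f] by (simp add: power2_eq_square)
next
  fix i assume i: "i \<in> I"
  have words: "fs_word [(i, True), (i, False)] \<in> free_star I" "fs_word [] \<in> free_star I"
    using i by (auto intro: free_star_word)
  show "poly_norm (\<lambda>w. fs_word [(i, True), (i, False)] w - fs_word [] w) = 0"
  proof (rule poly_norm_eq_0[OF free_star_diff[OF words]])
    fix \<psi> assume "\<psi> \<in> sq_int M"
    then have "AE x in M. Ts i (T i \<psi>) x = \<psi> x"
      using Ts_T[OF i] by (simp add: l2_eq_def)
    then show "AE x in M. poly_op (\<lambda>w. fs_word [(i, True), (i, False)] w - fs_word [] w) \<psi> x = 0"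
      unfolding poly_op_diff[OF words] by eventually_elim (simp add: poly_op_word letter_def)
  qed
next
  have words: "(\<lambda>w. \<Sum>i\<in>I. fs_word [(i, False), (i, True)] w) \<in> free_star I" "fs_word [] \<in> free_star I"
    by (auto intro!: free_star_word free_star_sum)
  show "poly_norm (\<lambda>w. (\<Sum>i\<in>I. fs_word [(i, False), (i, True)] w) - fs_word [] w) = 0"
  proof (rule poly_norm_eq_0[OF free_star_diff[OF words]])
    fix \<psi> assume "\<psi> \<in> sq_int M"
    then have "AE x in M. (\<Sum>i\<in>I. T i (Ts i \<psi>) x) = \<psi> x"
      using sum_T_Ts by (simp add: l2_eq_def)
    moreover have "poly_op (\<lambda>w. \<Sum>i\<in>I. fs_word [(i, False), (i, True)] w) \<psi>
        = (\<lambda>x. \<Sum>i\<in>I. T i (Ts i \<psi>) x)"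
      by (subst poly_op_sum) (auto simp: poly_op_word letter_def intro!: free_star_word)
    ultimately show "AE x in M. poly_op (\<lambda>w. (\<Sum>i\<in>I. fs_word [(i, False), (i, True)] w) - fs_word [] w) \<psi> x = 0"
      unfolding poly_op_diff[OF words] by (auto simp: poly_op_word elim: eventually_mono)
  qed
qed (auto intro: poly_norm_add poly_norm_mult poly_norm_scale)

lemma l2_operator_letter:
  assumes "i \<in> I"
  shows "l2_operator M (T i)" "l2_operator M (Ts i)"
  unfolding l2_operator_def using assms
  by (auto simp: T_sq_int Ts_sq_int T_add Ts_add T_scale Ts_scale T_norm intro!: exI[of _ 1] Ts_norm)

lemma l2_cuntz_family_T: "l2_cuntz_family M I T"
  unfolding l2_cuntz_family_def
  by (intro exI[of _ Ts] conjI ballI l2_operator_letter T_adjoint Ts_T sum_T_Ts)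

end

section \<open>Extension to the Cuntz algebra\<close>

lemma LIMSEQ_lower_bound:
  fixes x :: real
  assumes "X \<longlonglongrightarrow> x" "\<And>n. c \<le> X n"
  shows "c \<le> x"
  using assms by (intro Lim_bounded2[of X x 0 c]) auto

lemma l2_operator_sq_int: "l2_operator M Q \<Longrightarrow> \<psi> \<in> sq_int M \<Longrightarrow> Q \<psi> \<in> sq_int M"
  by (simp add: l2_operator_def)

lemma l2_operator_add:
  "l2_operator M Q \<Longrightarrow> \<phi> \<in> sq_int M \<Longrightarrow> \<psi> \<in> sq_int M \<Longrightarrow>
    AE x in M. Q (\<lambda>x. \<phi> x + \<psi> x) x = Q \<phi> x + Q \<psi> x"
  by (simp add: l2_operator_def)

lemma l2_operator_cong:
  assumes Q: "l2_operator M Q" and sq: "\<phi> \<in> sq_int M" "\<psi> \<in> sq_int M" and eq: "AE x in M. \<phi> x = \<psi> x"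
  shows "AE x in M. Q \<phi> x = Q \<psi> x"
proof -
  let ?d = "\<lambda>x. \<phi> x - \<psi> x"
  have d: "?d \<in> sq_int M" by (rule sq_int_diff[OF sq])
  obtain C where "l2_norm M (Q ?d) \<le> C * l2_norm M ?d"
    using Q d unfolding l2_operator_def by blast
  moreover have "l2_norm M ?d = 0"
    using sq_intD(1)[OF d] eq by (intro l2_norm_AE_0) auto
  ultimately have "l2_norm M (Q ?d) = 0"
    using l2_norm_nonneg[of M "Q ?d"] by simp
  then have "AE x in M. Q ?d x = 0"
    by (rule l2_norm_eq_0[OF l2_operator_sq_int[OF Q d]])
  moreover have "AE x in M. Q (\<lambda>x. ?d x + \<psi> x) x = Q ?d x + Q \<psi> x"
    by (rule l2_operator_add[OF Q d sq(2)])
  ultimately show ?thesis by eventually_elim simp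
qed

lemma l2_adjoint_unique:
  assumes "l2_adjoint M P Q" "l2_adjoint M P' Q'" and eq: "l2_eq M P P'"
    and sq: "\<And>\<psi>. \<psi> \<in> sq_int M \<Longrightarrow> P \<psi> \<in> sq_int M" "\<And>\<psi>. \<psi> \<in> sq_int M \<Longrightarrow> P' \<psi> \<in> sq_int M"
      "\<And>\<psi>. \<psi> \<in> sq_int M \<Longrightarrow> Q \<psi> \<in> sq_int M" "\<And>\<psi>. \<psi> \<in> sq_int M \<Longrightarrow> Q' \<psi> \<in> sq_int M"
  shows "l2_eq M Q Q'"
  unfolding l2_eq_def
proof
  fix \<psi> assume \<psi>: "\<psi> \<in> sq_int M"
  let ?d = "\<lambda>x. Q \<psi> x - Q' \<psi> x"
  have d: "?d \<in> sq_int M" using sq \<psi> by (intro sq_int_diff)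
  have "l2_inner M ?d (Q \<psi>) = l2_inner M (P ?d) \<psi>"
    using assms(1) d \<psi> by (simp add: l2_adjoint_def)
  also have "\<dots> = cnj (l2_inner M \<psi> (P ?d))" by (rule l2_inner_commute)
  also have "l2_inner M \<psi> (P ?d) = l2_inner M \<psi> (P' ?d)"
    using eq d \<psi> sq by (intro l2_inner_cong_right) (auto simp: l2_eq_def)
  also have "cnj (l2_inner M \<psi> (P' ?d)) = l2_inner M (P' ?d) \<psi>" by (rule l2_inner_commute[symmetric])
  also have "\<dots> = l2_inner M ?d (Q' \<psi>)"
    using assms(2) d \<psi> by (simp add: l2_adjoint_def)
  finally have "l2_inner M ?d ?d = 0"
    using d sq \<psi> by (subst l2_inner_diff_right) auto
  then have "(l2_norm M ?d)\<^sup>2 = 0"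
    unfolding l2_inner_self by (simp only: of_real_eq_0_iff)
  then have "l2_norm M ?d = 0" by simp
  from l2_norm_eq_0[OF d this] show "AE x in M. Q \<psi> x = Q' \<psi> x" by eventually_elim simp
qed

text \<open>
  A Cuntz family of operators together with a Cuntz algebra with the same index set.
\<close>

locale cuntz_ops_algebra =
  cuntz_ops M I T Ts + cuntz_algebra cscale adj I S
  for M :: "'a measure" and I :: "'i set" and T Ts :: "'i \<Rightarrow> ('a \<Rightarrow> complex) \<Rightarrow> 'a \<Rightarrow> complex"
    and cscale :: "complex \<Rightarrow> 'c::{real_normed_algebra_1, banach} \<Rightarrow> 'c" and adj and S
begin

abbreviation ev :: "('i star_word \<Rightarrow> complex) \<Rightarrow> 'c" where
  "ev \<equiv> fs_eval cscale adj S"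

text \<open>
  Here the universal property enters: the operator norm is one of the seminorms that the norm of the
  Cuntz algebra dominates.
\<close>

lemma poly_op_norm:
  assumes "f \<in> free_star I" "\<psi> \<in> sq_int M"
  shows "l2_norm M (poly_op f \<psi>) \<le> norm (ev f) * l2_norm M \<psi>"
  using poly_norm_bound[OF assms] mult_right_mono[OF universal[OF cuntz_seminorm_poly_norm assms(1)] l2_norm_nonneg[of M \<psi>]]
  by linarith

lemma poly_op_diff_norm:
  assumes "f \<in> free_star I" "g \<in> free_star I" "\<psi> \<in> sq_int M"
  shows "l2_norm M (\<lambda>x. poly_op f \<psi> x - poly_op g \<psi> x) \<le> norm (ev f - ev g) * l2_norm M \<psi>"
  using poly_op_norm[OF free_star_diff[OF assms(1,2)] assms(3)] assms
  by (simp add: poly_op_diff fs_eval_diff)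

text \<open>
  The vector \<open>g\<close> is the image of \<open>\<psi>\<close> under the algebra element \<open>a\<close>. Comparison with all polynomials
  \<open>f\<close>, which are dense in the algebra, determines \<open>g\<close> almost everywhere.
\<close>

definition acts :: "'c \<Rightarrow> ('a \<Rightarrow> complex) \<Rightarrow> ('a \<Rightarrow> complex) \<Rightarrow> bool" where
  "acts a \<psi> g \<longleftrightarrow> g \<in> sq_int M \<and>
     (\<forall>f\<in>free_star I. l2_norm M (\<lambda>x. g x - poly_op f \<psi> x) \<le> norm (a - ev f) * l2_norm M \<psi>)"

lemma acts_sq_int: "acts a \<psi> g \<Longrightarrow> g \<in> sq_int M"
  by (simp add: acts_def)

lemma actsD:
  "acts a \<psi> g \<Longrightarrow> f \<in> free_star I \<Longrightarrow>
    l2_norm M (\<lambda>x. g x - poly_op f \<psi> x) \<le> norm (a - ev f) * l2_norm M \<psi>"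
  by (simp add: acts_def)

lemma poly_approximation:
  "\<exists>f. (\<forall>n. f n \<in> free_star I) \<and> (\<lambda>n. ev (f n)) \<longlonglongrightarrow> a"
proof -
  have "a \<in> closure (ev ` free_star I)" using generated by simp
  then have "\<exists>b. (\<forall>n. b n \<in> ev ` free_star I) \<and> b \<longlonglongrightarrow> a"
    by (simp only: closure_sequential)
  then obtain b where b: "\<forall>n. b n \<in> ev ` free_star I" "b \<longlonglongrightarrow> a"
    by (elim exE conjE)
  define f where "f n = inv_into (free_star I) ev (b n)" for n
  have "f n \<in> free_star I" "ev (f n) = b n" for n
    unfolding f_def using b(1) by (simp_all add: inv_into_into f_inv_into_f)
  with b(2) show ?thesis by (intro exI[of _ f]) simp
qed

lemma acts_tendsto:
  assumes g: "acts a \<psi> g" and f: "\<And>n. f n \<in> free_star I" "(\<lambda>n. ev (f n)) \<longlonglongrightarrow> a"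
  shows "(\<lambda>n. l2_norm M (\<lambda>x. g x - poly_op (f n) \<psi> x)) \<longlonglongrightarrow> 0"
proof (rule Lim_null_comparison)
  have "(\<lambda>n. norm (a - ev (f n)) * l2_norm M \<psi>) \<longlonglongrightarrow> norm (a - a) * l2_norm M \<psi>"
    by (intro tendsto_intros f(2))
  then show "(\<lambda>n. norm (a - ev (f n)) * l2_norm M \<psi>) \<longlonglongrightarrow> 0" by simp
  have "norm (l2_norm M (\<lambda>x. g x - poly_op (f n) \<psi> x)) \<le> norm (a - ev (f n)) * l2_norm M \<psi>" for n
    using actsD[OF g f(1)] by (simp add: l2_norm_nonneg)
  then show "\<forall>\<^sub>F n in sequentially.
      norm (l2_norm M (\<lambda>x. g x - poly_op (f n) \<psi> x)) \<le> norm (a - ev (f n)) * l2_norm M \<psi>"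
    by (rule always_eventually[OF allI])
qed

text \<open>One approximating sequence of polynomials suffices.\<close>

lemma actsI:
  assumes \<psi>: "\<psi> \<in> sq_int M" and g: "g \<in> sq_int M"
    and f: "\<And>n. f n \<in> free_star I" "(\<lambda>n. ev (f n)) \<longlonglongrightarrow> a"
    and e: "e \<longlonglongrightarrow> 0" "\<And>n. l2_norm M (\<lambda>x. g x - poly_op (f n) \<psi> x) \<le> e n"
  shows "acts a \<psi> g"
  unfolding acts_def
proof (intro conjI ballI g)
  fix f' assume f': "f' \<in> free_star I"
  have "(\<lambda>n. e n + norm (ev (f n) - ev f') * l2_norm M \<psi>) \<longlonglongrightarrow> 0 + norm (a - ev f') * l2_norm M \<psi>"
    by (intro tendsto_intros e(1) f(2))
  moreover have "l2_norm M (\<lambda>x. g x - poly_op f' \<psi> x) \<le> e n + norm (ev (f n) - ev f') * l2_norm M \<psi>" for n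
    using l2_norm_diff_triangle[OF g poly_op_sq_int[OF f(1) \<psi>] poly_op_sq_int[OF f' \<psi>], of n]
      e(2)[of n] poly_op_diff_norm[OF f(1) f' \<psi>, of n] by linarith
  ultimately have "l2_norm M (\<lambda>x. g x - poly_op f' \<psi> x) \<le> 0 + norm (a - ev f') * l2_norm M \<psi>"
    by (rule LIMSEQ_lower_bound)
  then show "l2_norm M (\<lambda>x. g x - poly_op f' \<psi> x) \<le> norm (a - ev f') * l2_norm M \<psi>" by simp
qed

lemma acts_unique:
  assumes \<psi>: "\<psi> \<in> sq_int M" and g: "acts a \<psi> g" and h: "acts a \<psi> h"
  shows "AE x in M. g x = h x"
proof -
  note sq = acts_sq_int[OF g] acts_sq_int[OF h]
  obtain f where f: "\<And>n. f n \<in> free_star I" "(\<lambda>n. ev (f n)) \<longlonglongrightarrow> a" using poly_approximation[of a] by blast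
  have le: "l2_norm M (\<lambda>x. g x - h x) \<le> l2_norm M (\<lambda>x. g x - poly_op (f n) \<psi> x) + l2_norm M (\<lambda>x. h x - poly_op (f n) \<psi> x)" for n
    using l2_norm_diff_triangle[OF sq(1) poly_op_sq_int[OF f(1) \<psi>] sq(2), of n]
    unfolding l2_norm_minus_commute[of M h "poly_op (f n) \<psi>"] .
  have "l2_norm M (\<lambda>x. g x - h x) \<le> 0 + 0"
    by (rule LIMSEQ_lower_bound[OF tendsto_add[OF acts_tendsto[OF g f] acts_tendsto[OF h f]] le])
  then have "l2_norm M (\<lambda>x. g x - h x) = 0" by (simp add: l2_norm_nonneg order_antisym)
  from l2_norm_eq_0[OF sq_int_diff[OF sq] this] show ?thesis by eventually_elim simp
qed

lemma acts_exists:
  assumes \<psi>: "\<psi> \<in> sq_int M"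
  shows "\<exists>g. acts a \<psi> g"
proof -
  let ?n = "l2_norm M \<psi>"
  obtain f where f: "\<And>n. f n \<in> free_star I" "(\<lambda>n. ev (f n)) \<longlonglongrightarrow> a" using poly_approximation[of a] by blast
  \<comment> \<open>Pass to a subsequence along which the vectors are a fast Cauchy sequence.\<close>
  have "\<exists>m. norm (ev (f m) - a) * (2 * ?n) \<le> (1 / 2) ^ k \<and> norm (ev (f m) - a) \<le> (1 / 2) ^ k" for k
  proof -
    have "(\<lambda>m. norm (ev (f m) - a) * (2 * ?n)) \<longlonglongrightarrow> norm (a - a) * (2 * ?n)"
      "(\<lambda>m. norm (ev (f m) - a)) \<longlonglongrightarrow> norm (a - a)"
      by (intro tendsto_intros f(2))+
    then have "\<forall>\<^sub>F m in sequentially. norm (ev (f m) - a) * (2 * ?n) < (1 / 2) ^ k"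
      "\<forall>\<^sub>F m in sequentially. norm (ev (f m) - a) < (1 / 2) ^ k"
      by (auto dest: order_tendstoD(2)[of _ _ _ "(1 / 2) ^ k"])
    from eventually_conj[OF this] show ?thesis
      by (auto simp: eventually_sequentially intro: less_imp_le)
  qed
  then obtain m where m: "\<And>k. norm (ev (f (m k)) - a) * (2 * ?n) \<le> (1 / 2) ^ k"
      "\<And>k. norm (ev (f (m k)) - a) \<le> (1 / 2) ^ k"
    using choice[of "\<lambda>k m. norm (ev (f m) - a) * (2 * ?n) \<le> (1 / 2) ^ k \<and> norm (ev (f m) - a) \<le> (1 / 2) ^ k"]
    by blast
  have step: "l2_norm M (\<lambda>x. poly_op (f (m (Suc k))) \<psi> x - poly_op (f (m k)) \<psi> x) \<le> (1 / 2) ^ k" for k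
  proof -
    have "norm (ev (f (m (Suc k))) - ev (f (m k))) \<le> norm (ev (f (m (Suc k))) - a) + norm (ev (f (m k)) - a)"
      using norm_triangle_ineq4[of "ev (f (m (Suc k))) - a" "ev (f (m k)) - a"] by simp
    then have "norm (ev (f (m (Suc k))) - ev (f (m k))) * ?n
        \<le> norm (ev (f (m (Suc k))) - a) * ?n + norm (ev (f (m k)) - a) * ?n"
      unfolding distrib_right[symmetric] by (intro mult_right_mono l2_norm_nonneg)
    moreover have "(1 / 2 :: real) ^ Suc k \<le> (1 / 2) ^ k" by simp
    ultimately show ?thesis
      using poly_op_diff_norm[OF f(1) f(1) \<psi>, of "m (Suc k)" "m k"] m(1)[of k] m(1)[of "Suc k"] by linarith
  qed
  obtain h where h: "h \<in> sq_int M" "\<And>k. l2_norm M (\<lambda>x. h x - poly_op (f (m k)) \<psi> x) \<le> 2 * (1 / 2) ^ k"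
    by (rule l2_complete[of "\<lambda>k. poly_op (f (m k)) \<psi>", OF poly_op_sq_int[OF f(1) \<psi>] step]) blast
  have "acts a \<psi> h"
  proof (rule actsI[OF \<psi> h(1) f(1) _ _ h(2)])
    have "(\<lambda>k. (1 / 2 :: real) ^ k) \<longlonglongrightarrow> 0" by (rule LIMSEQ_realpow_zero) auto
    then show "(\<lambda>k. 2 * (1 / 2 :: real) ^ k) \<longlonglongrightarrow> 0" by (rule tendsto_mult_right_zero)
    show "(\<lambda>k. ev (f (m k))) \<longlonglongrightarrow> a"
      using Lim_null_comparison[OF always_eventually[OF allI[OF m(2)]] \<open>(\<lambda>k. (1 / 2 :: real) ^ k) \<longlonglongrightarrow> 0\<close>]
      by (rule Lim_null[THEN iffD2])
  qed
  then show ?thesis by blast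
qed

lemma acts_add:
  assumes \<psi>: "\<psi> \<in> sq_int M" and g: "acts a \<psi> g" and h: "acts b \<psi> h"
  shows "acts (a + b) \<psi> (\<lambda>x. g x + h x)"
proof -
  note sq = acts_sq_int[OF g] acts_sq_int[OF h]
  obtain f where f: "\<And>n. f n \<in> free_star I" "(\<lambda>n. ev (f n)) \<longlonglongrightarrow> a" using poly_approximation[of a] by blast
  obtain f' where f': "\<And>n. f' n \<in> free_star I" "(\<lambda>n. ev (f' n)) \<longlonglongrightarrow> b" using poly_approximation[of b] by blast
  show ?thesis
  proof (rule actsI[OF \<psi> sq_int_add[OF sq] free_star_add[OF f(1) f'(1)]])
    show "(\<lambda>n. ev (\<lambda>w. f n w + f' n w)) \<longlonglongrightarrow> a + b"
      using tendsto_add[OF f(2) f'(2)] by (simp add: fs_eval_add[OF f(1) f'(1)])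
    show "(\<lambda>n. l2_norm M (\<lambda>x. g x - poly_op (f n) \<psi> x) + l2_norm M (\<lambda>x. h x - poly_op (f' n) \<psi> x)) \<longlonglongrightarrow> 0"
      using tendsto_add[OF acts_tendsto[OF g f] acts_tendsto[OF h f']] by simp
    show "l2_norm M (\<lambda>x. g x + h x - poly_op (\<lambda>w. f n w + f' n w) \<psi> x)
        \<le> l2_norm M (\<lambda>x. g x - poly_op (f n) \<psi> x) + l2_norm M (\<lambda>x. h x - poly_op (f' n) \<psi> x)" for n
      using l2_norm_add_le[OF sq_int_diff[OF sq(1) poly_op_sq_int[OF f(1) \<psi>]]
          sq_int_diff[OF sq(2) poly_op_sq_int[OF f'(1) \<psi>]]]
      by (simp add: poly_op_add[OF f(1) f'(1)] add_diff_add)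
  qed
qed

lemma acts_scale:
  assumes \<psi>: "\<psi> \<in> sq_int M" and g: "acts a \<psi> g"
  shows "acts (cscale c a) \<psi> (\<lambda>x. c * g x)"
proof -
  obtain f where f: "\<And>n. f n \<in> free_star I" "(\<lambda>n. ev (f n)) \<longlonglongrightarrow> a" using poly_approximation[of a] by blast
  show ?thesis
  proof (rule actsI[OF \<psi> sq_int_scale[OF acts_sq_int[OF g]] free_star_scale[OF f(1)]])
    have "ev (\<lambda>w. c * f n w) - cscale c a = cscale c (ev (f n) - a)" for n
      by (simp add: fs_eval_scale[OF f(1)] scale_right_diff_distrib)
    then have "(\<lambda>n. norm (ev (\<lambda>w. c * f n w) - cscale c a)) = (\<lambda>n. cmod c * norm (ev (f n) - a))"
      by (simp add: norm_cscale)
    also have "\<dots> \<longlonglongrightarrow> 0"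
      by (rule tendsto_mult_right_zero[OF tendsto_norm_zero[OF LIM_zero[OF f(2)]]])
    finally show "(\<lambda>n. ev (\<lambda>w. c * f n w)) \<longlonglongrightarrow> cscale c a"
      by (rule LIM_zero_cancel[OF tendsto_norm_zero_cancel])
    show "(\<lambda>n. cmod c * l2_norm M (\<lambda>x. g x - poly_op (f n) \<psi> x)) \<longlonglongrightarrow> 0"
      by (intro tendsto_mult_right_zero acts_tendsto[OF g f])
    show "l2_norm M (\<lambda>x. c * g x - poly_op (\<lambda>w. c * f n w) \<psi> x) \<le> cmod c * l2_norm M (\<lambda>x. g x - poly_op (f n) \<psi> x)" for n
      by (simp add: poly_op_scale[OF f(1)] right_diff_distrib[symmetric] l2_norm_scale)
  qed
qed

lemma acts_norm:
  assumes \<psi>: "\<psi> \<in> sq_int M" and g: "acts a \<psi> g"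
  shows "l2_norm M g \<le> norm a * l2_norm M \<psi>"
proof -
  obtain f where f: "\<And>n. f n \<in> free_star I" "(\<lambda>n. ev (f n)) \<longlonglongrightarrow> a" using poly_approximation[of a] by blast
  have le: "l2_norm M g \<le> l2_norm M (\<lambda>x. g x - poly_op (f n) \<psi> x) + norm (ev (f n)) * l2_norm M \<psi>" for n
    using l2_norm_le_diff[OF acts_sq_int[OF g] poly_op_sq_int[OF f(1) \<psi>], of n] poly_op_norm[OF f(1) \<psi>, of n] by linarith
  have "(\<lambda>n. l2_norm M (\<lambda>x. g x - poly_op (f n) \<psi> x) + norm (ev (f n)) * l2_norm M \<psi>) \<longlonglongrightarrow> 0 + norm a * l2_norm M \<psi>"
    by (intro tendsto_intros acts_tendsto[OF g f] f(2))
  from LIMSEQ_lower_bound[OF this le] have "l2_norm M g \<le> 0 + norm a * l2_norm M \<psi>" .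
  then show ?thesis by simp
qed

lemma acts_arg_add:
  assumes "\<phi> \<in> sq_int M" "\<psi> \<in> sq_int M" and g: "acts a \<phi> g" and h: "acts a \<psi> h"
  shows "acts a (\<lambda>x. \<phi> x + \<psi> x) (\<lambda>x. g x + h x)"
proof -
  note sq = acts_sq_int[OF g] acts_sq_int[OF h]
  obtain f where f: "\<And>n. f n \<in> free_star I" "(\<lambda>n. ev (f n)) \<longlonglongrightarrow> a" using poly_approximation[of a] by blast
  show ?thesis
  proof (rule actsI[OF sq_int_add[OF assms(1,2)] sq_int_add[OF sq] f])
    show "(\<lambda>n. l2_norm M (\<lambda>x. g x - poly_op (f n) \<phi> x) + l2_norm M (\<lambda>x. h x - poly_op (f n) \<psi> x)) \<longlonglongrightarrow> 0"
      using tendsto_add[OF acts_tendsto[OF g f] acts_tendsto[OF h f]] by simp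
    show "l2_norm M (\<lambda>x. g x + h x - poly_op (f n) (\<lambda>x. \<phi> x + \<psi> x) x)
        \<le> l2_norm M (\<lambda>x. g x - poly_op (f n) \<phi> x) + l2_norm M (\<lambda>x. h x - poly_op (f n) \<psi> x)" for n
      using l2_norm_add_le[OF sq_int_diff[OF sq(1) poly_op_sq_int[OF f(1) assms(1)]]
          sq_int_diff[OF sq(2) poly_op_sq_int[OF f(1) assms(2)]]]
      by (simp add: poly_op_add_arg add_diff_add)
  qed
qed

lemma acts_arg_scale:
  assumes g: "acts a \<psi> g"
  shows "acts a (\<lambda>x. c * \<psi> x) (\<lambda>x. c * g x)"
  unfolding acts_def
proof (intro conjI ballI sq_int_scale acts_sq_int[OF g])
  fix f assume "f \<in> free_star I"
  from mult_left_mono[OF actsD[OF g this], of "cmod c"]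
  show "l2_norm M (\<lambda>x. c * g x - poly_op f (\<lambda>x. c * \<psi> x) x) \<le> norm (a - ev f) * l2_norm M (\<lambda>x. c * \<psi> x)"
    by (simp add: poly_op_scale_arg right_diff_distrib[symmetric] l2_norm_scale mult.left_commute)
qed

lemma acts_mult:
  assumes \<psi>: "\<psi> \<in> sq_int M" and g: "acts b \<psi> g" and h: "acts a g h"
  shows "acts (a * b) \<psi> h"
proof -
  note sq = acts_sq_int[OF g] acts_sq_int[OF h]
  obtain f where f: "\<And>n. f n \<in> free_star I" "(\<lambda>n. ev (f n)) \<longlonglongrightarrow> a" using poly_approximation[of a] by blast
  obtain f' where f': "\<And>n. f' n \<in> free_star I" "(\<lambda>n. ev (f' n)) \<longlonglongrightarrow> b" using poly_approximation[of b] by blast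
  note f'_sq = poly_op_sq_int[OF f'(1) \<psi>]
  show ?thesis
  proof (rule actsI[OF \<psi> sq(2) free_star_mult[OF f(1) f'(1)]])
    show "(\<lambda>n. ev (fs_mult (f n) (f' n))) \<longlonglongrightarrow> a * b"
      using tendsto_mult[OF f(2) f'(2)] by (simp add: fs_eval_mult[OF f(1) f'(1)])
    have "(\<lambda>n. l2_norm M (\<lambda>x. h x - poly_op (f n) g x) + norm (ev (f n)) * l2_norm M (\<lambda>x. g x - poly_op (f' n) \<psi> x))
        \<longlonglongrightarrow> 0 + norm a * 0"
      by (intro tendsto_intros acts_tendsto[OF g f'] acts_tendsto[OF h f] f(2))
    then show "(\<lambda>n. l2_norm M (\<lambda>x. h x - poly_op (f n) g x) + norm (ev (f n)) * l2_norm M (\<lambda>x. g x - poly_op (f' n) \<psi> x))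
        \<longlonglongrightarrow> 0" by simp
    show "l2_norm M (\<lambda>x. h x - poly_op (fs_mult (f n) (f' n)) \<psi> x)
        \<le> l2_norm M (\<lambda>x. h x - poly_op (f n) g x) + norm (ev (f n)) * l2_norm M (\<lambda>x. g x - poly_op (f' n) \<psi> x)" for n
      using l2_norm_diff_triangle[OF sq(2) poly_op_sq_int[OF f(1) sq(1)] poly_op_sq_int[OF f(1) f'_sq], of n n n]
        poly_op_norm[OF f(1) sq_int_diff[OF sq(1) f'_sq], of n n]
      unfolding poly_op_mult[OF f(1) f'(1)] poly_op_diff_arg by linarith
  qed
qed

lemma acts_poly:
  assumes "f \<in> free_star I" "\<psi> \<in> sq_int M"
  shows "acts (ev f) \<psi> (poly_op f \<psi>)"
  unfolding acts_def using assms by (auto intro: poly_op_sq_int poly_op_diff_norm)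

lemma acts_one:
  assumes "\<psi> \<in> sq_int M"
  shows "acts 1 \<psi> \<psi>"
  using acts_poly[OF free_star_word[of "[]"] assms]
  by (simp add: fs_eval_word word_val_def poly_op_word)

lemma acts_generator:
  assumes "i \<in> I" "\<psi> \<in> sq_int M"
  shows "acts (S i) \<psi> (T i \<psi>)"
  using acts_poly[OF free_star_word[of "[(i, False)]"] assms(2)] assms(1)
  by (simp add: fs_eval_word word_val_def poly_op_word letter_def)

lemma acts_inner_tendsto:
  assumes \<phi>: "\<phi> \<in> sq_int M" and \<psi>: "\<psi> \<in> sq_int M" and g: "acts a \<phi> g"
    and f: "\<And>n. f n \<in> free_star I" "(\<lambda>n. ev (f n)) \<longlonglongrightarrow> a"
  shows "(\<lambda>n. l2_inner M (poly_op (f n) \<phi>) \<psi>) \<longlonglongrightarrow> l2_inner M g \<psi>"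
proof -
  note sq = acts_sq_int[OF g] poly_op_sq_int[OF f(1) \<phi>]
  have "cmod (l2_inner M g \<psi> - l2_inner M (poly_op (f n) \<phi>) \<psi>)
      \<le> l2_norm M (\<lambda>x. g x - poly_op (f n) \<phi> x) * l2_norm M \<psi>" for n
    using l2_Cauchy_Schwarz[OF sq_int_diff[OF sq] \<psi>] by (simp add: l2_inner_diff_left sq \<psi>)
  then have "\<forall>\<^sub>F n in sequentially. cmod (l2_inner M (poly_op (f n) \<phi>) \<psi> - l2_inner M g \<psi>)
      \<le> l2_norm M (\<lambda>x. g x - poly_op (f n) \<phi> x) * l2_norm M \<psi>"
    by (simp add: norm_minus_commute)
  then have "(\<lambda>n. l2_inner M (poly_op (f n) \<phi>) \<psi> - l2_inner M g \<psi>) \<longlonglongrightarrow> 0"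
    by (rule Lim_null_comparison) (rule tendsto_mult_left_zero[OF acts_tendsto[OF g f]])
  then show ?thesis by (rule LIM_zero_cancel)
qed

lemma acts_adj:
  assumes \<phi>: "\<phi> \<in> sq_int M" and \<psi>: "\<psi> \<in> sq_int M" and g: "acts a \<phi> g" and h: "acts (adj a) \<psi> h"
  shows "l2_inner M g \<psi> = l2_inner M \<phi> h"
proof -
  obtain f where f: "\<And>n. f n \<in> free_star I" "(\<lambda>n. ev (f n)) \<longlonglongrightarrow> a" using poly_approximation[of a] by blast
  have "norm (ev (fs_adj (f n)) - adj a) = norm (ev (f n) - a)" for n
    by (simp add: fs_eval_adj adj_diff[symmetric] norm_adj)
  then have "(\<lambda>n. ev (fs_adj (f n))) \<longlonglongrightarrow> adj a"
    using f(2) by (simp add: tendsto_iff dist_norm)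
  from tendsto_cnj[OF acts_inner_tendsto[OF \<psi> \<phi> h free_star_adj[OF f(1)] this]]
  have "(\<lambda>n. l2_inner M \<phi> (poly_op (fs_adj (f n)) \<psi>)) \<longlonglongrightarrow> l2_inner M \<phi> h"
    by (simp only: l2_inner_commute[symmetric])
  then have "(\<lambda>n. l2_inner M (poly_op (f n) \<phi>) \<psi>) \<longlonglongrightarrow> l2_inner M \<phi> h"
    by (simp add: poly_op_adjoint[OF f(1) \<phi> \<psi>])
  with acts_inner_tendsto[OF \<phi> \<psi> g f] show ?thesis by (rule LIMSEQ_unique)
qed

text \<open>
  The representation. The image of \<open>\<psi>\<close> is only determined almost everywhere, hence the choice; the
  value for \<open>\<psi>\<close> that are not square-integrable is irrelevant.
\<close>

definition rep :: "'c \<Rightarrow> ('a \<Rightarrow> complex) \<Rightarrow> 'a \<Rightarrow> complex" where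
  "rep a \<psi> = (SOME g. acts a \<psi> g)"

lemma acts_rep: "\<psi> \<in> sq_int M \<Longrightarrow> acts a \<psi> (rep a \<psi>)"
  unfolding rep_def by (rule someI_ex[OF acts_exists])

lemma rep_sq_int: "\<psi> \<in> sq_int M \<Longrightarrow> rep a \<psi> \<in> sq_int M"
  by (rule acts_sq_int[OF acts_rep])

lemma rep_eqI: "\<psi> \<in> sq_int M \<Longrightarrow> acts a \<psi> g \<Longrightarrow> AE x in M. rep a \<psi> x = g x"
  by (rule acts_unique[OF _ acts_rep])

theorem l2_representation_rep: "l2_representation cscale adj M rep"
  unfolding l2_representation_def
proof (intro conjI allI)
  fix a
  show "l2_operator M (rep a)"
    unfolding l2_operator_def
  proof (intro conjI ballI allI)
    show "\<exists>C. \<forall>\<psi>\<in>sq_int M. l2_norm M (rep a \<psi>) \<le> C * l2_norm M \<psi>"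
      using acts_norm[OF _ acts_rep] by blast
    fix \<phi> \<psi> assume "\<phi> \<in> sq_int M" "\<psi> \<in> sq_int M"
    then show "AE x in M. rep a (\<lambda>y. \<phi> y + \<psi> y) x = rep a \<phi> x + rep a \<psi> x"
      by (intro rep_eqI sq_int_add acts_arg_add acts_rep)
  next
    fix c \<psi> assume "\<psi> \<in> sq_int M"
    then show "AE x in M. rep a (\<lambda>y. c * \<psi> y) x = c * rep a \<psi> x"
      by (intro rep_eqI sq_int_scale acts_arg_scale acts_rep)
  qed (rule rep_sq_int)
  show "l2_adjoint M (rep a) (rep (adj a))"
    unfolding l2_adjoint_def by (auto intro: acts_adj acts_rep)
next
  fix a b
  show "l2_eq M (rep (a + b)) (\<lambda>\<psi> x. rep a \<psi> x + rep b \<psi> x)"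
    unfolding l2_eq_def by (intro ballI rep_eqI acts_add acts_rep)
next
  fix c a
  show "l2_eq M (rep (cscale c a)) (\<lambda>\<psi> x. c * rep a \<psi> x)"
    unfolding l2_eq_def by (intro ballI rep_eqI acts_scale acts_rep)
qed (auto simp: l2_eq_def intro: rep_eqI acts_mult acts_one acts_rep rep_sq_int acts_norm)

lemma rep_generator: "i \<in> I \<Longrightarrow> l2_eq M (rep (S i)) (T i)"
  unfolding l2_eq_def by (auto intro: rep_eqI acts_generator)

text \<open>
  A representation is determined by the images of the generators: those of their adjoints are the
  adjoints, and by continuity the polynomials determine the rest.
\<close>

theorem rep_unique:
  assumes \<pi>: "l2_representation cscale adj M \<pi>" and gen: "\<And>i. i \<in> I \<Longrightarrow> l2_eq M (\<pi> (S i)) (T i)"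
  shows "l2_eq M (\<pi> a) (rep a)"
proof -
  have op: "l2_operator M (\<pi> a)" for a
    using \<pi> by (simp add: l2_representation_def)
  note sq = l2_operator_sq_int[OF op]
  have add: "AE x in M. \<pi> (a + b) \<psi> x = \<pi> a \<psi> x + \<pi> b \<psi> x"
    and mult: "AE x in M. \<pi> (a * b) \<psi> x = \<pi> a (\<pi> b \<psi>) x"
    and scale: "AE x in M. \<pi> (cscale c a) \<psi> x = c * \<pi> a \<psi> x"
    and one: "AE x in M. \<pi> 1 \<psi> x = \<psi> x"
    and bound: "l2_norm M (\<pi> a \<psi>) \<le> norm a * l2_norm M \<psi>"
    if "\<psi> \<in> sq_int M" for a b c \<psi>
    using \<pi> that unfolding l2_representation_def l2_eq_def by blast+
  have adj_gen: "l2_eq M (\<pi> (adj (S i))) (Ts i)" if i: "i \<in> I" for i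
  proof (rule l2_adjoint_unique[OF _ T_adjoint[OF i] gen[OF i]])
    show "l2_adjoint M (\<pi> (S i)) (\<pi> (adj (S i)))" using \<pi> by (simp add: l2_representation_def)
  qed (auto intro: sq T_sq_int Ts_sq_int i)
  have letter: "AE x in M. \<pi> (word_val S [l]) \<psi> x = letter l \<psi> x" if "fst l \<in> I" "\<psi> \<in> sq_int M" for l \<psi>
    using gen[OF that(1)] adj_gen[OF that(1)] that(2)
    by (cases l) (auto simp: word_val_def letter_def l2_eq_def)
  have word: "AE x in M. \<pi> (word_val S w) \<psi> x = word_op w \<psi> x" if "fst ` set w \<subseteq> I" "\<psi> \<in> sq_int M" for w \<psi>
    using that(1)
  proof (induction w)
    case Nil
    show ?case using one[OF that(2)] by (simp add: word_val_def)
  next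
    case (Cons l w)
    have l: "fst l \<in> I" and w: "fst ` set w \<subseteq> I" using Cons.prems by auto
    have "AE x in M. \<pi> (word_val S [l] * word_val S w) \<psi> x = \<pi> (word_val S [l]) (\<pi> (word_val S w) \<psi>) x"
      by (rule mult[OF that(2)])
    moreover have "AE x in M. \<pi> (word_val S [l]) (\<pi> (word_val S w) \<psi>) x = \<pi> (word_val S [l]) (word_op w \<psi>) x"
      by (intro l2_operator_cong[OF op] sq that(2) word_op_sq_int w Cons.IH)
    moreover have "AE x in M. \<pi> (word_val S [l]) (word_op w \<psi>) x = letter l (word_op w \<psi>) x"
      by (intro letter l word_op_sq_int w that(2))
    ultimately show ?case
      unfolding word_val_append[symmetric] by eventually_elim simp
  qed
  have poly: "AE x in M. \<pi> (ev f) \<psi> x = poly_op f \<psi> x" if f: "f \<in> free_star I" and \<psi>: "\<psi> \<in> sq_int M" for f \<psi>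
  proof -
    have "AE x in M. \<pi> (\<Sum>w\<in>W. cscale (f w) (word_val S w)) \<psi> x = (\<Sum>w\<in>W. f w * word_op w \<psi> x)"
      if "finite W" "\<And>w. w \<in> W \<Longrightarrow> fst ` set w \<subseteq> I" for W
      using that
    proof (induction W rule: finite_induct)
      case empty
      have "l2_norm M (\<pi> 0 \<psi>) = 0"
        using bound[OF \<psi>, of 0] l2_norm_nonneg[of M "\<pi> 0 \<psi>"] by simp
      from l2_norm_eq_0[OF sq[OF \<psi>] this] show ?case by simp
    next
      case (insert w W)
      have "AE x in M. \<pi> (\<Sum>w\<in>W. cscale (f w) (word_val S w)) \<psi> x = (\<Sum>w\<in>W. f w * word_op w \<psi> x)"
        using insert by simp
      moreover have "AE x in M. \<pi> (word_val S w) \<psi> x = word_op w \<psi> x"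
        using insert.prems \<psi> by (intro word) auto
      moreover note scale[OF \<psi>, of "f w" "word_val S w"]
        add[OF \<psi>, of "cscale (f w) (word_val S w)" "\<Sum>w\<in>W. cscale (f w) (word_val S w)"]
      ultimately show ?case
        unfolding sum.insert[OF insert.hyps] by eventually_elim simp
    qed
    from this[OF free_star_finite[OF f]] show ?thesis
      using free_star_letters[OF f] by (simp add: fs_eval_eq lin_ext_def poly_op_def)
  qed
  have "acts a \<psi> (\<pi> a \<psi>)" if \<psi>: "\<psi> \<in> sq_int M" for \<psi>
    unfolding acts_def
  proof (intro conjI ballI sq[OF \<psi>])
    fix f assume f: "f \<in> free_star I"
    have "AE x in M. \<pi> a \<psi> x - poly_op f \<psi> x = \<pi> (a - ev f) \<psi> x"
      using add[OF \<psi>, of "a - ev f" "ev f"] poly[OF f \<psi>] by eventually_elim simp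
    then have "l2_norm M (\<lambda>x. \<pi> a \<psi> x - poly_op f \<psi> x) = l2_norm M (\<pi> (a - ev f) \<psi>)"
      using f \<psi> by (intro l2_norm_cong sq_intD(1) sq_int_diff sq poly_op_sq_int)
    then show "l2_norm M (\<lambda>x. \<pi> a \<psi> x - poly_op f \<psi> x) \<le> norm (a - ev f) * l2_norm M \<psi>"
      using bound[OF \<psi>] by simp
  qed
  then show ?thesis
    unfolding l2_eq_def by (auto intro: acts_unique acts_rep)
qed

end

section \<open>Cuntz families from branching systems\<close>

text \<open>
  A system of branches \<open>\<tau> i\<close>, each of which divides the measure by \<open>c\<close>, whose ranges \<open>R i\<close> partition
  the space, and a common left inverse \<open>\<sigma>\<close>, all up to null sets. The condition on the measure is
  expressed through the image measure. The weights \<open>g i\<close> are only known almost everywhere, as they come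
  from Radon-Nikodym derivatives.
\<close>

locale uniform_branching = finite_measure M for M :: "'a measure" +
  fixes I :: "'i set" and \<tau> :: "'i \<Rightarrow> 'a \<Rightarrow> 'a" and \<sigma> :: "'a \<Rightarrow> 'a" and R :: "'i \<Rightarrow> 'a set"
    and c :: real and g :: "'i \<Rightarrow> 'a \<Rightarrow> real"
  assumes finite_I: "finite I" and c_pos: "0 < c"
    and \<tau>_meas: "i \<in> I \<Longrightarrow> \<tau> i \<in> measurable M M"
    and \<sigma>_meas [measurable]: "\<sigma> \<in> measurable M M"
    and R_sets: "i \<in> I \<Longrightarrow> R i \<in> sets M"
    and distr_\<tau>: "i \<in> I \<Longrightarrow> distr M M (\<tau> i) = density M (\<lambda>x. ennreal (c * indicator (R i) x))"
    and \<sigma>_\<tau>: "i \<in> I \<Longrightarrow> AE x in M. \<sigma> (\<tau> i x) = x"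
    and R_partition: "AE x in M. (\<Sum>i\<in>I. indicator (R i) x) = (1 :: complex)"
    and g_meas: "i \<in> I \<Longrightarrow> g i \<in> borel_measurable M"
    and g_AE: "i \<in> I \<Longrightarrow> AE x in M. g i x = sqrt c"
begin

text \<open>
  The isometry of the branch \<open>\<tau> i\<close>, and its adjoint, for which the constant weight can be taken.
\<close>

definition T :: "'i \<Rightarrow> ('a \<Rightarrow> complex) \<Rightarrow> 'a \<Rightarrow> complex" where
  "T i \<psi> x = indicator (R i) x * complex_of_real (g i (\<sigma> x)) * \<psi> (\<sigma> x)"

definition Ts :: "'i \<Rightarrow> ('a \<Rightarrow> complex) \<Rightarrow> 'a \<Rightarrow> complex" where
  "Ts i \<psi> x = complex_of_real (1 / sqrt c) * \<psi> (\<tau> i x)"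

context
  fixes i assumes i: "i \<in> I"
begin

lemmas [measurable] = \<tau>_meas[OF i] R_sets[OF i] g_meas[OF i]

lemma AE_\<tau>_iff:
  assumes [measurable]: "Measurable.pred M Q"
  shows "(AE x in M. Q (\<tau> i x)) \<longleftrightarrow> (AE x in M. x \<in> R i \<longrightarrow> Q x)"
proof -
  have "(AE x in M. Q (\<tau> i x)) \<longleftrightarrow> (AE x in distr M M (\<tau> i). Q x)"
    by (subst AE_distr_iff) auto
  also have "\<dots> \<longleftrightarrow> (AE x in M. 0 < ennreal (c * indicator (R i) x) \<longrightarrow> Q x)"
    unfolding distr_\<tau>[OF i] by (rule AE_density) measurable
  also have "\<dots> \<longleftrightarrow> (AE x in M. x \<in> R i \<longrightarrow> Q x)"
    using c_pos by (intro AE_cong) (auto split: split_indicator)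
  finally show ?thesis .
qed

lemma integral_\<tau>:
  fixes F :: "'a \<Rightarrow> 'b::{banach, second_countable_topology}"
  assumes [measurable]: "F \<in> borel_measurable M"
  shows "(\<integral>x. F (\<tau> i x) \<partial>M) = (\<integral>x. (c * indicator (R i) x) *\<^sub>R F x \<partial>M)"
    and "integrable M (\<lambda>x. F (\<tau> i x)) \<longleftrightarrow> integrable M (\<lambda>x. (c * indicator (R i) x) *\<^sub>R F x)"
proof -
  have "(\<integral>x. F (\<tau> i x) \<partial>M) = (\<integral>x. F x \<partial>distr M M (\<tau> i))"
    by (rule integral_distr[symmetric]) measurable
  also have "\<dots> = (\<integral>x. (c * indicator (R i) x) *\<^sub>R F x \<partial>M)"
    unfolding distr_\<tau>[OF i] using c_pos by (intro integral_density) auto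
  finally show "(\<integral>x. F (\<tau> i x) \<partial>M) = (\<integral>x. (c * indicator (R i) x) *\<^sub>R F x \<partial>M)" .
  have "integrable M (\<lambda>x. F (\<tau> i x)) \<longleftrightarrow> integrable (distr M M (\<tau> i)) F"
    by (rule integrable_distr_eq[symmetric]) measurable
  also have "\<dots> \<longleftrightarrow> integrable M (\<lambda>x. (c * indicator (R i) x) *\<^sub>R F x)"
    unfolding distr_\<tau>[OF i] using c_pos by (intro integrable_density) auto
  finally show "integrable M (\<lambda>x. F (\<tau> i x)) \<longleftrightarrow> integrable M (\<lambda>x. (c * indicator (R i) x) *\<^sub>R F x)" .
qed

lemma \<tau>_in_R: "AE x in M. \<tau> i x \<in> R i"
  by (subst AE_\<tau>_iff) auto

lemma g_\<sigma>: "AE x in M. x \<in> R i \<longrightarrow> g i (\<sigma> x) = sqrt c"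
proof -
  have "AE x in M. g i (\<sigma> (\<tau> i x)) = sqrt c"
    using \<sigma>_\<tau>[OF i] g_AE[OF i] by eventually_elim simp
  then show ?thesis by (subst (asm) AE_\<tau>_iff) auto
qed

lemma \<tau>_\<sigma>:
  assumes [measurable]: "\<psi> \<in> borel_measurable M"
  shows "AE x in M. x \<in> R i \<longrightarrow> \<psi> (\<tau> i (\<sigma> x)) = (\<psi> x :: complex)"
proof -
  have "AE x in M. \<psi> (\<tau> i (\<sigma> (\<tau> i x))) = \<psi> (\<tau> i x)"
    using \<sigma>_\<tau>[OF i] by eventually_elim simp
  then show ?thesis by (subst (asm) AE_\<tau>_iff) auto
qed

lemma T_sq_int:
  assumes \<psi>: "\<psi> \<in> sq_int M"
  shows "T i \<psi> \<in> sq_int M"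
proof (rule sq_intI)
  note [measurable] = sq_intD(1)[OF \<psi>]
  show T_meas [measurable]: "T i \<psi> \<in> borel_measurable M"
    unfolding T_def[abs_def] by measurable
  have "integrable M (\<lambda>x. (cmod (\<psi> (\<sigma> (\<tau> i x))))\<^sup>2)"
    using sq_intD(2)[OF \<psi>]
  proof (rule integrable_cong_AE_imp)
    show "AE x in M. (cmod (\<psi> x))\<^sup>2 = (cmod (\<psi> (\<sigma> (\<tau> i x))))\<^sup>2"
      using \<sigma>_\<tau>[OF i] by eventually_elim simp
  qed measurable
  then have "integrable M (\<lambda>x. (c * indicator (R i) x) *\<^sub>R (cmod (\<psi> (\<sigma> x)))\<^sup>2)"
    by (subst (asm) integral_\<tau>(2)) auto
  then show "integrable M (\<lambda>x. (cmod (T i \<psi> x))\<^sup>2)"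
  proof (rule integrable_cong_AE_imp)
    show "AE x in M. (c * indicator (R i) x) *\<^sub>R (cmod (\<psi> (\<sigma> x)))\<^sup>2 = (cmod (T i \<psi> x))\<^sup>2"
      using g_\<sigma> c_pos
      by (auto simp: T_def norm_mult power_mult_distrib split: split_indicator elim!: eventually_mono)
  qed measurable
qed

lemma Ts_sq_int:
  assumes \<psi>: "\<psi> \<in> sq_int M"
  shows "Ts i \<psi> \<in> sq_int M"
proof (rule sq_intI)
  note [measurable] = sq_intD(1)[OF \<psi>]
  show "Ts i \<psi> \<in> borel_measurable M"
    unfolding Ts_def[abs_def] by measurable
  have "integrable M (\<lambda>x. indicator (R i) x *\<^sub>R (cmod (\<psi> x))\<^sup>2)"
    using sq_intD(2)[OF \<psi>] by (intro integrable_mult_indicator) auto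
  then have "integrable M (\<lambda>x. (c * indicator (R i) x) *\<^sub>R (cmod (\<psi> x))\<^sup>2)"
    unfolding scaleR_scaleR[symmetric] by (rule integrable_scaleR_right)
  then have "integrable M (\<lambda>x. (cmod (\<psi> (\<tau> i x)))\<^sup>2)"
    by (subst integral_\<tau>(2)) auto
  then show "integrable M (\<lambda>x. (cmod (Ts i \<psi> x))\<^sup>2)"
    by (simp add: Ts_def norm_mult norm_divide power_mult_distrib power_divide)
qed

lemma T_adjoint: "l2_adjoint M (T i) (Ts i)"
  unfolding l2_adjoint_def
proof (intro ballI)
  fix \<phi> \<psi> assume "\<phi> \<in> sq_int M" "\<psi> \<in> sq_int M"
  then have [measurable]: "\<phi> \<in> borel_measurable M" "\<psi> \<in> borel_measurable M" by (auto dest: sq_intD)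
  let ?F = "\<lambda>x. complex_of_real (g i (\<sigma> x)) * \<phi> (\<sigma> x) * cnj (\<psi> x)"
  have "complex_of_real c * l2_inner M (T i \<phi>) \<psi> = (\<integral>x. complex_of_real c * (T i \<phi> x * cnj (\<psi> x)) \<partial>M)"
    by (simp add: l2_inner_def)
  also have "\<dots> = (\<integral>x. (c * indicator (R i) x) *\<^sub>R ?F x \<partial>M)"
    by (intro Bochner_Integration.integral_cong refl) (auto simp: T_def scaleR_conv_of_real split: split_indicator)
  also have "\<dots> = (\<integral>x. ?F (\<tau> i x) \<partial>M)"
    by (rule integral_\<tau>(1)[symmetric]) measurable
  also have "\<dots> = (\<integral>x. complex_of_real c * (\<phi> x * cnj (Ts i \<psi> x)) \<partial>M)"
  proof (rule integral_cong_AE)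
    have "c * (1 / sqrt c) = sqrt c"
      using c_pos by (simp add: real_div_sqrt)
    then have w: "complex_of_real c * complex_of_real (1 / sqrt c) = complex_of_real (sqrt c)"
      by (simp only: of_real_mult[symmetric])
    show "AE x in M. ?F (\<tau> i x) = complex_of_real c * (\<phi> x * cnj (Ts i \<psi> x))"
      using \<sigma>_\<tau>[OF i] g_AE[OF i]
    proof eventually_elim
      case (elim x)
      then have "?F (\<tau> i x) = complex_of_real (sqrt c) * \<phi> x * cnj (\<psi> (\<tau> i x))" by simp
      then show ?case unfolding w[symmetric] by (simp only: Ts_def complex_cnj_mult complex_cnj_complex_of_real mult_ac)
    qed
  qed (unfold Ts_def[abs_def], measurable)
  also have "\<dots> = complex_of_real c * l2_inner M \<phi> (Ts i \<psi>)"
    by (simp add: l2_inner_def)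
  finally show "l2_inner M (T i \<phi>) \<psi> = l2_inner M \<phi> (Ts i \<psi>)"
    using c_pos by simp
qed

lemma Ts_T: "l2_eq M (\<lambda>\<psi>. Ts i (T i \<psi>)) (\<lambda>\<psi>. \<psi>)"
  unfolding l2_eq_def
proof
  fix \<psi> :: "'a \<Rightarrow> complex"
  have "complex_of_real (1 / sqrt c) * complex_of_real (sqrt c) = 1"
    using c_pos by (simp flip: of_real_mult)
  note w = this
  show "AE x in M. Ts i (T i \<psi>) x = \<psi> x"
    using \<sigma>_\<tau>[OF i] g_AE[OF i] \<tau>_in_R
  proof eventually_elim
    case (elim x)
    then have "Ts i (T i \<psi>) x = complex_of_real (1 / sqrt c) * complex_of_real (sqrt c) * \<psi> x"
      by (simp add: Ts_def T_def)
    then show ?case by (simp only: w mult_1)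
  qed
qed

end

lemma sum_T_Ts: "l2_eq M (\<lambda>\<psi> x. \<Sum>i\<in>I. T i (Ts i \<psi>) x) (\<lambda>\<psi>. \<psi>)"
  unfolding l2_eq_def
proof
  fix \<psi> assume "\<psi> \<in> sq_int M"
  then have \<psi>: "\<psi> \<in> borel_measurable M" by (rule sq_intD)
  have one: "complex_of_real (sqrt c) * complex_of_real (1 / sqrt c) = 1"
    using c_pos by (simp flip: of_real_mult)
  have "AE x in M. \<forall>i\<in>I. T i (Ts i \<psi>) x = indicator (R i) x * \<psi> x"
  proof (rule AE_finite_allI[OF finite_I])
    fix i assume i: "i \<in> I"
    show "AE x in M. T i (Ts i \<psi>) x = indicator (R i) x * \<psi> x"
      using g_\<sigma>[OF i] \<tau>_\<sigma>[OF i \<psi>]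
    proof eventually_elim
      case (elim x)
      show ?case
      proof (cases "x \<in> R i")
        case True
        with elim have "T i (Ts i \<psi>) x = complex_of_real (sqrt c) * complex_of_real (1 / sqrt c) * \<psi> x"
          by (simp add: T_def Ts_def)
        with True one show ?thesis by simp
      qed (simp add: T_def)
    qed
  qed
  with R_partition show "AE x in M. (\<Sum>i\<in>I. T i (Ts i \<psi>) x) = \<psi> x"
    by eventually_elim (simp add: sum_distrib_right[symmetric])
qed

lemma cuntz_ops: "cuntz_ops M I T Ts"
proof
  show "T i (\<lambda>x. \<phi> x + \<psi> x) = (\<lambda>x. T i \<phi> x + T i \<psi> x)" for i \<phi> \<psi>
    by (simp add: T_def fun_eq_iff distrib_left)
  show "Ts i (\<lambda>x. \<phi> x + \<psi> x) = (\<lambda>x. Ts i \<phi> x + Ts i \<psi> x)" for i \<phi> \<psi>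
    by (simp add: Ts_def fun_eq_iff distrib_left)
  show "T i (\<lambda>x. a * \<psi> x) = (\<lambda>x. a * T i \<psi> x)" for i a \<psi>
    by (simp add: T_def fun_eq_iff mult_ac)
  show "Ts i (\<lambda>x. a * \<psi> x) = (\<lambda>x. a * Ts i \<psi> x)" for i a \<psi>
    by (simp add: Ts_def fun_eq_iff mult_ac)
qed (fact finite_I T_sq_int Ts_sq_int T_adjoint Ts_T sum_T_Ts)+

end

section \<open>The representation on the fractal\<close>

context sierp
begin

lemma distr_sierp_map:
  assumes ij: "ij \<in> allowed N A"
  shows "distr \<mu> \<mu> (sierp_map N ij) = density \<mu> (\<lambda>x. ennreal (real D * indicator (sierp_map N ij ` K) x))"
proof (rule measure_eqI)
  fix E assume "E \<in> sets (distr \<mu> \<mu> (sierp_map N ij))"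
  then have E: "E \<in> sets \<mu>" by simp
  let ?B = "sierp_map N ij -` E \<inter> space \<mu>"
  have R [measurable]: "sierp_map N ij ` K \<in> sets \<mu>" by (rule sierp_map_sets[OF ij K_sets])
  have B: "?B \<in> sets \<mu>" by (rule measurable_sets[OF sierp_map_measurable_\<mu>[OF ij] E])
  have "sierp_map N ij ` ?B = E \<inter> sierp_map N ij ` K" by auto
  with emeasure_sierp_map[OF ij B] have "emeasure \<mu> (E \<inter> sierp_map N ij ` K) = emeasure \<mu> ?B / of_nat D"
    by simp
  then have "of_nat D * emeasure \<mu> (E \<inter> sierp_map N ij ` K) = emeasure \<mu> ?B"
    using D_pos mult_divide_eq_ennreal[of "of_nat D" "emeasure \<mu> ?B"]
    by (simp add: ennreal_times_divide mult.commute)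
  moreover have "emeasure (density \<mu> (\<lambda>x. ennreal (real D * indicator (sierp_map N ij ` K) x))) E
      = of_nat D * emeasure \<mu> (E \<inter> sierp_map N ij ` K)"
  proof -
    have "emeasure (density \<mu> (\<lambda>x. ennreal (real D * indicator (sierp_map N ij ` K) x))) E
        = (\<integral>\<^sup>+x. of_nat D * indicator (E \<inter> sierp_map N ij ` K) x \<partial>\<mu>)"
      using E by (subst emeasure_density)
        (auto simp: ennreal_of_nat_eq_real_of_nat split: split_indicator intro!: nn_integral_cong)
    also have "\<dots> = of_nat D * emeasure \<mu> (E \<inter> sierp_map N ij ` K)"
      using E R by (intro nn_integral_cmult_indicator) auto
    finally show ?thesis .
  qed
  ultimately show "emeasure (distr \<mu> \<mu> (sierp_map N ij)) E
      = emeasure (density \<mu> (\<lambda>x. ennreal (real D * indicator (sierp_map N ij ` K) x))) E"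
    using E by (simp add: emeasure_distr[OF sierp_map_measurable_\<mu>[OF ij] E])
qed simp

lemma ranges_partition: "AE x in \<mu>. (\<Sum>ij\<in>allowed N A. indicator (sierp_map N ij ` K) x) = (1 :: complex)"
proof -
  have null: "AE x in \<mu>. x \<notin> sierp_map N i ` K \<inter> sierp_map N j ` K"
    if "i \<in> allowed N A" "j \<in> allowed N A - {i}" for i j
    using that by (intro AE_not_in null_setsI overlap_null sets.Int sierp_map_sets K_sets) auto
  have "AE x in \<mu>. \<forall>i\<in>allowed N A. \<forall>j\<in>allowed N A - {i}. x \<notin> sierp_map N i ` K \<inter> sierp_map N j ` K"
    by (intro AE_finite_allI null finite_Diff finite_allowed)
  moreover have "AE x in \<mu>. x \<in> K" by (rule AE_I2) simp
  ultimately show ?thesis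
  proof eventually_elim
    case (elim x)
    from elim(2) have "x \<in> (\<Union>ij\<in>allowed N A. sierp_map N ij ` K)" by (subst (asm) K_Union)
    then obtain i where i: "i \<in> allowed N A" "x \<in> sierp_map N i ` K" by (rule UN_E)
    have "(\<Sum>ij\<in>allowed N A. indicator (sierp_map N ij ` K) x) = (\<Sum>ij\<in>allowed N A. if ij = i then 1 else (0 :: complex))"
    proof (rule sum.cong[OF refl])
      fix ij assume ij: "ij \<in> allowed N A"
      show "indicator (sierp_map N ij ` K) x = (if ij = i then 1 else (0 :: complex))"
      proof (cases "ij = i")
        case False
        with ij have "x \<notin> sierp_map N i ` K \<inter> sierp_map N ij ` K"
          by (intro bspec[OF bspec[OF elim(1) i(1)]]) blast
        with i(2) False show ?thesis by simp
      qed (use i(2) in simp)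
    qed
    then show ?case using i(1) by simp
  qed
qed

lemma uniform_branching_sierp:
  assumes \<sigma>: "is_digit_shift N A \<sigma>" "\<sigma> \<in> measurable \<mu> \<mu>"
  shows "uniform_branching \<mu> (allowed N A) (sierp_map N) \<sigma> (\<lambda>ij. sierp_map N ij ` K) (real D)
    (\<lambda>ij y. enn2real (sbfs_deriv \<mu> K (sierp_map N ij) y) powr (-1/2))"
proof -
  interpret finite_measure \<mu> by (rule finite_measure_\<mu>)
  show ?thesis
  proof
    fix ij assume ij: "ij \<in> allowed N A"
    show "sierp_map N ij ` K \<in> sets \<mu>" by (rule sierp_map_sets[OF ij K_sets])
    show "(\<lambda>y. enn2real (sbfs_deriv \<mu> K (sierp_map N ij) y) powr (-1/2)) \<in> borel_measurable \<mu>"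
      unfolding sbfs_deriv_def by measurable
    have "(1 / real D) powr (-1/2) = sqrt (real D)"
      using D_pos by (simp add: powr_minus powr_divide powr_half_sqrt)
    then show "AE x in \<mu>. enn2real (sbfs_deriv \<mu> K (sierp_map N ij) x) powr (-1/2) = sqrt (real D)"
      using sbfs_deriv_sierp_map[OF ij] by (auto elim!: eventually_mono)
  qed (use D_pos in \<open>auto intro: sierp_map_measurable_\<mu> \<sigma> distr_sierp_map digit_shift_AE ranges_partition\<close>)
qed

lemma cuntz_family_sierp:
  assumes \<sigma>: "is_digit_shift N A \<sigma>" "\<sigma> \<in> measurable \<mu> \<mu>"
  defines "T \<equiv> sbfs_op \<mu> (\<lambda>_. K) (sierp_map N) \<sigma>"
  shows "l2_cuntz_family \<mu> (allowed N A) T"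
    and "cuntz_algebra cscale adj (allowed N A) S \<Longrightarrow>
      \<exists>\<pi>. l2_representation cscale adj \<mu> \<pi> \<and> (\<forall>ij\<in>allowed N A. l2_eq \<mu> (\<pi> (S ij)) (T ij)) \<and>
        (\<forall>\<pi>'. l2_representation cscale adj \<mu> \<pi>' \<and> (\<forall>ij\<in>allowed N A. l2_eq \<mu> (\<pi>' (S ij)) (T ij)) \<longrightarrow>
           (\<forall>a. l2_eq \<mu> (\<pi>' a) (\<pi> a)))"
proof -
  interpret B: uniform_branching \<mu> "allowed N A" "sierp_map N" \<sigma> "\<lambda>ij. sierp_map N ij ` K" "real D"
    "\<lambda>ij y. enn2real (sbfs_deriv \<mu> K (sierp_map N ij) y) powr (-1/2)"
    by (rule uniform_branching_sierp[OF \<sigma>])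
  have T: "T = B.T"
    by (intro ext) (unfold T_def sbfs_op_def B.T_def, rule refl)
  interpret O: cuntz_ops \<mu> "allowed N A" B.T B.Ts by (rule B.cuntz_ops)
  show "l2_cuntz_family \<mu> (allowed N A) T"
    unfolding T by (rule O.l2_cuntz_family_T)
  assume "cuntz_algebra cscale adj (allowed N A) S"
  then interpret R: cuntz_ops_algebra \<mu> "allowed N A" B.T B.Ts cscale adj S
    by (intro cuntz_ops_algebra.intro O.cuntz_ops_axioms)
  show "\<exists>\<pi>. l2_representation cscale adj \<mu> \<pi> \<and> (\<forall>ij\<in>allowed N A. l2_eq \<mu> (\<pi> (S ij)) (T ij)) \<and>
        (\<forall>\<pi>'. l2_representation cscale adj \<mu> \<pi>' \<and> (\<forall>ij\<in>allowed N A. l2_eq \<mu> (\<pi>' (S ij)) (T ij)) \<longrightarrow>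
           (\<forall>a. l2_eq \<mu> (\<pi>' a) (\<pi> a)))"
    unfolding T
  proof (intro exI[of _ R.rep] conjI ballI allI impI)
    show "l2_representation cscale adj \<mu> R.rep" by (rule R.l2_representation_rep)
    show "l2_eq \<mu> (R.rep (S ij)) (B.T ij)" if "ij \<in> allowed N A" for ij
      using that by (rule R.rep_generator)
    show "l2_eq \<mu> (\<pi>' a) (R.rep a)"
      if "l2_representation cscale adj \<mu> \<pi>' \<and> (\<forall>ij\<in>allowed N A. l2_eq \<mu> (\<pi>' (S ij)) (B.T ij))" for \<pi>' a
      using conjunct1[OF that] bspec[OF conjunct2[OF that]] by (rule R.rep_unique)
  qed
qed

lemma coding_map_sierp:
  assumes "is_digit_shift N A \<sigma>" "\<sigma> \<in> measurable \<mu> \<mu>"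
  shows "coding_map \<mu> (allowed N A) (\<lambda>_. K) (sierp_map N) \<sigma>"
  unfolding coding_map_def
proof (intro conjI ballI assms(2))
  fix ij assume "ij \<in> allowed N A"
  from digit_shift_AE[OF assms(1) this] show "AE x in \<mu>. x \<in> K \<longrightarrow> \<sigma> (sierp_map N ij x) = x"
    by eventually_elim simp
qed

end

lemma card_allowed: "card (allowed N A) = sierp_D N A"
proof -
  have "allowed N A = (SIGMA i:{..<N}. {j. j < N \<and> A i j = 1})"
    by (auto simp: allowed_def)
  then show ?thesis by (simp add: sierp_D_def)
qed

theorem lemma2p23:
  fixes N :: nat and A :: "nat \<Rightarrow> nat \<Rightarrow> nat" and \<delta> :: real
    and \<mu> :: "(real \<times> real) measure"
    and cscale :: "complex \<Rightarrow> 'c::{real_normed_algebra_1, banach} \<Rightarrow> 'c"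
    and adj :: "'c \<Rightarrow> 'c" and S :: "nat \<times> nat \<Rightarrow> 'c"
  assumes "2 \<le> N"
    and "\<forall>i<N. \<forall>j<N. A i j \<in> {0, 1}"
    and "0 < sierp_D N A"
    and "\<delta> = ln (real (sierp_D N A)) / (2 * ln (real N))"
    and "\<mu> = restrict_space (hausdorff_measure (2 * \<delta>)) (sierpinski N A)"
  shows "hausdorff_dim_wrt diam_area (sierpinski N A) = ereal \<delta>
       \<and> (hausdorff_measure_wrt diam_area \<delta> :: (real \<times> real) measure) = hausdorff_measure (2 * \<delta>)
       \<and> hausdorff_dim (sierpinski N A) = ereal (2 * \<delta>)
       \<and> card (allowed N A) = sierp_D N A
       \<and> (\<forall>ij\<in>allowed N A. sierp_map N ij ` sierpinski N A \<subseteq> sierpinski N A)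
       \<and> semibranching_system \<mu> (allowed N A) (\<lambda>_. sierpinski N A) (sierp_map N)
       \<and> (\<exists>\<sigma>. is_digit_shift N A \<sigma> \<and> \<sigma> \<in> measurable \<mu> \<mu>)
       \<and> (\<forall>\<sigma>. is_digit_shift N A \<sigma> \<and> \<sigma> \<in> measurable \<mu> \<mu> \<longrightarrow>
            coding_map \<mu> (allowed N A) (\<lambda>_. sierpinski N A) (sierp_map N) \<sigma> \<and>
            (let T = sbfs_op \<mu> (\<lambda>_. sierpinski N A) (sierp_map N) \<sigma> in
              l2_cuntz_family \<mu> (allowed N A) T \<and>
              (cuntz_algebra cscale adj (allowed N A) S \<longrightarrow>
                (\<exists>\<pi>. l2_representation cscale adj \<mu> \<pi> \<and>
                     (\<forall>ij\<in>allowed N A. l2_eq \<mu> (\<pi> (S ij)) (T ij)) \<and>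
                     (\<forall>\<pi>'. l2_representation cscale adj \<mu> \<pi>' \<and>
                           (\<forall>ij\<in>allowed N A. l2_eq \<mu> (\<pi>' (S ij)) (T ij)) \<longrightarrow>
                           (\<forall>a. l2_eq \<mu> (\<pi>' a) (\<pi> a)))))))"
proof -
  have "allowed N A \<noteq> {}"
    using card_allowed[of N A] assms(3) by auto
  then interpret sierp N A
    using assms(1) by unfold_locales
  have D: "D = sierp_D N A" by (simp add: D_def card_allowed)
  have s: "2 * \<delta> = s" by (simp add: assms(4) s_def D)
  then have s2: "s / 2 = \<delta>" by simp
  have \<mu>: "\<mu> = sierp.\<mu> N A" by (simp add: assms(5) s \<mu>_def)
  note dims = hausdorff_dim_eqI[OF s_nonneg hausdorff_outer_K_pos hausdorff_outer_K_finite]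
  show ?thesis
    unfolding \<mu> Let_def
  proof (intro conjI allI impI)
    show "hausdorff_dim_wrt diam_area K = ereal \<delta>" using dims(2) unfolding s2 .
    show "hausdorff_dim K = ereal (2 * \<delta>)" using dims(1) unfolding s .
    show "(hausdorff_measure_wrt diam_area \<delta> :: (real \<times> real) measure) = hausdorff_measure (2 * \<delta>)"
      by (rule hausdorff_measure_diam_area)
    show "card (allowed N A) = sierp_D N A" by (rule card_allowed)
    show "\<forall>ij\<in>allowed N A. sierp_map N ij ` K \<subseteq> K"
      by (intro ballI image_subsetI sierp_map_K)
    show "semibranching_system (sierp.\<mu> N A) (allowed N A) (\<lambda>_. K) (sierp_map N)"
      by (rule semibranching_sierp)
    show "\<exists>\<sigma>. is_digit_shift N A \<sigma> \<and> \<sigma> \<in> measurable (sierp.\<mu> N A) (sierp.\<mu> N A)"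
      by (rule digit_shift_exists)
  next
    fix \<sigma>
    assume "is_digit_shift N A \<sigma> \<and> \<sigma> \<in> measurable (sierp.\<mu> N A) (sierp.\<mu> N A)"
    then have \<sigma>: "is_digit_shift N A \<sigma>" "\<sigma> \<in> measurable (sierp.\<mu> N A) (sierp.\<mu> N A)" by auto
    show "coding_map (sierp.\<mu> N A) (allowed N A) (\<lambda>_. K) (sierp_map N) \<sigma>"
      by (rule coding_map_sierp[OF \<sigma>])
    show "l2_cuntz_family (sierp.\<mu> N A) (allowed N A) (sbfs_op (sierp.\<mu> N A) (\<lambda>_. K) (sierp_map N) \<sigma>)"
      by (rule cuntz_family_sierp(1)[OF \<sigma>])
    assume "cuntz_algebra cscale adj (allowed N A) S"
    from cuntz_family_sierp(2)[OF \<sigma> this]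
    show "\<exists>\<pi>. l2_representation cscale adj (sierp.\<mu> N A) \<pi> \<and>
        (\<forall>ij\<in>allowed N A. l2_eq (sierp.\<mu> N A) (\<pi> (S ij)) (sbfs_op (sierp.\<mu> N A) (\<lambda>_. K) (sierp_map N) \<sigma> ij)) \<and>
        (\<forall>\<pi>'. l2_representation cscale adj (sierp.\<mu> N A) \<pi>' \<and>
          (\<forall>ij\<in>allowed N A. l2_eq (sierp.\<mu> N A) (\<pi>' (S ij)) (sbfs_op (sierp.\<mu> N A) (\<lambda>_. K) (sierp_map N) \<sigma> ij)) \<longrightarrow>
          (\<forall>a. l2_eq (sierp.\<mu> N A) (\<pi>' a) (\<pi> a)))" .
  qed
qed

end
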